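(* Let $\mathfrak g$ be a symmetrizable Kac-Moody Lie algebra, fix a Coxeter quiver $Q(\mathfrak g)$ and an integer $m\ge 2$, and let $Q_m(\mathfrak g)$ be the associated weighted quiver. (1) There is an injective group homomorphism $\phi_m: W(\mathfrak g)\to P_{Q_m(\mathfrak g)}$ into the peripheral subgroup of the cluster modular group $\Gamma_{Q_m(\mathfrak g)}$ with $\phi_m(r_s)=R(s)$ for all $s\in S$. (2) There is a $W(\mathfrak g)$-equivariant embedding of abelian groups $\iota: L(\mathfrak g)\to Z(\mathcal X_{Q_m(\mathfrak g)})$ of the root lattice $L(\mathfrak g)=\bigoplus_{s\in S}\mathbb Z\alpha_s$ into the group of monomial Poisson Casimirs, i.e. $\phi_m(w)^*(\iota(v))=\iota(w^{-1}v)$ for all $w\in W(\mathfrak g)$, $v\in L(\mathfrak g)$.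
   Context: Cluster conventions. A weighted quiver $Q$ with finite vertex set $I$ (here no frozen vertices) consists of positive integers $d_i$ and an integral skew-symmetric matrix $\sigma_{ij}=\#\{i\to j\}-\#\{j\to i\}$; its exchange matrix is $\varepsilon_{ij}=\sigma_{ij}d_i/\gcd(d_i,d_j)$. A seed is $(Q,\mathbf X,\mathbf A)$ with $\mathbf X=(X_i)_{i\in I}$, $\mathbf A=(A_i)_{i\in I}$ tuples of algebraically independent elements of a field of rational functions. The mutation $\mu_k$ keeps $d$ and sends $\varepsilon,\mathbf X,\mathbf A$ to: $\varepsilon'_{ij}=-\varepsilon_{ij}$ if $k\in\{i,j\}$, $\varepsilon'_{ij}=\varepsilon_{ij}+\frac{|\varepsilon_{ik}|\varepsilon_{kj}+\varepsilon_{ik}|\varepsilon_{kj}|}{2}$ otherwise; $X'_k=X_k^{-1}$, $X'_i=X_i(1+X_k^{-\mathrm{sgn}(\varepsilon_{ik})})^{-\varepsilon_{ik}}$ for $i\ne k$; $A'_k=A_k^{-1}(\prod_{\varepsilon_{kj}>0}A_j^{\varepsilon_{kj}}+\prod_{\varepsilon_{kj}<0}A_j^{-\varepsilon_{kj}})$, $A'_i=A_i$ for $i\neq k$. A seed permutation $\pi$ of $I$ sends $(\varepsilon_{ij},d_i,X_i,A_i)$ to $(\varepsilon_{\pi^{-1}(i)\pi^{-1}(j)},d_{\pi^{-1}(i)},X_{\pi^{-1}(i)},A_{\pi^{-1}(i)})$. A mutation sequence is a finite composition (applied right to left) of mutations and seed permutations. The cluster modular group $\Gamma_Q$ is the group of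 mutation sequences $\phi$ with $\phi(Q)=Q$, modulo those preserving the seed. If $\phi(Q,\mathbf X,\mathbf A)=(Q,\mathbf X',\mathbf A')$, write $\phi^*X_i=X'_i$, $\phi^*A_i=A'_i$, extended to automorphisms of $\mathbb C(\mathbf X)$ and $\mathbb C(\mathbf A)$; then $(\phi\psi)^*=\psi^*\phi^*$. Let $p^*(X_k)=\prod_{i}A_i^{\varepsilon_{ki}}$. The peripheral subgroup $P_Q\subset\Gamma_Q$ consists of $\phi$ with $\phi^*(p^*(X_k))=p^*(X_k)$ for all $k$. The group of monomial Poisson Casimirs $Z(\mathcal X_Q)$ is the multiplicative group of Laurent monomials $\prod_iX_i^{\beta_i}$ ($\beta\in\mathbb Z^I$) with $\sum_i\beta_i\varepsilon_{ij}d_j=0$ for all $j$, i.e. Casimirs of the Poisson bracket $\{X_i,X_j\}=\varepsilon_{ij}d_jX_iX_j$. Kac-Moody data. $C=(C_{st})_{s,t\in S}$ is a generalized Cartan matrix on a finite set $S$, symmetrizable by positive integers $d_s$ with $\gcd(d_s)=1$ and $d_sC_{st}=d_tC_{ts}$; $\mathfrak g$ is the corresponding Kac-Moody algebra with simple roots $\alpha_s$ and simple coroots $\alpha_s^\vee$, $\langle\alpha_s^\vee,\alpha_t\rangle=C_{st}$. The Weyl group $W(\mathfrak g)$ is generated by $r_s$, $r_s\alpha_t=\alpha_t-C_{st}\alpha_s$. A Coxeter quiver $Q(\mathfrak g)$ is a weighted quiver with vertex set $S$, weights $d_s$ and exchange matrix with $|\varepsilon_{st}|=-C_{ts}$ for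 $s\ne t$; let $\sigma_{st}$ be its signed arrow numbers. For $m\ge2$, $Q_m(\mathfrak g)$ has vertices $v_i^s$ ($s\in S$, $i\in\mathbb Z_m=\mathbb Z/m\mathbb Z$) of weight $d_s$, an arrow $v_i^s\to v_{i+1}^s$ for all $s,i$ (for $m=2$ these cancel), and, whenever $\sigma_{st}\ge1$, $\sigma_{st}$ arrows $v_i^s\to v_i^t$ and $\sigma_{st}$ arrows $v_{i+1}^t\to v_i^s$ for all $i$. The elements $R(s)$. Write $\mu_i^s$ for mutation at $v_i^s$ and $(v,v')$ for the transposition of two vertices. For $s\in S$, $i\in\mathbb Z_m$ put $M_i^s=\mu^s_{m+i-3}\mu^s_{m+i-4}\cdots\mu^s_{i+1}\mu^s_i$ (empty for $m=2$) and $R(s,i)=(M_i^s)^{-1}\circ(v^s_{m+i-2},v^s_{m+i-1})\circ\mu^s_{m+i-1}\mu^s_{m+i-2}\circ M_i^s$. It preserves $Q_m(\mathfrak g)$ and its class in $\Gamma_{Q_m(\mathfrak g)}$ does not depend on $i$; it is denoted $R(s)$. *)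

theory Defs
  imports
    Complex_Main
    "HOL-Library.Poly_Mapping"
    "HOL-Computational_Algebra.Fraction_Field"
    "HOL-Combinatorics.Permutations"
    "HOL-Algebra.Bij"
    "HOL-Algebra.Generated_Groups"
begin

section \<open>Rational functions over the complex numbers\<close>

text \<open>
  The finitely supported functions of \<^theory>\<open>HOL-Library.Poly_Mapping\<close> are known to be an
  integral domain only when the variables carry a linear order.  The copy below is an integral
  domain for every type \<^typ>\<open>'v\<close> of variables, so that its fraction field can be formed.
\<close>

typedef 'v mpoly = "UNIV :: (('v \<Rightarrow>\<^sub>0 nat) \<Rightarrow>\<^sub>0 complex) set"
  morphisms poly_map Mpoly ..

setup_lifting type_definition_mpoly

instantiation mpoly :: (type) comm_ring_1
begin
lift_definition zero_mpoly :: "'a mpoly" is 0 .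
lift_definition one_mpoly :: "'a mpoly" is 1 .
lift_definition plus_mpoly :: "'a mpoly \<Rightarrow> 'a mpoly \<Rightarrow> 'a mpoly" is "(+)" .
lift_definition minus_mpoly :: "'a mpoly \<Rightarrow> 'a mpoly \<Rightarrow> 'a mpoly" is "(-)" .
lift_definition uminus_mpoly :: "'a mpoly \<Rightarrow> 'a mpoly" is "uminus" .
lift_definition times_mpoly :: "'a mpoly \<Rightarrow> 'a mpoly \<Rightarrow> 'a mpoly" is "(*)" .
instance
  by standard (transfer; simp add: algebra_simps)+
end

lemma lookup_mult_isolated:
  fixes p q :: "'k::monoid_add \<Rightarrow>\<^sub>0 'b::semiring_0"
  assumes only: "\<And>a b. a \<in> Poly_Mapping.keys p \<Longrightarrow> b \<in> Poly_Mapping.keys q \<Longrightarrow> a + b = k + l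
      \<Longrightarrow> a = k \<and> b = l"
  shows "Poly_Mapping.lookup (p * q) (k + l) = Poly_Mapping.lookup p k * Poly_Mapping.lookup q l"
proof -
  have "Poly_Mapping.lookup (p * q) (k + l) =
      Sum_any (\<lambda>(a, b). Poly_Mapping.lookup p a * Poly_Mapping.lookup q b when k + l = a + b)"
    by (simp add: times_poly_mapping.rep_eq prod_fun_unfold_prod)
  also have "\<dots> = Sum_any (\<lambda>ab. Poly_Mapping.lookup p k * Poly_Mapping.lookup q l when ab = (k, l))"
  proof (rule arg_cong[where f = Sum_any], rule ext, clarify)
    fix a b
    show "(Poly_Mapping.lookup p a * Poly_Mapping.lookup q b when k + l = a + b) =
        (Poly_Mapping.lookup p k * Poly_Mapping.lookup q l when (a, b) = (k, l))"
    proof (cases "a \<in> Poly_Mapping.keys p \<and> b \<in> Poly_Mapping.keys q")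
      case True
      then have "k + l = a + b \<longleftrightarrow> (a, b) = (k, l)"
        using only[of a b] by (metis prod.inject)
      then show ?thesis
        by (simp add: when_def)
    next
      case False
      then have "Poly_Mapping.lookup p a * Poly_Mapping.lookup q b = 0"
        by (auto simp: in_keys_iff)
      then show ?thesis
        by (auto simp: when_def)
    qed
  qed
  also have "\<dots> = Poly_Mapping.lookup p k * Poly_Mapping.lookup q l"
    by simp
  finally show ?thesis .
qed

lemma complex_poly_mapping_no_zero_divisors:
  fixes p q :: "('v \<Rightarrow>\<^sub>0 nat) \<Rightarrow>\<^sub>0 complex"
  assumes "p \<noteq> 0" "q \<noteq> 0"
  shows "p * q \<noteq> 0"
proof -
  define V where "V = (\<Union>a \<in> Poly_Mapping.keys p \<union> Poly_Mapping.keys q. Poly_Mapping.keys a)"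
  have finV: "finite V" by (simp add: V_def)
  then obtain f :: "'v \<Rightarrow> nat" where f: "inj_on f V"
    using finite_imp_inj_to_nat_seg by blast
  define h :: "('v \<Rightarrow>\<^sub>0 nat) \<Rightarrow> (nat \<Rightarrow>\<^sub>0 nat)"
    where "h a = (\<Sum>v\<in>V. Poly_Mapping.single (f v) (Poly_Mapping.lookup a v))" for a
  have h_add: "h (a + b) = h a + h b" for a b
    by (simp add: h_def lookup_add single_add sum.distrib)
  have h_lookup: "Poly_Mapping.lookup (h a) (f v) = Poly_Mapping.lookup a v" if "v \<in> V" for a v
  proof -
    have "Poly_Mapping.lookup (h a) (f v) = (\<Sum>w\<in>V. Poly_Mapping.lookup a w when f w = f v)"
      by (simp add: h_def lookup_sum lookup_single)
    also have "\<dots> = (\<Sum>w\<in>V. if w = v then Poly_Mapping.lookup a w else 0)"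
      using f that by (intro sum.cong) (auto simp: when_def inj_on_def)
    also have "\<dots> = Poly_Mapping.lookup a v"
      using finV that by simp
    finally show ?thesis .
  qed
  have h_inj: "a = b" if "a \<in> Poly_Mapping.keys p \<union> Poly_Mapping.keys q"
      "b \<in> Poly_Mapping.keys p \<union> Poly_Mapping.keys q" "h a = h b" for a b
  proof (rule poly_mapping_eqI)
    fix v
    show "Poly_Mapping.lookup a v = Poly_Mapping.lookup b v"
    proof (cases "v \<in> V")
      case True
      then show ?thesis using h_lookup[of v a] h_lookup[of v b] that(3) by simp
    next
      case False
      then have "v \<notin> Poly_Mapping.keys a" "v \<notin> Poly_Mapping.keys b" using that by (auto simp: V_def)
      then show ?thesis by (simp add: in_keys_iff)
    qed
  qed
  have top: "\<exists>k \<in> Poly_Mapping.keys r. \<forall>a \<in> Poly_Mapping.keys r. h a \<le> h k"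
    if "r \<noteq> 0" for r :: "('v \<Rightarrow>\<^sub>0 nat) \<Rightarrow>\<^sub>0 complex"
  proof -
    have "Max (h ` Poly_Mapping.keys r) \<in> h ` Poly_Mapping.keys r"
      using that by (intro Max_in) auto
    then obtain k where "k \<in> Poly_Mapping.keys r" "Max (h ` Poly_Mapping.keys r) = h k" by blast
    then show ?thesis by (metis Max_ge finite_imageI finite_keys imageI)
  qed
  obtain k where k: "k \<in> Poly_Mapping.keys p" "\<And>a. a \<in> Poly_Mapping.keys p \<Longrightarrow> h a \<le> h k"
    using top[OF assms(1)] by blast
  obtain l where l: "l \<in> Poly_Mapping.keys q" "\<And>b. b \<in> Poly_Mapping.keys q \<Longrightarrow> h b \<le> h l"
    using top[OF assms(2)] by blast
  have "Poly_Mapping.lookup (p * q) (k + l) = Poly_Mapping.lookup p k * Poly_Mapping.lookup q l"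
  proof (rule lookup_mult_isolated)
    fix a b assume ab: "a \<in> Poly_Mapping.keys p" "b \<in> Poly_Mapping.keys q" "a + b = k + l"
    have sum: "h a + h b = h k + h l" using ab(3) by (metis h_add)
    have "h a = h k"
    proof (rule ccontr)
      assume "h a \<noteq> h k"
      then have "h a < h k" using k(2)[OF ab(1)] by simp
      then have "h a + h b < h k + h l" using l(2)[OF ab(2)] by (rule add_less_le_mono)
      then show False using sum by simp
    qed
    moreover from this have "h b = h l" using sum by simp
    ultimately show "a = k \<and> b = l" using h_inj ab k(1) l(1) by blast
  qed
  also have "\<dots> \<noteq> 0" using k(1) l(1) by (simp add: in_keys_iff)
  finally show ?thesis by auto
qed

instance mpoly :: (type) idom
proof
  fix a b :: "'a mpoly"
  assume "a \<noteq> 0" "b \<noteq> 0"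
  then show "a * b \<noteq> 0"
    by transfer (rule complex_poly_mapping_no_zero_divisors)
qed

type_synonym 'v ratfun = "'v mpoly fract"

definition ratfun_const :: "complex \<Rightarrow> 'v ratfun" where
  "ratfun_const c = Fract (Mpoly (Poly_Mapping.single 0 c)) 1"

definition ratfun_var :: "'v \<Rightarrow> 'v ratfun" where
  "ratfun_var v = Fract (Mpoly (Poly_Mapping.single (Poly_Mapping.single v 1) 1)) 1"

definition mpoly_eval :: "('v \<Rightarrow> 'w ratfun) \<Rightarrow> 'v mpoly \<Rightarrow> 'w ratfun" where
  "mpoly_eval x p =
     (\<Sum>a\<in>Poly_Mapping.keys (poly_map p). ratfun_const (Poly_Mapping.lookup (poly_map p) a) *
       (\<Prod>v\<in>Poly_Mapping.keys a. x v ^ Poly_Mapping.lookup a v))"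

text \<open>
  The homomorphism of fields over the complex numbers that sends each variable \<open>v\<close> to \<open>x v\<close>.  The
  value below is determined as soon as some representation of \<open>f\<close> has a denominator that does not
  vanish at \<open>x\<close>; this is always so when the \<open>x v\<close> are algebraically independent.
\<close>

definition ratfun_subst :: "('v \<Rightarrow> 'w ratfun) \<Rightarrow> 'v ratfun \<Rightarrow> 'w ratfun" where
  "ratfun_subst x f =
     (THE g. \<exists>p q. f = Fract p q \<and> mpoly_eval x q \<noteq> 0 \<and> g = mpoly_eval x p / mpoly_eval x q)"


section \<open>Weighted quivers, seeds and mutation sequences\<close>

text \<open>\<open>arr Q i j\<close> is the signed number of arrows from \<open>i\<close> to \<open>j\<close>.\<close>

record 'v wquiver =
  verts :: "'v set"
  wt :: "'v \<Rightarrow> int"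
  arr :: "'v \<Rightarrow> 'v \<Rightarrow> int"

definition weighted_quiver :: "'v wquiver \<Rightarrow> bool" where
  "weighted_quiver Q \<longleftrightarrow> finite (verts Q) \<and> (\<forall>i\<in>verts Q. wt Q i > 0) \<and>
     (\<forall>i\<in>verts Q. \<forall>j\<in>verts Q. arr Q i j = - arr Q j i)"

definition exchange :: "'v wquiver \<Rightarrow> 'v \<Rightarrow> 'v \<Rightarrow> int" where
  "exchange Q i j = arr Q i j * (wt Q i div gcd (wt Q i) (wt Q j))"

text \<open>
  Since mutation is defined on the weights and the exchange matrix, which together determine the
  weighted quiver, a seed stores these two.  Only values at elements of \<open>svert\<close> are meaningful.
\<close>

record 'v seed =
  svert :: "'v set"
  swt :: "'v \<Rightarrow> int"
  sexch :: "'v \<Rightarrow> 'v \<Rightarrow> int"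
  sX :: "'v \<Rightarrow> 'v ratfun"
  sA :: "'v \<Rightarrow> 'v ratfun"

definition initial_seed :: "'v wquiver \<Rightarrow> 'v seed" where
  "initial_seed Q = \<lparr>svert = verts Q, swt = wt Q, sexch = exchange Q, sX = ratfun_var, sA = ratfun_var\<rparr>"

definition same_quiver :: "'v seed \<Rightarrow> 'v seed \<Rightarrow> bool" where
  "same_quiver S T \<longleftrightarrow> svert S = svert T \<and> (\<forall>i\<in>svert S. swt S i = swt T i) \<and>
     (\<forall>i\<in>svert S. \<forall>j\<in>svert S. sexch S i j = sexch T i j)"

definition same_seed :: "'v seed \<Rightarrow> 'v seed \<Rightarrow> bool" where
  "same_seed S T \<longleftrightarrow> same_quiver S T \<and> (\<forall>i\<in>svert S. sX S i = sX T i \<and> sA S i = sA T i)"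

definition mutate :: "'v \<Rightarrow> 'v seed \<Rightarrow> 'v seed" where
  "mutate k S = (let e = sexch S; X = sX S; A = sA S in
     S\<lparr>sexch := (\<lambda>i j. if k = i \<or> k = j then - e i j
                 else e i j + (\<bar>e i k\<bar> * e k j + e i k * \<bar>e k j\<bar>) div 2),
       sX := (\<lambda>i. if i = k then inverse (X k)
                 else X i * (1 + X k powi (- sgn (e i k))) powi (- e i k)),
       sA := (\<lambda>i. if i = k
                 then inverse (A k) * ((\<Prod>j | j \<in> svert S \<and> e k j > 0. A j powi (e k j))
                                     + (\<Prod>j | j \<in> svert S \<and> e k j < 0. A j powi (- e k j)))
                 else A i)\<rparr>)"

definition permute_seed :: "('v \<Rightarrow> 'v) \<Rightarrow> 'v seed \<Rightarrow> 'v seed" where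
  "permute_seed \<pi> S = (let \<rho> = inv_into UNIV \<pi> in
     S\<lparr>swt := (\<lambda>i. swt S (\<rho> i)), sexch := (\<lambda>i j. sexch S (\<rho> i) (\<rho> j)),
       sX := (\<lambda>i. sX S (\<rho> i)), sA := (\<lambda>i. sA S (\<rho> i))\<rparr>)"

datatype 'v step = Mut 'v | Perm "'v \<Rightarrow> 'v"

text \<open>A composition of steps is the list of its factors; the last element is applied first.\<close>

type_synonym 'v mseq = "'v step list"

fun apply_step :: "'v step \<Rightarrow> 'v seed \<Rightarrow> 'v seed" where
  "apply_step (Mut k) = mutate k"
| "apply_step (Perm \<pi>) = permute_seed \<pi>"

definition apply_seq :: "'v mseq \<Rightarrow> 'v seed \<Rightarrow> 'v seed" where
  "apply_seq \<phi> S = foldr apply_step \<phi> S"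

fun step_on :: "'v set \<Rightarrow> 'v step \<Rightarrow> bool" where
  "step_on I (Mut k) \<longleftrightarrow> k \<in> I"
| "step_on I (Perm \<pi>) \<longleftrightarrow> \<pi> permutes I"

text \<open>Mutations are involutive.\<close>

fun step_inv :: "'v step \<Rightarrow> 'v step" where
  "step_inv (Mut k) = Mut k"
| "step_inv (Perm \<pi>) = Perm (inv_into UNIV \<pi>)"

definition seq_inv :: "'v mseq \<Rightarrow> 'v mseq" where
  "seq_inv \<phi> = rev (map step_inv \<phi>)"


section \<open>The cluster modular group\<close>

definition quiver_preserving :: "'v wquiver \<Rightarrow> 'v mseq set" where
  "quiver_preserving Q = {\<phi>. (\<forall>s\<in>set \<phi>. step_on (verts Q) s) \<and>
     same_quiver (apply_seq \<phi> (initial_seed Q)) (initial_seed Q)}"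

definition seed_preserving :: "'v wquiver \<Rightarrow> 'v mseq set" where
  "seed_preserving Q = {\<phi> \<in> quiver_preserving Q.
     same_seed (apply_seq \<phi> (initial_seed Q)) (initial_seed Q)}"

definition cmg_rel :: "'v wquiver \<Rightarrow> ('v mseq \<times> 'v mseq) set" where
  "cmg_rel Q = {(\<phi>, \<psi>). \<phi> \<in> quiver_preserving Q \<and> \<psi> \<in> quiver_preserving Q \<and>
     seq_inv \<phi> @ \<psi> \<in> seed_preserving Q}"

definition cmg_class :: "'v wquiver \<Rightarrow> 'v mseq \<Rightarrow> 'v mseq set" where
  "cmg_class Q \<phi> = cmg_rel Q `` {\<phi>}"

definition cluster_modular_group :: "'v wquiver \<Rightarrow> 'v mseq set monoid" where
  "cluster_modular_group Q =
     \<lparr>carrier = quiver_preserving Q // cmg_rel Q,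
      mult = (\<lambda>a b. \<Union>\<phi>\<in>a. \<Union>\<psi>\<in>b. cmg_class Q (\<phi> @ \<psi>)),
      one = cmg_class Q []\<rparr>"

text \<open>
  \<open>pullback_X Q c\<close> and \<open>pullback_A Q c\<close> are the automorphisms induced by a class \<open>c\<close> of mutation
  sequences; all its representatives lead to the same seed.
\<close>

definition pullback_X :: "'v wquiver \<Rightarrow> 'v mseq set \<Rightarrow> 'v ratfun \<Rightarrow> 'v ratfun" where
  "pullback_X Q c = ratfun_subst (sX (apply_seq (SOME \<phi>. \<phi> \<in> c) (initial_seed Q)))"

definition pullback_A :: "'v wquiver \<Rightarrow> 'v mseq set \<Rightarrow> 'v ratfun \<Rightarrow> 'v ratfun" where
  "pullback_A Q c = ratfun_subst (sA (apply_seq (SOME \<phi>. \<phi> \<in> c) (initial_seed Q)))"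

definition p_star :: "'v wquiver \<Rightarrow> 'v \<Rightarrow> 'v ratfun" where
  "p_star Q k = (\<Prod>i\<in>verts Q. ratfun_var i powi exchange Q k i)"

definition peripheral_group :: "'v wquiver \<Rightarrow> 'v mseq set monoid" where
  "peripheral_group Q = (cluster_modular_group Q)
     \<lparr>carrier := {c \<in> carrier (cluster_modular_group Q).
        \<forall>k\<in>verts Q. pullback_A Q c (p_star Q k) = p_star Q k}\<rparr>"

definition monomial_casimirs :: "'v wquiver \<Rightarrow> 'v ratfun monoid" where
  "monomial_casimirs Q =
     \<lparr>carrier = {\<Prod>i\<in>verts Q. ratfun_var i powi \<beta> i |\<beta>.
        \<forall>j\<in>verts Q. (\<Sum>i\<in>verts Q. \<beta> i * exchange Q i j * wt Q j) = 0},
      mult = (*),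
      one = 1\<rparr>"


section \<open>Cartan matrices, root lattice and Weyl group\<close>

definition generalized_cartan :: "('s \<Rightarrow> 's \<Rightarrow> int) \<Rightarrow> bool" where
  "generalized_cartan C \<longleftrightarrow> (\<forall>s. C s s = 2) \<and> (\<forall>s t. s \<noteq> t \<longrightarrow> C s t \<le> 0) \<and>
     (\<forall>s t. C s t = 0 \<longleftrightarrow> C t s = 0)"

definition symmetrized_by :: "('s \<Rightarrow> 's \<Rightarrow> int) \<Rightarrow> ('s \<Rightarrow> int) \<Rightarrow> bool" where
  "symmetrized_by C d \<longleftrightarrow> (\<forall>s. d s > 0) \<and> Gcd (range d) = 1 \<and> (\<forall>s t. d s * C s t = d t * C t s)"

text \<open>The element \<open>v\<close> of the root lattice is the sum of the \<open>v s \<alpha>\<^sub>s\<close>.\<close>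

type_synonym 's root_vec = "'s \<Rightarrow> int"

definition root_lattice :: "'s root_vec monoid" where
  "root_lattice = \<lparr>carrier = UNIV, mult = (\<lambda>u v s. u s + v s), one = (\<lambda>_. 0)\<rparr>"

definition simple_root :: "'s \<Rightarrow> 's root_vec" where
  "simple_root s = (\<lambda>t. of_bool (t = s))"

definition simple_reflection :: "('s::finite \<Rightarrow> 's \<Rightarrow> int) \<Rightarrow> 's \<Rightarrow> 's root_vec \<Rightarrow> 's root_vec" where
  "simple_reflection C s v = (\<lambda>u. v u - (\<Sum>t\<in>UNIV. v t * C s t) * simple_root s u)"

lemma simple_reflection_simple_root:
  "simple_reflection C s (simple_root t) = (\<lambda>u. simple_root t u - C s t * simple_root s u)"
  by (simp add: simple_reflection_def simple_root_def fun_eq_iff of_bool_def if_distrib[of "\<lambda>x. x * _"]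
      cong: if_cong)

lemma simple_reflection_involution:
  assumes "generalized_cartan C"
  shows "simple_reflection C s (simple_reflection C s v) = v"
proof -
  have "(\<Sum>t\<in>UNIV. simple_reflection C s v t * C s t)
      = (\<Sum>t\<in>UNIV. v t * C s t) - (\<Sum>t\<in>UNIV. v t * C s t) * (\<Sum>t\<in>UNIV. simple_root s t * C s t)"
    by (simp add: simple_reflection_def algebra_simps sum_subtractf sum_distrib_left)
  also have "(\<Sum>t\<in>UNIV. simple_root s t * C s t) = 2"
    using assms by (simp add: simple_root_def generalized_cartan_def of_bool_def
        if_distrib[of "\<lambda>x. x * _"] cong: if_cong)
  finally show ?thesis
    by (simp add: simple_reflection_def[of C s "simple_reflection C s v"])
      (simp add: simple_reflection_def algebra_simps)
qed

text \<open>
  The Weyl group, realized by its action on the root lattice.  The simple reflections of a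
  generalized Cartan matrix do lie in the ambient group, by the lemma that follows.
\<close>

definition weyl_group :: "('s::finite \<Rightarrow> 's \<Rightarrow> int) \<Rightarrow> ('s root_vec \<Rightarrow> 's root_vec) monoid" where
  "weyl_group C = subgroup_generated (BijGroup UNIV) (range (simple_reflection C))"

lemma simple_reflection_in_BijGroup:
  assumes "generalized_cartan C"
  shows "simple_reflection C s \<in> carrier (BijGroup UNIV)"
proof -
  have "bij (simple_reflection C s)"
    by (rule o_bij[of "simple_reflection C s"])
      (simp_all add: fun_eq_iff simple_reflection_involution[OF assms])
  then show ?thesis
    by (simp add: BijGroup_def Bij_def)
qed


section \<open>The quivers of a Kac-Moody algebra and the elements R(s)\<close>

definition coxeter_quiver :: "('s::finite \<Rightarrow> 's \<Rightarrow> int) \<Rightarrow> ('s \<Rightarrow> int) \<Rightarrow> 's wquiver \<Rightarrow> bool" where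
  "coxeter_quiver C d Q \<longleftrightarrow> weighted_quiver Q \<and> verts Q = UNIV \<and> wt Q = d \<and>
     (\<forall>s t. s \<noteq> t \<longrightarrow> \<bar>exchange Q s t\<bar> = - C t s)"

text \<open>
  The vertex \<open>v\<^sup>s\<^sub>i\<close> is the pair \<open>(s, i)\<close> with \<open>i < m\<close>.  The function below counts the arrows drawn
  from \<open>v\<^sup>s\<^sub>i\<close> to \<open>v\<^sup>t\<^sub>j\<close>.  Its last summand is the family of arrows from \<open>v\<^sup>s\<^sub>j\<^sub>+\<^sub>1\<close> to \<open>v\<^sup>t\<^sub>j\<close>
  that comes from the arrows of \<open>Q\<close> from \<open>t\<close> to \<open>s\<close>.
\<close>

fun Qm_arrows :: "nat \<Rightarrow> 's wquiver \<Rightarrow> 's \<times> nat \<Rightarrow> 's \<times> nat \<Rightarrow> int" where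
  "Qm_arrows m Q (s, i) (t, j) =
     (if s = t \<and> j = Suc i mod m then 1 else 0)
   + (if arr Q s t \<ge> 1 \<and> j = i then arr Q s t else 0)
   + (if arr Q t s \<ge> 1 \<and> i = Suc j mod m then arr Q t s else 0)"

definition Qm :: "nat \<Rightarrow> 's wquiver \<Rightarrow> ('s \<times> nat) wquiver" where
  "Qm m Q = \<lparr>verts = verts Q \<times> {..<m}, wt = (\<lambda>v. wt Q (fst v)),
     arr = (\<lambda>v w. Qm_arrows m Q v w - Qm_arrows m Q w v)\<rparr>"

definition M_seq :: "nat \<Rightarrow> 's \<Rightarrow> nat \<Rightarrow> ('s \<times> nat) mseq" where
  "M_seq m s i = map (\<lambda>j. Mut (s, (i + j) mod m)) (rev [0..<m - 2])"

definition R_seq :: "nat \<Rightarrow> 's \<Rightarrow> nat \<Rightarrow> ('s \<times> nat) mseq" where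
  "R_seq m s i = (let a = (s, (m + i - 2) mod m); b = (s, (m + i - 1) mod m) in
     seq_inv (M_seq m s i) @ [Perm (transpose a b), Mut b, Mut a] @ M_seq m s i)"

end

theory Submission
  imports Defs
begin

text \<open>
  Every \<open>s\<close>-cycle of \<open>Q\<^sub>m\<close> with the triangles attached to it looks like a puncture, and by induction on
  its length \<open>R(s)\<close> acts in closed form: in terms of the sequence \<open>T\<^sub>j\<close> with
  \<open>X\<^sub>j = T\<^sub>j\<^sub>-\<^sub>1 / T\<^sub>j\<close>, quasi-periodic along the cycle, it only uses sums of \<open>m\<close> consecutive \<open>T\<^sub>j\<close>. Writing \<open>T\<close> as
  \<open>y\<^sub>j * \<Prod>t. A\<^sup>t / (A\<^sup>s\<^sub>j * A\<^sup>s\<^sub>j\<^sub>+\<^sub>1)\<close> with quasi-periodic sequences \<open>A\<^sup>s\<close> and fixed coefficients \<open>y\<close>,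
  the reflection replaces \<open>A\<^sup>s\<close> by a solution of a discrete Wronskian equation (a QQ-system).  With
  \<open>y = 1\<close> and periodic \<open>A\<close> this also describes the \<open>A\<close>-variables.  For generic multipliers the
  solution is unique, which gives the braid relation of type \<open>A\<^sub>2\<close>; types \<open>B\<^sub>2\<close> and \<open>G\<^sub>2\<close> follow by
  folding stars of type \<open>A\<^sub>3\<close> and \<open>D\<^sub>4\<close>.  Tits' argument on the signs of roots shows that these
  rank two relations suffice.  The products \<open>q\<^sub>s\<close> of the \<open>X\<close>-variables along the cycles are
  multiplied by \<open>q\<^sub>t\<close> to the power \<open>- C t s\<close> under \<open>R(t)\<close>, which is the action of the Weyl group on the
  root lattice; faithfulness of the latter gives injectivity.
\<close>

section \<open>The word problem in the Weyl group\<close>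

text \<open>Two mutation sequences agree in the cluster modular group only if both the X-variables
  and the A-variables agree, so each relation is checked twice, and the two checks are of opposite
  nature. On the X-side the multiplier of a root is a nontrivial monomial in the independent
  products q_s, hence not 1; a Wronskian carries the factor 1 - q and therefore determines the
  reflected sequence. On the A-side all multipliers are 1 and the Wronskians vanish, but then window
  sums are constant, a reflection rescales one sequence by a scalar, and the relations turn into
  identities between integer exponents. The Weyl group is given as a group of transformations,
  without a presentation, so sending r_s to R(s) makes sense only once the word problem is solved.
  Folding is needed because in types B2 and G2 the equation of one node contains the square or cube
  of the other sequence, whereas the Wronskian identities are about exponent 1; copies of that
  sequence on separate leaves make all exponents 1.\<close>

definition weyl_act :: "('s::finite \<Rightarrow> 's \<Rightarrow> int) \<Rightarrow> 's list \<Rightarrow> 's root_vec \<Rightarrow> 's root_vec" where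
  "weyl_act C u v = foldr (simple_reflection C) u v"

lemma weyl_act_Nil [simp]: "weyl_act C [] v = v"
  by (simp add: weyl_act_def)

lemma weyl_act_Cons [simp]: "weyl_act C (s # u) v = simple_reflection C s (weyl_act C u v)"
  by (simp add: weyl_act_def)

lemma weyl_act_append [simp]: "weyl_act C (u @ w) v = weyl_act C u (weyl_act C w v)"
  by (simp add: weyl_act_def)

lemma simple_reflection_linear:
  "simple_reflection C s (\<lambda>x. a * f x + b * g x)
    = (\<lambda>x. a * simple_reflection C s f x + b * simple_reflection C s g x)"
proof -
  have "(\<Sum>t\<in>UNIV. (a * f t + b * g t) * C s t)
      = a * (\<Sum>t\<in>UNIV. f t * C s t) + b * (\<Sum>t\<in>UNIV. g t * C s t)"
    by (simp add: sum_distrib_left sum.distrib algebra_simps)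
  then show ?thesis
    by (simp add: simple_reflection_def fun_eq_iff algebra_simps)
qed

lemma weyl_act_linear:
  "weyl_act C u (\<lambda>x. a * f x + b * g x) = (\<lambda>x. a * weyl_act C u f x + b * weyl_act C u g x)"
  by (induction u) (simp_all add: simple_reflection_linear)

lemma weyl_act_zero [simp]: "weyl_act C u (\<lambda>x. 0) = (\<lambda>x. 0)"
  using weyl_act_linear[of C u 0 "\<lambda>x. 0" 0 "\<lambda>x. 0"] by simp

lemma weyl_act_rev_cancel:
  assumes "generalized_cartan C"
  shows "weyl_act C (rev u) (weyl_act C u v) = v" "weyl_act C u (weyl_act C (rev u) v) = v"
proof -
  show 1: "weyl_act C (rev u) (weyl_act C u v) = v" for u v
    by (induction u arbitrary: v) (simp_all add: simple_reflection_involution[OF assms])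
  show "weyl_act C u (weyl_act C (rev u) v) = v"
    using 1[of "rev u" v] by simp
qed

text \<open>The alternating word \<^emph>\<open>ending\<close> in \<open>t\<close>.\<close>

fun braid_word :: "'a \<Rightarrow> 'a \<Rightarrow> nat \<Rightarrow> 'a list" where
  "braid_word s t 0 = []"
| "braid_word s t (Suc n) = braid_word t s n @ [t]"

lemma length_braid_word [simp]: "length (braid_word s t n) = n"
  by (induction n arbitrary: s t) simp_all

lemma braid_word_add:
  "\<exists>w. braid_word s t (k + n) = w @ braid_word s t n \<and> length w = k"
proof (induction n arbitrary: s t)
  case (Suc n)
  from Suc[of t s] show ?case by auto
qed simp

text \<open>The value \<open>0\<close> stands for infinity: the corresponding braid relation is void.\<close>

definition coxeter_exponent :: "('s \<Rightarrow> 's \<Rightarrow> int) \<Rightarrow> 's \<Rightarrow> 's \<Rightarrow> nat" where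
  "coxeter_exponent C s t = (let p = C s t * C t s in
     if p = 0 then 2 else if p = 1 then 3 else if p = 2 then 4 else if p = 3 then 6 else 0)"

section \<open>Rank two computations in the root lattice\<close>

definition root_span2 :: "'s \<Rightarrow> 's \<Rightarrow> int \<Rightarrow> int \<Rightarrow> 's root_vec" where
  "root_span2 s t a b = (\<lambda>u. a * simple_root s u + b * simple_root t u)"

lemma reflection_root_span2:
  assumes "generalized_cartan C"
  shows "simple_reflection C s (root_span2 s t a b) = root_span2 s t (- a - C s t * b) b"
    and "simple_reflection C t (root_span2 s t a b) = root_span2 s t a (- b - C t s * a)"
proof -
  have "C s s = 2" "C t t = 2" using assms by (simp_all add: generalized_cartan_def)
  then show "simple_reflection C s (root_span2 s t a b) = root_span2 s t (- a - C s t * b) b"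
    "simple_reflection C t (root_span2 s t a b) = root_span2 s t a (- b - C t s * a)"
    by (simp_all add: root_span2_def simple_reflection_linear simple_reflection_simple_root
        fun_eq_iff algebra_simps)
qed

lemma cartan_rank_two_cases:
  assumes "generalized_cartan C" "s \<noteq> t"
  obtains (zero) "C s t = 0" "C t s = 0" "coxeter_exponent C s t = 2"
  | (one) "C s t = -1" "C t s = -1" "coxeter_exponent C s t = 3"
  | (two) "C s t = -1" "C t s = -2" "coxeter_exponent C s t = 4"
  | (two') "C s t = -2" "C t s = -1" "coxeter_exponent C s t = 4"
  | (three) "C s t = -1" "C t s = -3" "coxeter_exponent C s t = 6"
  | (three') "C s t = -3" "C t s = -1" "coxeter_exponent C s t = 6"
  | (inf) "C s t * C t s \<ge> 4" "coxeter_exponent C s t = 0"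
proof -
  define x where "x = - C s t"
  define y where "y = - C t s"
  have nn: "x \<ge> 0" "y \<ge> 0" "x = 0 \<longleftrightarrow> y = 0"
    using assms by (auto simp: x_def y_def generalized_cartan_def)
  have C: "C s t = - x" "C t s = - y" by (simp_all add: x_def y_def)
  consider "x = 0" "y = 0" | "x > 0" "y > 0" "x * y < 4" | "x * y \<ge> 4"
    using nn by force
  then show ?thesis
  proof cases
    case 1
    then show ?thesis using zero by (simp add: C coxeter_exponent_def)
  next
    case 2
    have "x \<le> x * y" "y \<le> x * y" using 2 by (simp_all add: mult_le_cancel_left1 mult_le_cancel_right1)
    then have "x < 4" "y < 4" using 2 by linarith+
    then have "x \<in> {1,2,3}" "y \<in> {1,2,3}" using 2 by auto
    then show ?thesis
      using 2 one two two' three three' by (auto simp: C coxeter_exponent_def)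
  next
    case 3
    then have "coxeter_exponent C s t = 0" by (auto simp: C coxeter_exponent_def Let_def)
    then show ?thesis using inf 3 by (simp add: C)
  qed
qed

lemma rank_two_sum:
  fixes C :: "'s::finite \<Rightarrow> 's \<Rightarrow> int"
  assumes "generalized_cartan C"
  shows "(\<Sum>x\<in>UNIV. (v x + root_span2 s t a b x) * C s x)
      = (\<Sum>x\<in>UNIV. v x * C s x) + 2 * a + C s t * b"
    and "(\<Sum>x\<in>UNIV. (v x + root_span2 s t a b x) * C t x)
      = (\<Sum>x\<in>UNIV. v x * C t x) + C t s * a + 2 * b"
  using assms
  by (simp_all add: root_span2_def simple_root_def of_bool_def distrib_right sum.distrib
      if_distrib[of "\<lambda>x. x * _"] if_distrib[of "\<lambda>x. _ * x"] generalized_cartan_def cong: if_cong)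

text \<open>On the coset of \<open>v\<close> modulo the span of the two roots both reflections are
  affine in the coordinates \<open>a\<close> and \<open>b\<close>. The braid relation on an
  arbitrary \<open>v\<close> thereby becomes a computation with two integers.\<close>

lemma reflection_add_root_span2:
  fixes v s t C
  defines "x \<equiv> (\<Sum>u\<in>UNIV. v u * C s u)" and "y \<equiv> (\<Sum>u\<in>UNIV. v u * C t u)"
  assumes "generalized_cartan C"
  shows "simple_reflection C s (\<lambda>u. v u + root_span2 s t a b u)
      = (\<lambda>u. v u + root_span2 s t (- a - C s t * b - x) b u)"
    and "simple_reflection C t (\<lambda>u. v u + root_span2 s t a b u)
      = (\<lambda>u. v u + root_span2 s t a (- b - C t s * a - y) u)"
  unfolding x_def y_def simple_reflection_def rank_two_sum[OF assms(3)]
  by (simp_all add: fun_eq_iff root_span2_def algebra_simps)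

lemma weyl_act_braid:
  assumes C: "generalized_cartan C" and st: "s \<noteq> t"
  shows "weyl_act C (braid_word s t (coxeter_exponent C s t)) v
    = weyl_act C (braid_word t s (coxeter_exponent C s t)) v"
proof -
  define V where "V a b = (\<lambda>u. v u + root_span2 s t a b u)" for a b
  have v: "v = V 0 0"
    by (simp add: V_def root_span2_def)
  note V = reflection_add_root_span2[OF C, where s = s and t = t and v = v, folded V_def]
  show ?thesis
    using C st
    by (cases rule: cartan_rank_two_cases)
      (simp_all only: v, simp_all add: eval_nat_numeral V)
qed

lemma root_span2_commute: "root_span2 s t a b = root_span2 t s b a"
  by (simp add: root_span2_def add.commute)

text \<open>The last bound says that the vector pairs non-positively with the coroot of
  \<open>t\<close>, whose reflection acts first. That reflection can only raise \<open>b\<close>,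
  and afterwards the pairing with the coroot of \<open>s\<close> is non-positive because the product
  of the two entries is at least 4; so the induction continues with \<open>s\<close> and
  \<open>t\<close> exchanged.\<close>

lemma weyl_act_braid_word_infinite:
  assumes C: "generalized_cartan C" and p: "C s t * C t s \<ge> 4" and st: "s \<noteq> t"
    and ab: "a \<ge> 0" "b \<ge> 0" "- C t s * a \<ge> 2 * b"
  shows "\<exists>a'\<ge>0. \<exists>b'\<ge>0. weyl_act C (braid_word s t k) (root_span2 s t a b) = root_span2 s t a' b'"
  using p st ab
proof (induction k arbitrary: s t a b)
  case 0
  then show ?case by auto
next
  case (Suc k)
  let ?b = "- b - C t s * a"
  have nn: "C s t \<le> 0" using C Suc.prems(2) by (simp add: generalized_cartan_def)
  have b: "?b \<ge> 0" using Suc.prems by linarith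
  have "4 * a \<le> (C s t * C t s) * a"
    using Suc.prems by (intro mult_right_mono) auto
  also have "\<dots> = (- C s t) * (- C t s * a)" by simp
  also have "- C t s * a \<le> 2 * ?b" using Suc.prems(5) by (simp add: algebra_simps)
  then have "(- C s t) * (- C t s * a) \<le> (- C s t) * (2 * ?b)"
    using nn by (intro mult_left_mono) auto
  finally have ab: "2 * a \<le> - C s t * ?b" by (simp add: algebra_simps)
  have "\<exists>a'\<ge>0. \<exists>b'\<ge>0. weyl_act C (braid_word t s k) (root_span2 t s ?b a) = root_span2 t s a' b'"
  proof (rule Suc.IH)
    show "C t s * C s t \<ge> 4" using Suc.prems(1) by (simp only: mult.commute)
    show "2 * a \<le> - C s t * ?b" by (rule ab)
  qed (use Suc.prems(2,3) b in simp_all)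
  then show ?case
    by (auto simp: reflection_root_span2[OF C] root_span2_commute[of t s])
qed

text \<open>This is positivity of roots in the rank two subgroup, the local input of
  \<open>root_nonneg\<close>. The bound on \<open>k\<close> is sharp: the full braid word acts as
  the one that ends in \<open>s\<close>, and this letter, acting first, negates the root.\<close>

lemma weyl_act_braid_word_simple_root:
  assumes C: "generalized_cartan C" and st: "s \<noteq> t"
    and k: "coxeter_exponent C s t \<noteq> 0 \<Longrightarrow> k < coxeter_exponent C s t"
  shows "\<exists>a\<ge>0. \<exists>b\<ge>0. weyl_act C (braid_word s t k) (simple_root s) = root_span2 s t a b"
proof -
  define nonneg where "nonneg f \<longleftrightarrow> (\<exists>a\<ge>0. \<exists>b\<ge>0. f = root_span2 s t a b)" for f
  have nonneg: "nonneg (root_span2 s t a b)" if "a \<ge> 0" "b \<ge> 0" for a b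
    using that by (auto simp: nonneg_def)
  have s: "simple_root s = root_span2 s t 1 0"
    by (simp add: root_span2_def)
  have neg: "C t s \<le> 0" using C st by (simp add: generalized_cartan_def)
  note refl = reflection_root_span2[OF C, where s = s and t = t]
  have "nonneg (weyl_act C (braid_word s t k) (root_span2 s t 1 0))"
    using C st
  proof (cases rule: cartan_rank_two_cases)
    case inf
    then show ?thesis
      using weyl_act_braid_word_infinite[OF C inf(1) st, of 1 0 k] neg by (simp add: nonneg_def)
  next
    case zero
    then have "k = 0 \<or> k = 1" using k by auto
    then show ?thesis using zero
      by (elim disjE) (simp_all add: refl nonneg eval_nat_numeral)
  next
    case one
    then have "k = 0 \<or> k = 1 \<or> k = 2" using k by auto
    then show ?thesis using one
      by (elim disjE) (simp_all add: refl nonneg eval_nat_numeral)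
  next
    case two
    then have "k = 0 \<or> k = 1 \<or> k = 2 \<or> k = 3" using k by auto
    then show ?thesis using two
      by (elim disjE) (simp_all add: refl nonneg eval_nat_numeral)
  next
    case two'
    then have "k = 0 \<or> k = 1 \<or> k = 2 \<or> k = 3" using k by auto
    then show ?thesis using two'
      by (elim disjE) (simp_all add: refl nonneg eval_nat_numeral)
  next
    case three
    then have "k = 0 \<or> k = 1 \<or> k = 2 \<or> k = 3 \<or> k = 4 \<or> k = 5" using k by auto
    then show ?thesis using three
      by (elim disjE) (simp_all add: refl nonneg eval_nat_numeral)
  next
    case three'
    then have "k = 0 \<or> k = 1 \<or> k = 2 \<or> k = 3 \<or> k = 4 \<or> k = 5" using k by auto
    then show ?thesis using three'
      by (elim disjE) (simp_all add: refl nonneg eval_nat_numeral)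
  qed
  then show ?thesis by (simp add: nonneg_def s)
qed

section \<open>Tits' solution of the word problem, for an abstract congruence\<close>

locale weyl_word_congruence =
  fixes C :: "'s::finite \<Rightarrow> 's \<Rightarrow> int" and eq :: "'s list \<Rightarrow> 's list \<Rightarrow> bool"
  assumes cartan: "generalized_cartan C"
    and eq_refl: "eq u u"
    and eq_sym: "eq u v \<Longrightarrow> eq v u"
    and eq_trans [trans]: "eq u v \<Longrightarrow> eq v w \<Longrightarrow> eq u w"
    and eq_left: "eq u v \<Longrightarrow> eq (w @ u) (w @ v)"
    and eq_right: "eq u v \<Longrightarrow> eq (u @ w) (v @ w)"
    and eq_square: "eq [s, s] []"
    and eq_braid: "s \<noteq> t \<Longrightarrow>
      eq (braid_word s t (coxeter_exponent C s t)) (braid_word t s (coxeter_exponent C s t))"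
    and eq_act: "eq u v \<Longrightarrow> weyl_act C u = weyl_act C v"
begin

text \<open>Length is measured modulo \<open>eq\<close>, not by the action. The locale is
  instantiated with proportionality of reflected sequences and with equality of seeds as well, and
  the sign argument has to produce relations of that kind.\<close>

definition len :: "'s list \<Rightarrow> nat" where
  "len u = (LEAST n. \<exists>v. eq v u \<and> length v = n)"

lemma len_le: "eq v u \<Longrightarrow> len u \<le> length v"
  unfolding len_def by (rule Least_le) blast

lemma len_obtain: obtains v where "eq v u" "length v = len u"
proof -
  have "\<exists>v. eq v u \<and> length v = len u"
    unfolding len_def by (rule LeastI[of _ "length u"]) (use eq_refl in blast)
  then show ?thesis using that by blast
qed

lemma len_cong: "eq u v \<Longrightarrow> len u = len v"
  by (metis eq_sym eq_trans len_le len_obtain order_antisym)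

lemma len_append: "len (u @ w) \<le> len u + length w"
proof -
  obtain v where "eq v u" "length v = len u" by (rule len_obtain)
  then show ?thesis using len_le[OF eq_right[of v u w]] by simp
qed

lemma eq_cancel: "eq (u @ [s, s] @ w) (u @ w)"
  using eq_left[OF eq_right[OF eq_square[of s], of w], of u] by simp

text \<open>A factorization through a coset of the rank two subgroup of \<open>s\<close> and
  \<open>t\<close>, without loss of length. When \<open>len v\<close> is least, \<open>v\<close> is
  a shortest representative of its coset.\<close>

definition dihedral_split :: "'s list \<Rightarrow> 's \<Rightarrow> 's \<Rightarrow> 's list \<Rightarrow> 's list \<Rightarrow> bool" where
  "dihedral_split u s t v w \<longleftrightarrow> eq u (v @ w) \<and> set w \<subseteq> {s, t} \<and> len v + length w = len u"

lemma dihedral_split_commute: "dihedral_split u s t v w = dihedral_split u t s v w"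
  by (simp add: dihedral_split_def insert_commute)

text \<open>Otherwise an \<open>s\<close> could be moved from the end of \<open>v\<close> to the
  front of \<open>w\<close>, giving a split with a shorter \<open>v\<close>.\<close>

lemma dihedral_split_minimal:
  assumes split: "dihedral_split u s t v w"
    and min: "\<And>v' w'. dihedral_split u s t v' w' \<Longrightarrow> len v \<le> len v'"
  shows "len v \<le> len (v @ [s])"
proof (rule ccontr)
  assume less: "\<not> len v \<le> len (v @ [s])"
  have "eq v ((v @ [s]) @ [s])"
    using eq_cancel[of v s "[]"] eq_sym by simp
  then have "eq (v @ w) ((v @ [s]) @ (s # w))"
    using eq_right[of v "(v @ [s]) @ [s]" w] by simp
  then have e: "eq u ((v @ [s]) @ (s # w))"
    using split eq_trans unfolding dihedral_split_def by blast
  have "len u \<le> len (v @ [s]) + length (s # w)"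
    using len_cong[OF e] len_append[of "v @ [s]" "s # w"] by linarith
  then have "dihedral_split u s t (v @ [s]) (s # w)"
    using e split less unfolding dihedral_split_def by auto
  then show False using min less by blast
qed

lemma reduced_is_braid_word:
  assumes "set w \<subseteq> {s, t}" "s \<noteq> t" "\<And>x r w'. w \<noteq> w' @ [x, x] @ r"
    and "\<And>w'. w \<noteq> w' @ [s]"
  shows "w = braid_word s t (length w)"
  using assms
proof (induction w arbitrary: s t rule: rev_induct)
  case (snoc x w)
  have x: "x = t" using snoc.prems(1) snoc.prems(4)[of w] by auto
  have "w = braid_word t s (length w)"
  proof (rule snoc.IH)
    show "w \<noteq> w' @ [t]" for w'
      using snoc.prems(3)[of w' t "[]"] x by auto
    show "w \<noteq> w' @ [y, y] @ r" for w' y r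
      using snoc.prems(3)[of w' y "r @ [x]"] by auto
  qed (use snoc.prems in auto)
  then show ?case using x by simp
qed simp

text \<open>Additivity of the lengths makes \<open>w\<close> reduced, and \<open>w\<close> cannot be
  rewritten to end in \<open>s\<close> because appending \<open>s\<close> does not shorten
  \<open>u\<close>. So \<open>w\<close> alternates and ends in \<open>t\<close>; if it contained a
  full braid word, the braid relation would make it end in \<open>s\<close> after all.\<close>

lemma dihedral_split_braid_word:
  assumes split: "dihedral_split u s t v w" and st: "s \<noteq> t" and asc: "len u \<le> len (u @ [s])"
  shows "w = braid_word s t (length w)"
    and "coxeter_exponent C s t \<noteq> 0 \<Longrightarrow> length w < coxeter_exponent C s t"
proof -
  have e: "eq u (v @ w)" and l: "len v + length w = len u" and sub: "set w \<subseteq> {s, t}"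
    using split by (auto simp: dihedral_split_def)
  have short: False if "eq (v @ w) (v @ w')" "length w' < length w" for w'
    using len_cong[OF eq_trans[OF e that(1)]] len_append[of v w'] l that(2) by linarith
  have nots: False if "eq (v @ w) (v @ w' @ [s])" "length w' < length w" for w'
  proof -
    have "eq (u @ [s]) (v @ w' @ [s, s])"
      using eq_right[OF eq_trans[OF e that(1)], of "[s]"] by simp
    also have "eq (v @ w' @ [s, s]) (v @ w')"
      using eq_cancel[of "v @ w'" s "[]"] by simp
    finally have "len (u @ [s]) = len (v @ w')" by (rule len_cong)
    then show False using len_append[of v w'] l that(2) asc by linarith
  qed
  show w: "w = braid_word s t (length w)"
  proof (rule reduced_is_braid_word[OF sub st])
    show "w \<noteq> w' @ [x, x] @ r" for w' x r
      using short[of "w' @ r"] eq_cancel[of "v @ w'" x r] by auto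
    show "w \<noteq> w' @ [s]" for w'
      using nots[of w'] eq_refl by auto
  qed
  show "length w < coxeter_exponent C s t" if h: "coxeter_exponent C s t \<noteq> 0"
  proof (rule ccontr)
    let ?h = "coxeter_exponent C s t"
    assume "\<not> length w < ?h"
    then obtain k where "length w = k + ?h" by (metis add.commute le_Suc_ex not_less)
    then obtain w' where w': "w = w' @ braid_word s t ?h"
      using w braid_word_add[of s t k ?h] by metis
    have "eq (v @ w) (v @ w' @ braid_word t s ?h)"
      using eq_left[OF eq_braid[OF st], of "v @ w'"] w' by simp
    moreover obtain h' where "?h = Suc h'" using h not0_implies_Suc by blast
    ultimately show False
      using nots[of "w' @ braid_word s t h'"] w' by simp
  qed
qed

text \<open>Induction on the length, with \<open>u\<close> split as \<open>v @ w\<close> over a rank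
  two subgroup and \<open>v\<close> shortest. The rank two case writes the image of the root under
  \<open>w\<close> as a non-negative combination of the roots of \<open>s\<close> and
  \<open>t\<close>, and the induction hypothesis applies to the images of both under
  \<open>v\<close>.\<close>

theorem root_nonneg:
  assumes "len u \<le> len (u @ [s])"
  shows "weyl_act C u (simple_root s) x \<ge> 0"
  using assms
proof (induction "len u" arbitrary: u s x rule: less_induct)
  case less
  obtain u0 where u0: "eq u0 u" "length u0 = len u" by (rule len_obtain)
  have act0: "weyl_act C u0 = weyl_act C u" using u0(1) by (rule eq_act)
  show ?case
  proof (cases u0 rule: rev_cases)
    case Nil
    then show ?thesis using act0 by (simp add: simple_root_def flip: act0)
  next
    case (snoc u1 t)
    have st: "s \<noteq> t"
    proof
      assume "s = t"
      then have "eq (u @ [s]) (u1 @ [s, s])"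
        using eq_right[OF eq_sym[OF u0(1)], of "[s]"] snoc by simp
      also have "eq (u1 @ [s, s]) u1"
        using eq_cancel[of u1 s "[]"] by simp
      finally have "eq (u @ [s]) u1" .
      then show False
        using len_le[OF eq_sym] less.prems snoc u0(2) by fastforce
    qed
    have ex: "dihedral_split u s t u1 [t]"
    proof -
      have "eq u (u1 @ [t])" using u0(1) snoc eq_sym by simp
      moreover from this have "len u \<le> len u1 + 1"
        using len_cong[of u "u1 @ [t]"] len_append[of u1 "[t]"] by simp
      moreover have "len u1 \<le> length u1" by (rule len_le[OF eq_refl])
      ultimately show ?thesis using u0(2) snoc by (auto simp: dihedral_split_def)
    qed
    \<comment> \<open>The split \<open>ex\<close>, which cuts off the last letter of a shortest
      word, shows that the minimum exists and that it is smaller than \<open>len u\<close>.\<close>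
    define n where "n = (LEAST n. \<exists>v w. dihedral_split u s t v w \<and> len v = n)"
    have "\<exists>v w. dihedral_split u s t v w \<and> len v = n"
      unfolding n_def by (rule LeastI[of _ "len u1"]) (use ex in blast)
    then obtain v w where split: "dihedral_split u s t v w" and vn: "len v = n" by blast
    have min: "len v \<le> len v'" if "dihedral_split u s t v' w'" for v' w'
      unfolding vn n_def by (rule Least_le) (use that in blast)
    have v_less: "len v < len u"
      using min[OF ex] ex by (auto simp: dihedral_split_def)
    have s_nn: "weyl_act C v (simple_root s) x \<ge> 0" for x
      by (rule less.hyps[OF v_less dihedral_split_minimal[OF split min]])
    have t_nn: "weyl_act C v (simple_root t) x \<ge> 0" for x
      by (rule less.hyps[OF v_less dihedral_split_minimal[OF _ min]])
        (use split dihedral_split_commute[of u s t] in auto)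
    note w = dihedral_split_braid_word[OF split st less.prems]
    obtain a b where ab: "a \<ge> 0" "b \<ge> 0"
      "weyl_act C w (simple_root s) = root_span2 s t a b"
      using weyl_act_braid_word_simple_root[OF cartan st w(2)] w(1) by metis
    have "weyl_act C u = weyl_act C (v @ w)"
      using split by (auto simp: dihedral_split_def intro: eq_act)
    then have "weyl_act C u (simple_root s) x
        = a * weyl_act C v (simple_root s) x + b * weyl_act C v (simple_root t) x"
      using ab(3) by (simp add: root_span2_def weyl_act_linear)
    then show ?thesis using ab s_nn t_nn by simp
  qed
qed

lemma weyl_act_snoc_simple_root:
  "weyl_act C (u @ [s]) (simple_root s) x = - weyl_act C u (simple_root s) x"
proof -
  have "simple_reflection C s (simple_root s) = (\<lambda>x. (-1) * simple_root s x + 0 * simple_root s x)"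
    using cartan by (simp add: simple_reflection_simple_root generalized_cartan_def)
  then show ?thesis using weyl_act_linear[of C u "-1" "simple_root s" 0] by simp
qed

text \<open>If appending \<open>s\<close> shortens \<open>u\<close>, then \<open>root_nonneg\<close>
  applies to \<open>u @ [s]\<close>, and the extra reflection changes the sign.\<close>

corollary root_sign:
  "(\<forall>x. weyl_act C u (simple_root s) x \<ge> 0) \<or> (\<forall>x. weyl_act C u (simple_root s) x \<le> 0)"
proof (cases "len u \<le> len (u @ [s])")
  case False
  have "eq ((u @ [s]) @ [s]) u" using eq_cancel[of u s "[]"] by simp
  then have "len (u @ [s]) \<le> len ((u @ [s]) @ [s])" using False len_cong by fastforce
  then show ?thesis
    using root_nonneg[of "u @ [s]" s] weyl_act_snoc_simple_root[of u s] by auto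
qed (use root_nonneg in blast)

text \<open>A shortest nonempty word ending in \<open>s\<close> sends the root of \<open>s\<close>
  to a non-positive vector, whereas the identity keeps its coordinate 1.\<close>

theorem eq_Nil_if_act_id:
  assumes "weyl_act C u = id"
  shows "eq u []"
proof -
  obtain u0 where u0: "eq u0 u" "length u0 = len u" by (rule len_obtain)
  show ?thesis
  proof (cases u0 rule: rev_cases)
    case Nil
    then show ?thesis using u0 eq_sym by simp
  next
    case (snoc u1 s)
    have "eq (u1 @ [s, s]) (u @ [s])"
      using eq_right[OF u0(1), of "[s]"] snoc by simp
    moreover have "eq u1 (u1 @ [s, s])"
      using eq_sym[OF eq_cancel[of u1 s "[]"]] by simp
    ultimately have e: "eq u1 (u @ [s])" by (rule eq_trans[rotated])
    have "len u1 \<le> len (u1 @ [s])"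
      using snoc u0 len_cong[OF u0(1)] len_le[OF eq_refl, of u1] by simp
    then have "weyl_act C u1 (simple_root s) s \<ge> 0" by (rule root_nonneg)
    then have "weyl_act C (u @ [s]) (simple_root s) s \<ge> 0" using eq_act[OF e] by simp
    then have "weyl_act C u (simple_root s) s \<le> 0" using weyl_act_snoc_simple_root[of u s s] by simp
    then show ?thesis using assms by (simp add: simple_root_def)
  qed
qed

corollary eq_iff_act: "eq u v \<longleftrightarrow> weyl_act C u = weyl_act C v"
proof
  assume act: "weyl_act C u = weyl_act C v"
  have cancel: "eq (v @ rev v) []" for v
  proof (induction v)
    case (Cons s v)
    have "eq ([s] @ (v @ rev v) @ [s]) ([s] @ [] @ [s])"
      using Cons by (intro eq_left eq_right)
    also have "eq \<dots> []" using eq_square by simp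
    finally show ?case by simp
  qed (simp add: eq_refl)
  have "weyl_act C (rev v @ u) = id"
    by (rule ext) (simp add: act weyl_act_rev_cancel[OF cartan])
  then have "eq (v @ rev v @ u) (v @ [])"
    by (intro eq_left eq_Nil_if_act_id)
  then have "eq (v @ rev v @ u) v" by simp
  moreover have "eq u (v @ rev v @ u)"
    using eq_sym[OF eq_right[OF cancel[of v], of u]] by simp
  ultimately show "eq u v" by (rule eq_trans[rotated])
qed (rule eq_act)

end

text \<open>This instance is taken for its consequences about signs of roots, which do not depend on
  the congruence chosen.\<close>

lemma weyl_act_congruence:
  assumes "generalized_cartan C"
  shows "weyl_word_congruence C (\<lambda>u v. weyl_act C u = weyl_act C v)"
proof
  show "weyl_act C (braid_word s t (coxeter_exponent C s t))
      = weyl_act C (braid_word t s (coxeter_exponent C s t))" if "s \<noteq> t" for s t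
    using weyl_act_braid[OF assms that] by (rule ext)
  show "weyl_act C (w @ u) = weyl_act C (w @ v)" if "weyl_act C u = weyl_act C v" for u v w
    by (rule ext) (simp add: that)
  show "weyl_act C (u @ w) = weyl_act C (v @ w)" if "weyl_act C u = weyl_act C v" for u v w
    by (rule ext) (simp add: that)
qed (simp_all add: assms fun_eq_iff simple_reflection_involution)

section \<open>Rational functions\<close>

text \<open>The cone takes the place of an order on the field: it is closed under the operations
  that occur in mutations and avoids 0, so the sums that appear in denominators do not
  vanish.\<close>

locale positive_cone =
  fixes P :: "'k::field set"
  assumes one_pos [simp, intro]: "1 \<in> P"
    and add_pos [intro]: "x \<in> P \<Longrightarrow> y \<in> P \<Longrightarrow> x + y \<in> P"
    and mult_pos [intro]: "x \<in> P \<Longrightarrow> y \<in> P \<Longrightarrow> x * y \<in> P"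
    and inverse_pos [intro]: "x \<in> P \<Longrightarrow> inverse x \<in> P"
    and zero_not_pos [simp]: "0 \<notin> P"
begin

lemma pos_nonzero: "x \<in> P \<Longrightarrow> x \<noteq> 0"
  by auto

lemma divide_pos [intro]: "x \<in> P \<Longrightarrow> y \<in> P \<Longrightarrow> x / y \<in> P"
  by (simp add: divide_inverse inverse_pos mult_pos)

lemma power_pos [intro]: "x \<in> P \<Longrightarrow> x ^ n \<in> P"
  by (induction n) auto

lemma power_int_pos [intro]: "x \<in> P \<Longrightarrow> x powi k \<in> P"
  by (auto simp: power_int_def)

lemma prod_pos [intro]: "(\<And>i. i \<in> I \<Longrightarrow> f i \<in> P) \<Longrightarrow> (\<Prod>i\<in>I. f i) \<in> P"
  by (induction I rule: infinite_finite_induct) auto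

lemma sum_pos:
  assumes "finite I" "I \<noteq> {}" "\<And>i. i \<in> I \<Longrightarrow> f i \<in> P"
  shows "(\<Sum>i\<in>I. f i) \<in> P"
  using assms by (induction I rule: finite_ne_induct) auto

end

lemma power_int_prod: "(\<Prod>i\<in>I. f i) powi k = (\<Prod>i\<in>I. f i powi k)"
  for f :: "'i \<Rightarrow> 'k::field"
  by (induction I rule: infinite_finite_induct) (simp_all add: power_int_mult_distrib)

subsection \<open>Evaluation of polynomials\<close>

definition monomial_eval :: "('v \<Rightarrow> 'k::field) \<Rightarrow> ('v \<Rightarrow>\<^sub>0 nat) \<Rightarrow> 'k" where
  "monomial_eval x a = (\<Prod>v\<in>Poly_Mapping.keys a. x v ^ Poly_Mapping.lookup a v)"

lemma monomial_eval_superset: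
  assumes "finite V" "Poly_Mapping.keys a \<subseteq> V"
  shows "monomial_eval x a = (\<Prod>v\<in>V. x v ^ Poly_Mapping.lookup a v)"
  unfolding monomial_eval_def
  by (rule prod.mono_neutral_left) (use assms in \<open>auto simp: in_keys_iff\<close>)

lemma monomial_eval_add: "monomial_eval x (a + b) = monomial_eval x a * monomial_eval x b"
proof -
  let ?V = "Poly_Mapping.keys a \<union> Poly_Mapping.keys b"
  have "Poly_Mapping.keys (a + b) \<subseteq> ?V" by (rule keys_add)
  then show ?thesis
    using monomial_eval_superset[of ?V "a + b" x] monomial_eval_superset[of ?V a x]
      monomial_eval_superset[of ?V b x]
    by (simp add: lookup_add power_add prod.distrib)
qed

lemma ratfun_const_hom:
  "ratfun_const 0 = 0" "ratfun_const 1 = 1"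
  "ratfun_const (c + d) = ratfun_const c + ratfun_const d"
  "ratfun_const (c * d) = ratfun_const c * ratfun_const d"
proof -
  show "ratfun_const 0 = 0"
    by (simp add: ratfun_const_def Zero_fract_def zero_mpoly.abs_eq)
  show "ratfun_const 1 = 1"
    by (simp add: ratfun_const_def One_fract_def one_mpoly.abs_eq)
  show "ratfun_const (c + d) = ratfun_const c + ratfun_const d"
    by (simp add: ratfun_const_def plus_mpoly.abs_eq single_add eq_onp_same_args)
  show "ratfun_const (c * d) = ratfun_const c * ratfun_const d"
    by (simp add: ratfun_const_def times_mpoly.abs_eq mult_single eq_onp_same_args)
qed

lemma poly_mapping_eq_sum_single:
  "p = (\<Sum>a\<in>Poly_Mapping.keys p. Poly_Mapping.single a (Poly_Mapping.lookup p a))"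
  by (rule poly_mapping_eqI)
    (auto simp: lookup_sum lookup_single when_def in_keys_iff if_distrib cong: if_cong)

lemma mpoly_eval_superset:
  assumes "finite K" "Poly_Mapping.keys (poly_map p) \<subseteq> K"
  shows "mpoly_eval x p = (\<Sum>a\<in>K. ratfun_const (Poly_Mapping.lookup (poly_map p) a) * monomial_eval x a)"
  unfolding mpoly_eval_def monomial_eval_def
  by (rule sum.mono_neutral_left) (use assms in \<open>auto simp: in_keys_iff ratfun_const_hom\<close>)

lemma mpoly_eval_add: "mpoly_eval x (p + q) = mpoly_eval x p + mpoly_eval x q"
proof -
  let ?K = "Poly_Mapping.keys (poly_map p) \<union> Poly_Mapping.keys (poly_map q)"
  have "Poly_Mapping.keys (poly_map (p + q)) \<subseteq> ?K"
    by (simp add: plus_mpoly.rep_eq keys_add)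
  then show ?thesis
    using mpoly_eval_superset[of ?K "p + q" x] mpoly_eval_superset[of ?K p x]
      mpoly_eval_superset[of ?K q x]
    by (simp add: plus_mpoly.rep_eq lookup_add ratfun_const_hom sum.distrib algebra_simps)
qed

lemma mpoly_eval_single:
  "mpoly_eval x (Mpoly (Poly_Mapping.single a c)) = ratfun_const c * monomial_eval x a"
  by (cases "c = 0") (simp_all add: mpoly_eval_def monomial_eval_def Mpoly_inverse ratfun_const_hom)

lemma mpoly_eval_0 [simp]: "mpoly_eval x 0 = 0"
  using mpoly_eval_single[of x 0 0] by (simp add: zero_mpoly.abs_eq ratfun_const_hom)

lemma mpoly_eval_1 [simp]: "mpoly_eval x 1 = 1"
  using mpoly_eval_single[of x 0 1] by (simp add: one_mpoly.abs_eq ratfun_const_hom monomial_eval_def)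

lemma mpoly_eval_sum: "mpoly_eval x (\<Sum>i\<in>I. f i) = (\<Sum>i\<in>I. mpoly_eval x (f i))"
  by (induction I rule: infinite_finite_induct) (simp_all add: mpoly_eval_add)

definition mpoly_monomial :: "('v \<Rightarrow>\<^sub>0 nat) \<Rightarrow> complex \<Rightarrow> 'v mpoly" where
  "mpoly_monomial a c = Mpoly (Poly_Mapping.single a c)"

lemma mpoly_monomial_mult:
  "mpoly_monomial a c * mpoly_monomial b d = mpoly_monomial (a + b) (c * d)"
  by (simp add: mpoly_monomial_def times_mpoly.abs_eq mult_single eq_onp_same_args)

lemma poly_map_sum: "poly_map (\<Sum>i\<in>I. f i) = (\<Sum>i\<in>I. poly_map (f i))"
  by (induction I rule: infinite_finite_induct) (simp_all add: zero_mpoly.rep_eq plus_mpoly.rep_eq)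

lemma mpoly_eq_sum_monomial:
  "p = (\<Sum>a\<in>Poly_Mapping.keys (poly_map p). mpoly_monomial a (Poly_Mapping.lookup (poly_map p) a))"
proof -
  have "poly_map p = poly_map (\<Sum>a\<in>Poly_Mapping.keys (poly_map p).
      mpoly_monomial a (Poly_Mapping.lookup (poly_map p) a))"
    unfolding poly_map_sum mpoly_monomial_def
    using poly_mapping_eq_sum_single[of "poly_map p"] by (simp add: Mpoly_inverse)
  then show ?thesis by (simp only: poly_map_inject)
qed

lemma mpoly_mult_eq_sum:
  "p * q = (\<Sum>a\<in>Poly_Mapping.keys (poly_map p). \<Sum>b\<in>Poly_Mapping.keys (poly_map q).
      mpoly_monomial (a + b) (Poly_Mapping.lookup (poly_map p) a * Poly_Mapping.lookup (poly_map q) b))"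
  by (subst (1) mpoly_eq_sum_monomial[of p], subst (1) mpoly_eq_sum_monomial[of q])
    (simp add: sum_product mpoly_monomial_mult)

lemma mpoly_eval_mult: "mpoly_eval x (p * q) = mpoly_eval x p * mpoly_eval x q"
proof -
  have ev: "mpoly_eval x r = (\<Sum>a\<in>Poly_Mapping.keys (poly_map r).
      ratfun_const (Poly_Mapping.lookup (poly_map r) a) * monomial_eval x a)" for r
    by (rule mpoly_eval_superset) auto
  have "mpoly_eval x (p * q) = (\<Sum>a\<in>Poly_Mapping.keys (poly_map p). \<Sum>b\<in>Poly_Mapping.keys (poly_map q).
      ratfun_const (Poly_Mapping.lookup (poly_map p) a * Poly_Mapping.lookup (poly_map q) b) *
      monomial_eval x (a + b))"
    by (simp add: mpoly_mult_eq_sum[of p q] mpoly_eval_sum mpoly_monomial_def mpoly_eval_single)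
  also have "\<dots> = mpoly_eval x p * mpoly_eval x q"
    unfolding ev[of p] ev[of q] sum_product
    by (simp add: ratfun_const_hom monomial_eval_add algebra_simps)
  finally show ?thesis .
qed

subsection \<open>Subtraction-free rational functions\<close>

definition nonneg_coeffs :: "'v mpoly set" where
  "nonneg_coeffs = {p. \<forall>a. \<exists>r\<ge>0. Poly_Mapping.lookup (poly_map p) a = complex_of_real r}"

lemma nonneg_coeffsI:
  "(\<And>a. \<exists>r\<ge>0. Poly_Mapping.lookup (poly_map p) a = complex_of_real r) \<Longrightarrow> p \<in> nonneg_coeffs"
  by (simp add: nonneg_coeffs_def)

lemma nonneg_coeffsD:
  "p \<in> nonneg_coeffs \<Longrightarrow> \<exists>r\<ge>0. Poly_Mapping.lookup (poly_map p) a = complex_of_real r"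
  by (simp add: nonneg_coeffs_def)

lemma nonneg_coeffs_add: "p \<in> nonneg_coeffs \<Longrightarrow> q \<in> nonneg_coeffs \<Longrightarrow> p + q \<in> nonneg_coeffs"
  by (rule nonneg_coeffsI)
    (metis add_nonneg_nonneg lookup_add nonneg_coeffsD of_real_add plus_mpoly.rep_eq)

lemma nonneg_coeffs_sum: "(\<And>i. i \<in> I \<Longrightarrow> f i \<in> nonneg_coeffs) \<Longrightarrow> (\<Sum>i\<in>I. f i) \<in> nonneg_coeffs"
proof (induction I rule: infinite_finite_induct)
  case (insert i I)
  then show ?case by (simp add: nonneg_coeffs_add)
qed (auto simp: nonneg_coeffs_def zero_mpoly.rep_eq)

lemma mpoly_monomial_nonneg: "r \<ge> 0 \<Longrightarrow> mpoly_monomial a (complex_of_real r) \<in> nonneg_coeffs"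
  by (auto simp: nonneg_coeffs_def mpoly_monomial_def Mpoly_inverse lookup_single when_def
      intro: exI[of _ r] exI[of _ "0::real"])

lemma nonneg_coeffs_mult:
  assumes "p \<in> nonneg_coeffs" "q \<in> nonneg_coeffs"
  shows "p * q \<in> nonneg_coeffs"
  unfolding mpoly_mult_eq_sum[of p q]
proof (intro nonneg_coeffs_sum)
  fix a b
  obtain r s where "r \<ge> 0" "Poly_Mapping.lookup (poly_map p) a = complex_of_real r"
    "s \<ge> 0" "Poly_Mapping.lookup (poly_map q) b = complex_of_real s"
    using assms nonneg_coeffsD by blast
  then show "mpoly_monomial (a + b)
      (Poly_Mapping.lookup (poly_map p) a * Poly_Mapping.lookup (poly_map q) b) \<in> nonneg_coeffs"
    using mpoly_monomial_nonneg[of "r * s" "a + b"] by simp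
qed

lemma nonneg_coeffs_add_nonzero:
  assumes "p \<in> nonneg_coeffs" "q \<in> nonneg_coeffs" "p \<noteq> 0"
  shows "p + q \<noteq> 0"
proof
  assume 0: "p + q = 0"
  have "Poly_Mapping.lookup (poly_map p) a = 0" for a
  proof -
    obtain r s where "r \<ge> 0" "Poly_Mapping.lookup (poly_map p) a = complex_of_real r"
      "s \<ge> 0" "Poly_Mapping.lookup (poly_map q) a = complex_of_real s"
      using assms(1,2) nonneg_coeffsD by blast
    moreover have "Poly_Mapping.lookup (poly_map (p + q)) a = 0" by (simp add: 0 zero_mpoly.rep_eq)
    ultimately show ?thesis by (simp add: plus_mpoly.rep_eq lookup_add flip: of_real_add)
  qed
  then have "poly_map p = poly_map 0"
    by (intro poly_mapping_eqI) (simp add: zero_mpoly.rep_eq)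
  then show False using assms(3) by (simp add: poly_map_inject)
qed

definition subtraction_free :: "'v ratfun set" where
  "subtraction_free =
     {Fract p q |p q. p \<in> nonneg_coeffs \<and> q \<in> nonneg_coeffs \<and> p \<noteq> 0 \<and> q \<noteq> 0}"

lemma one_nonneg_coeffs: "1 \<in> nonneg_coeffs"
  using mpoly_monomial_nonneg[of 1 0] by (simp add: mpoly_monomial_def one_mpoly.abs_eq)

interpretation subtraction_free: positive_cone "subtraction_free :: 'v ratfun set"
proof
  show "1 \<in> (subtraction_free :: 'v ratfun set)"
    unfolding subtraction_free_def One_fract_def using one_nonneg_coeffs by force
  fix x y :: "'v ratfun"
  assume x: "x \<in> subtraction_free" and y: "y \<in> subtraction_free"
  obtain p q where pq: "x = Fract p q" "p \<in> nonneg_coeffs" "q \<in> nonneg_coeffs" "p \<noteq> 0" "q \<noteq> 0"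
    using x by (auto simp: subtraction_free_def)
  obtain r s where rs: "y = Fract r s" "r \<in> nonneg_coeffs" "s \<in> nonneg_coeffs" "r \<noteq> 0" "s \<noteq> 0"
    using y by (auto simp: subtraction_free_def)
  have "x + y = Fract (p * s + r * q) (q * s)" using pq rs by simp
  moreover have "p * s + r * q \<noteq> 0"
    using pq rs by (intro nonneg_coeffs_add_nonzero nonneg_coeffs_mult) auto
  ultimately show "x + y \<in> subtraction_free"
    using pq rs by (auto simp: subtraction_free_def intro!: nonneg_coeffs_add nonneg_coeffs_mult exI)
  have "x * y = Fract (p * r) (q * s)" using pq rs by simp
  then show "x * y \<in> subtraction_free"
    using pq rs nonneg_coeffs_mult[of p r] nonneg_coeffs_mult[of q s] no_zero_divisors
    unfolding subtraction_free_def by blast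
  have "inverse x = Fract q p" using pq by simp
  then show "inverse x \<in> subtraction_free"
    using pq unfolding subtraction_free_def by blast
next
  show "0 \<notin> (subtraction_free :: 'v ratfun set)"
    by (auto simp: subtraction_free_def Zero_fract_def eq_fract)
qed

lemma ratfun_var_pos [simp, intro]: "ratfun_var v \<in> subtraction_free"
proof -
  let ?p = "mpoly_monomial (Poly_Mapping.single v 1) 1"
  have "?p \<in> nonneg_coeffs" using mpoly_monomial_nonneg[of 1] by simp
  moreover have "?p \<noteq> 0"
    by (auto simp: mpoly_monomial_def zero_mpoly.abs_eq Mpoly_inject)
      (metis lookup_single_eq lookup_zero zero_neq_one)
  ultimately show ?thesis
    unfolding subtraction_free_def ratfun_var_def mpoly_monomial_def[symmetric]
    using one_nonneg_coeffs by force
qed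

lemma ratfun_const_pos: "r > 0 \<Longrightarrow> ratfun_const (complex_of_real r) \<in> subtraction_free"
proof -
  assume r: "r > 0"
  let ?p = "mpoly_monomial 0 (complex_of_real r)"
  have "?p \<in> nonneg_coeffs" using mpoly_monomial_nonneg[of r] r by simp
  moreover have "?p \<noteq> 0" using r
    by (auto simp: mpoly_monomial_def zero_mpoly.abs_eq Mpoly_inject)
      (metis lookup_single_eq lookup_zero of_real_eq_0_iff less_irrefl)
  ultimately show ?thesis
    unfolding subtraction_free_def ratfun_const_def mpoly_monomial_def[symmetric]
    using one_nonneg_coeffs by force
qed

lemma mpoly_eval_pos:
  assumes x: "\<And>v. x v \<in> subtraction_free" and p: "p \<in> nonneg_coeffs" "p \<noteq> 0"
  shows "mpoly_eval x p \<in> subtraction_free"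
  unfolding mpoly_eval_def
proof (rule subtraction_free.sum_pos)
  show "Poly_Mapping.keys (poly_map p) \<noteq> {}"
    using p(2) by (metis keys_eq_empty poly_map_inject zero_mpoly.rep_eq)
  fix a assume a: "a \<in> Poly_Mapping.keys (poly_map p)"
  obtain r where r: "r \<ge> 0" "Poly_Mapping.lookup (poly_map p) a = complex_of_real r"
    using p(1) nonneg_coeffsD by blast
  then have "r > 0" using a by (auto simp: in_keys_iff less_le)
  then show "ratfun_const (Poly_Mapping.lookup (poly_map p) a) *
      (\<Prod>v\<in>Poly_Mapping.keys a. x v ^ Poly_Mapping.lookup a v) \<in> subtraction_free"
    using r x
    by (auto intro!: subtraction_free.mult_pos subtraction_free.prod_pos subtraction_free.power_pos
        ratfun_const_pos)
qed simp

subsection \<open>Substitution\<close>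

text \<open>Any two admissible representations of the same fraction agree after cross
  multiplication, so the definite description denotes this value.\<close>

lemma ratfun_subst_Fract:
  assumes "mpoly_eval x q \<noteq> 0"
  shows "ratfun_subst x (Fract p q) = mpoly_eval x p / mpoly_eval x q"
  unfolding ratfun_subst_def
proof (rule the_equality)
  show "\<exists>p' q'. Fract p q = Fract p' q' \<and> mpoly_eval x q' \<noteq> 0 \<and>
      mpoly_eval x p / mpoly_eval x q = mpoly_eval x p' / mpoly_eval x q'"
    using assms by blast
  fix g assume "\<exists>p' q'. Fract p q = Fract p' q' \<and> mpoly_eval x q' \<noteq> 0 \<and>
      g = mpoly_eval x p' / mpoly_eval x q'"
  then obtain p' q' where e: "Fract p q = Fract p' q'" and q': "mpoly_eval x q' \<noteq> 0"
    and g: "g = mpoly_eval x p' / mpoly_eval x q'" by blast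
  have "q \<noteq> 0" "q' \<noteq> 0" using assms q' by auto
  then have "p * q' = p' * q" using e by (simp add: eq_fract)
  then have "mpoly_eval x p * mpoly_eval x q' = mpoly_eval x p' * mpoly_eval x q"
    by (metis mpoly_eval_mult)
  then show "g = mpoly_eval x p / mpoly_eval x q"
    using assms q' g by (simp add: frac_eq_eq)
qed

lemma mpoly_eval_var: "mpoly_eval x (Mpoly (Poly_Mapping.single (Poly_Mapping.single v 1) 1)) = x v"
  by (simp add: mpoly_eval_single monomial_eval_def ratfun_const_hom)

lemma ratfun_subst_var: "ratfun_subst x (ratfun_var v) = x v"
  using ratfun_subst_Fract[of x 1 "Mpoly (Poly_Mapping.single (Poly_Mapping.single v 1) 1)"]
  by (simp add: ratfun_var_def mpoly_eval_var[simplified])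

context
  fixes x :: "'v \<Rightarrow> 'w ratfun"
  assumes x: "\<And>v. x v \<in> subtraction_free"
begin

lemma subtraction_free_cases:
  assumes "f \<in> (subtraction_free :: 'v ratfun set)"
  obtains p q where "f = Fract p q" "p \<noteq> 0" "q \<noteq> 0"
    "mpoly_eval x p \<in> subtraction_free" "mpoly_eval x q \<in> subtraction_free"
  using assms mpoly_eval_pos[of x, OF x] by (auto simp: subtraction_free_def)

lemma ratfun_subst_1: "ratfun_subst x 1 = 1"
  using ratfun_subst_Fract[of x 1 1] unfolding One_fract_def[symmetric] by simp

text \<open>A subtraction-free function has a representation whose numerator and denominator remain
  nonzero under every subtraction-free substitution, whether or not the values \<open>x v\<close>
  are algebraically independent.\<close>

lemma ratfun_subst_hom:
  assumes "f \<in> subtraction_free" "g \<in> subtraction_free"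
  shows ratfun_subst_add: "ratfun_subst x (f + g) = ratfun_subst x f + ratfun_subst x g"
    and ratfun_subst_mult: "ratfun_subst x (f * g) = ratfun_subst x f * ratfun_subst x g"
    and ratfun_subst_inverse: "ratfun_subst x (inverse f) = inverse (ratfun_subst x f)"
proof -
  obtain p q where pq: "f = Fract p q" "p \<noteq> 0" "q \<noteq> 0"
    "mpoly_eval x p \<in> subtraction_free" "mpoly_eval x q \<in> subtraction_free"
    using assms(1) by (rule subtraction_free_cases)
  obtain r s where rs: "g = Fract r s" "r \<noteq> 0" "s \<noteq> 0"
    "mpoly_eval x r \<in> subtraction_free" "mpoly_eval x s \<in> subtraction_free"
    using assms(2) by (rule subtraction_free_cases)
  have nz: "mpoly_eval x p \<noteq> 0" "mpoly_eval x q \<noteq> 0" "mpoly_eval x s \<noteq> 0"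
    using pq rs by (auto dest: subtraction_free.pos_nonzero)
  then have qs: "mpoly_eval x (q * s) \<noteq> 0" by (simp add: mpoly_eval_mult)
  show "ratfun_subst x (f + g) = ratfun_subst x f + ratfun_subst x g"
    using pq(1-3) rs(1-3) nz qs
    by (simp add: ratfun_subst_Fract mpoly_eval_add) (simp add: mpoly_eval_mult field_simps)
  show "ratfun_subst x (f * g) = ratfun_subst x f * ratfun_subst x g"
    using pq(1-3) rs(1-3) nz qs
    by (simp add: ratfun_subst_Fract) (simp add: mpoly_eval_mult)
  show "ratfun_subst x (inverse f) = inverse (ratfun_subst x f)"
    using pq(1-3) nz by (simp add: ratfun_subst_Fract)
qed

lemma ratfun_subst_power: "f \<in> subtraction_free \<Longrightarrow> ratfun_subst x (f ^ n) = ratfun_subst x f ^ n"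
  by (induction n) (auto simp: ratfun_subst_1 ratfun_subst_mult subtraction_free.power_pos)

lemma ratfun_subst_power_int:
  "f \<in> subtraction_free \<Longrightarrow> ratfun_subst x (f powi k) = ratfun_subst x f powi k"
  by (simp add: power_int_def ratfun_subst_power ratfun_subst_inverse subtraction_free.inverse_pos)

lemma ratfun_subst_prod:
  "(\<And>i. i \<in> I \<Longrightarrow> f i \<in> subtraction_free) \<Longrightarrow>
    ratfun_subst x (\<Prod>i\<in>I. f i) = (\<Prod>i\<in>I. ratfun_subst x (f i))"
  by (induction I rule: infinite_finite_induct)
    (auto simp: ratfun_subst_1 ratfun_subst_mult subtraction_free.prod_pos)

end

subsection \<open>Laurent monomials\<close>

lemma ratfun_var_prod_power:
  assumes "finite V"
  shows "(\<Prod>v\<in>V. ratfun_var v ^ n v)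
    = Fract (mpoly_monomial (\<Sum>v\<in>V. Poly_Mapping.single v (n v)) 1) 1"
proof -
  have power: "ratfun_var v ^ k = Fract (mpoly_monomial (Poly_Mapping.single v k) 1) 1" for v :: 'a and k
    by (induction k)
      (simp_all add: ratfun_var_def mpoly_monomial_mult flip: mpoly_monomial_def single_add,
        simp add: mpoly_monomial_def One_fract_def one_mpoly.abs_eq)
  show ?thesis using assms
    by (induction V rule: finite_induct)
      (simp_all add: power mpoly_monomial_mult, simp add: mpoly_monomial_def One_fract_def one_mpoly.abs_eq)
qed

lemma laurent_monomial_eq_quotient:
  fixes y :: "'v \<Rightarrow> 'k::field"
  assumes "\<And>v. v \<in> V \<Longrightarrow> y v \<noteq> 0"
  shows "(\<Prod>v\<in>V. y v powi b v) = (\<Prod>v\<in>V. y v ^ nat (b v)) / (\<Prod>v\<in>V. y v ^ nat (- b v))"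
  unfolding prod_dividef[symmetric]
  by (rule prod.cong) (use assms in \<open>auto simp: power_int_def field_simps\<close>)

text \<open>For monomials it suffices that \<open>x\<close> does not vanish on \<open>V\<close>.
  This matters for the pullbacks, where the chosen representative is not controlled at indices
  outside the vertex set.\<close>

lemma ratfun_subst_laurent_monomial:
  assumes "finite V" "\<And>v. v \<in> V \<Longrightarrow> x v \<noteq> 0"
  shows "ratfun_subst x (\<Prod>v\<in>V. ratfun_var v powi b v) = (\<Prod>v\<in>V. x v powi b v)"
proof -
  define mon where "mon n = mpoly_monomial (\<Sum>v\<in>V. Poly_Mapping.single v (n v)) 1" for n
  have ev: "mpoly_eval x (mon n) = (\<Prod>v\<in>V. x v ^ n v)" for n
  proof -
    have l: "Poly_Mapping.lookup (\<Sum>v\<in>V. Poly_Mapping.single v (n v)) w = (if w \<in> V then n w else 0)" for w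
      using assms(1) by (auto simp: lookup_sum lookup_single when_def cong: if_cong)
    then have "Poly_Mapping.keys (\<Sum>v\<in>V. Poly_Mapping.single v (n v)) \<subseteq> V"
      by (auto simp: in_keys_iff split: if_splits)
    then show ?thesis
      by (simp add: mon_def mpoly_monomial_def mpoly_eval_single ratfun_const_hom l
          monomial_eval_superset[OF assms(1)])
  qed
  have nz: "mpoly_eval x (mon n) \<noteq> 0" for n
    using assms by (simp add: ev)
  then have mon_nz: "mon n \<noteq> 0" for n by (metis mpoly_eval_0)
  have "(\<Prod>v\<in>V. ratfun_var v powi b v) = Fract (mon (\<lambda>v. nat (b v))) (mon (\<lambda>v. nat (- b v)))"
    using mon_nz unfolding mon_def
    by (subst laurent_monomial_eq_quotient)
      (use assms(1) in \<open>simp_all add: subtraction_free.pos_nonzero ratfun_var_prod_power\<close>)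
  then show ?thesis
    using nz assms(2) by (simp add: ratfun_subst_Fract laurent_monomial_eq_quotient ev)
qed

text \<open>Clearing denominators leaves an equality of two monic monomials, whose exponents are the
  positive and the negative parts of \<open>b\<close>. The independence of the cycle products and
  the injectivity of the map to Casimirs rest on this.\<close>

lemma laurent_monomial_eq_1_iff:
  assumes "finite V"
  shows "(\<Prod>v\<in>V. ratfun_var v powi b v) = 1 \<longleftrightarrow> (\<forall>v\<in>V. b v = 0)"
proof
  assume one: "(\<Prod>v\<in>V. ratfun_var v powi b v) = 1"
  define e where "e n = (\<Sum>v\<in>V. Poly_Mapping.single v (n v))" for n :: "'a \<Rightarrow> nat"
  have l: "Poly_Mapping.lookup (e n) w = (if w \<in> V then n w else 0)" for w n
    unfolding e_def using assms by (auto simp: lookup_sum lookup_single when_def cong: if_cong)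
  have "(\<Prod>v\<in>V. ratfun_var v ^ nat (b v)) = (\<Prod>v\<in>V. ratfun_var v ^ nat (- b v))"
    using one laurent_monomial_eq_quotient[of V ratfun_var b] assms
    by (simp add: subtraction_free.pos_nonzero)
  then have "mpoly_monomial (e (\<lambda>v. nat (b v))) 1 = mpoly_monomial (e (\<lambda>v. nat (- b v))) 1"
    using assms by (simp add: ratfun_var_prod_power e_def eq_fract)
  then have "Poly_Mapping.single (e (\<lambda>v. nat (b v))) 1
      = Poly_Mapping.single (e (\<lambda>v. nat (- b v))) (1::complex)"
    by (simp add: mpoly_monomial_def Mpoly_inject)
  then have "e (\<lambda>v. nat (b v)) = e (\<lambda>v. nat (- b v))"
    by (metis lookup_single_eq lookup_single_not_eq zero_neq_one)
  then have "nat (b v) = nat (- b v)" if "v \<in> V" for v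
    using that l by metis
  then show "\<forall>v\<in>V. b v = 0"
    by (metis nat_eq_iff nat_le_0 nat_0_iff neg_le_0_iff_le order_antisym linorder_le_cases)
qed simp

section \<open>QQ-systems\<close>

lemma power_int_sum: "x \<noteq> 0 \<Longrightarrow> x powi (\<Sum>i\<in>I. f i) = (\<Prod>i\<in>I. x powi f i)"
  for x :: "'k::field"
  by (induction I rule: infinite_finite_induct) (simp_all add: power_int_add)

section \<open>Quasi-periodic sequences and their window sums\<close>

context positive_cone
begin

definition quasi_periodic :: "nat \<Rightarrow> (int \<Rightarrow> 'k) \<Rightarrow> bool" where
  "quasi_periodic m f \<longleftrightarrow> (\<forall>j. f j \<in> P) \<and> (\<exists>c. \<forall>j. f (j - int m) = c * f j)"

text \<open>The period is traversed backwards so that for X_j = T_(j-1) / T_j the multiplier of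
  \<open>T\<close> is the product of the X_j over one period.\<close>

definition multiplier :: "nat \<Rightarrow> (int \<Rightarrow> 'k) \<Rightarrow> 'k" where
  "multiplier m f = f (- int m) / f 0"

lemma quasi_periodicD:
  assumes "quasi_periodic m f"
  shows "f j \<in> P" "f j \<noteq> 0" "f (j - int m) = multiplier m f * f j"
    "multiplier m f \<in> P" "multiplier m f \<noteq> 0"
proof -
  show pos: "f j \<in> P" for j using assms by (simp add: quasi_periodic_def)
  then show nz: "f j \<noteq> 0" for j by (metis zero_not_pos)
  obtain c where c: "\<And>j. f (j - int m) = c * f j"
    using assms by (auto simp: quasi_periodic_def)
  show "f (j - int m) = multiplier m f * f j"
    using c[of j] c[of 0] nz[of 0] by (simp add: multiplier_def)
  show "multiplier m f \<in> P"
    using pos by (simp add: multiplier_def divide_pos)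
  then show "multiplier m f \<noteq> 0" by (metis zero_not_pos)
qed

lemma quasi_periodicI:
  assumes "\<And>j. f j \<in> P" "\<And>j. f (j - int m) = c * f j"
  shows "quasi_periodic m f" "multiplier m f = c"
proof -
  show "quasi_periodic m f" using assms by (auto simp: quasi_periodic_def)
  have "f 0 \<noteq> 0" using assms(1)[of 0] by (rule pos_nonzero)
  then show "multiplier m f = c" using assms(2)[of 0] by (simp add: multiplier_def)
qed

lemma quasi_periodic_mult:
  assumes "quasi_periodic m f" "quasi_periodic m g"
  shows "quasi_periodic m (\<lambda>j. f j * g j)"
    and "multiplier m (\<lambda>j. f j * g j) = multiplier m f * multiplier m g"
  by (rule quasi_periodicI[of _ m "multiplier m f * multiplier m g"];
      use quasi_periodicD[OF assms(1)] quasi_periodicD[OF assms(2)] in \<open>auto\<close>)+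

lemma quasi_periodic_divide:
  assumes "quasi_periodic m f" "quasi_periodic m g"
  shows "quasi_periodic m (\<lambda>j. f j / g j)"
    and "multiplier m (\<lambda>j. f j / g j) = multiplier m f / multiplier m g"
  by (rule quasi_periodicI[of _ m "multiplier m f / multiplier m g"];
      use quasi_periodicD[OF assms(1)] quasi_periodicD[OF assms(2)] in \<open>auto\<close>)+

lemma quasi_periodic_power_int:
  assumes "quasi_periodic m f"
  shows "quasi_periodic m (\<lambda>j. f j powi n)"
    and "multiplier m (\<lambda>j. f j powi n) = multiplier m f powi n"
  by (rule quasi_periodicI[of _ m "multiplier m f powi n"];
      use quasi_periodicD[OF assms] in \<open>auto simp: power_int_mult_distrib\<close>)+

lemma quasi_periodic_const: "c \<in> P \<Longrightarrow> quasi_periodic m (\<lambda>j. c)"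
  "c \<in> P \<Longrightarrow> multiplier m (\<lambda>j. c) = 1"
  by (rule quasi_periodicI[of _ m 1]; simp)+

lemma quasi_periodic_prod:
  assumes "\<And>i. i \<in> I \<Longrightarrow> quasi_periodic m (f i)"
  shows "quasi_periodic m (\<lambda>j. \<Prod>i\<in>I. f i j)"
    and "multiplier m (\<lambda>j. \<Prod>i\<in>I. f i j) = (\<Prod>i\<in>I. multiplier m (f i))"
proof -
  have "(\<Prod>i\<in>I. f i (j - int m)) = (\<Prod>i\<in>I. multiplier m (f i)) * (\<Prod>i\<in>I. f i j)" for j
    unfolding prod.distrib[symmetric]
    by (rule prod.cong) (use quasi_periodicD(3)[OF assms] in auto)
  moreover have "(\<Prod>i\<in>I. f i j) \<in> P" for j
    by (rule prod_pos) (use quasi_periodicD(1)[OF assms] in auto)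
  ultimately show "quasi_periodic m (\<lambda>j. \<Prod>i\<in>I. f i j)"
    "multiplier m (\<lambda>j. \<Prod>i\<in>I. f i j) = (\<Prod>i\<in>I. multiplier m (f i))"
    using quasi_periodicI[of "\<lambda>j. \<Prod>i\<in>I. f i j" m] by blast+
qed

lemma quasi_periodic_shift:
  assumes "quasi_periodic m f"
  shows "quasi_periodic m (\<lambda>j. f (j + a))" "multiplier m (\<lambda>j. f (j + a)) = multiplier m f"
    and "quasi_periodic m (\<lambda>j. f (j - a))" "multiplier m (\<lambda>j. f (j - a)) = multiplier m f"
proof -
  have "f (j - int m + a) = multiplier m f * f (j + a)" for j a
    using quasi_periodicD(3)[OF assms, of "j + a"] by (simp add: algebra_simps)
  from this[of _ a] this[of _ "- a"]
  show "quasi_periodic m (\<lambda>j. f (j + a))" "multiplier m (\<lambda>j. f (j + a)) = multiplier m f"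
    "quasi_periodic m (\<lambda>j. f (j - a))" "multiplier m (\<lambda>j. f (j - a)) = multiplier m f"
    using quasi_periodicI[of "\<lambda>j. f (j + a)" m "multiplier m f"]
      quasi_periodicI[of "\<lambda>j. f (j - a)" m "multiplier m f"] quasi_periodicD(1)[OF assms]
    by simp_all
qed

definition window :: "nat \<Rightarrow> (int \<Rightarrow> 'k) \<Rightarrow> int \<Rightarrow> 'k" where
  "window m T j = (\<Sum>k<m. T (j - int k))"

lemma quasi_periodic_window:
  assumes "quasi_periodic m T" "m > 0"
  shows "quasi_periodic m (window m T)" "multiplier m (window m T) = multiplier m T"
proof -
  have "window m T j \<in> P" for j
    unfolding window_def by (rule sum_pos) (use assms quasi_periodicD(1) in auto)
  moreover have "window m T (j - int m) = multiplier m T * window m T j" for j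
    unfolding window_def sum_distrib_left
    by (rule sum.cong) (use quasi_periodicD(3)[OF assms(1), of "j - int _"] in \<open>auto simp: algebra_simps\<close>)
  ultimately show "quasi_periodic m (window m T)" "multiplier m (window m T) = multiplier m T"
    using quasi_periodicI[of "window m T" m] by blast+
qed

text \<open>The sum telescopes to \<open>T j - T (j - int m)\<close>. The factor
  \<open>1 - multiplier m T\<close> is what separates the generic case from the periodic
  one.\<close>

lemma window_diff:
  assumes "quasi_periodic m T"
  shows "window m T j - window m T (j - 1) = (1 - multiplier m T) * T j"
proof -
  have "window m T j - window m T (j - 1) = (\<Sum>k<m. T (j - int k) - T (j - int (Suc k)))"
    by (simp add: window_def sum_subtractf algebra_simps)
  also have "\<dots> = T j - T (j - int m)"
    by (subst sum_lessThan_telescope'[of "\<lambda>k. T (j - int k)"]) simp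
  finally show ?thesis using quasi_periodicD(3)[OF assms, of j] by (simp add: algebra_simps)
qed

section \<open>Discrete Wronskians and reproduction\<close>

definition wronskian :: "(int \<Rightarrow> 'k) \<Rightarrow> (int \<Rightarrow> 'k) \<Rightarrow> int \<Rightarrow> 'k" where
  "wronskian p p' j = p j * p' (j + 1) - p (j + 1) * p' j"

text \<open>The reproduction of \<open>p\<close>: up to a scalar, the solution \<open>p'\<close> of \<open>wronskian p p' = H\<close> that is
  again quasi-periodic.\<close>

definition reproduce :: "nat \<Rightarrow> (int \<Rightarrow> 'k) \<Rightarrow> (int \<Rightarrow> 'k) \<Rightarrow> int \<Rightarrow> 'k" where
  "reproduce m H p j = p j * window m (\<lambda>j. H j / (p j * p (j + 1))) (j - 1)"

definition reproduction_multiplier :: "nat \<Rightarrow> (int \<Rightarrow> 'k) \<Rightarrow> (int \<Rightarrow> 'k) \<Rightarrow> 'k" where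
  "reproduction_multiplier m H p = multiplier m H / (multiplier m p)\<^sup>2"

context
  fixes m :: nat and p H :: "int \<Rightarrow> 'k"
  assumes m: "m > 0" and p: "quasi_periodic m p" and H: "quasi_periodic m H"
begin

lemma quasi_periodic_ratio:
  "quasi_periodic m (\<lambda>j. H j / (p j * p (j + 1)))"
  "multiplier m (\<lambda>j. H j / (p j * p (j + 1))) = reproduction_multiplier m H p"
  using quasi_periodic_divide[OF H quasi_periodic_mult(1)[OF p quasi_periodic_shift(1)[OF p, of 1]]]
    quasi_periodic_mult(2)[OF p quasi_periodic_shift(1)[OF p, of 1]] quasi_periodic_shift(2)[OF p, of 1]
  by (simp_all add: reproduction_multiplier_def power2_eq_square)

lemma quasi_periodic_reproduce:
  "quasi_periodic m (reproduce m H p)"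
  "multiplier m (reproduce m H p) = multiplier m p * reproduction_multiplier m H p"
proof -
  note w = quasi_periodic_window[OF quasi_periodic_ratio(1) m]
  show "quasi_periodic m (reproduce m H p)"
    "multiplier m (reproduce m H p) = multiplier m p * reproduction_multiplier m H p"
    using quasi_periodic_mult[OF p quasi_periodic_shift(3)[OF w(1), of 1]]
      quasi_periodic_shift(4)[OF w(1), of 1] w(2)
    unfolding quasi_periodic_ratio(2)
    by (simp_all add: reproduce_def[abs_def])
qed

text \<open>The reproduction divided by \<open>p\<close> is a window sum, and the Wronskian is
  \<open>p j * p (j + 1)\<close> times the difference of two successive window sums, evaluated by
  \<open>window_diff\<close>.\<close>

lemma wronskian_reproduce:
  "wronskian p (reproduce m H p) j = (1 - reproduction_multiplier m H p) * H j"
proof -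
  have nz: "p j \<noteq> 0" "p (j + 1) \<noteq> 0" using quasi_periodicD(2)[OF p] by auto
  have "wronskian p (reproduce m H p) j = p j * p (j + 1) *
      (window m (\<lambda>j. H j / (p j * p (j + 1))) j - window m (\<lambda>j. H j / (p j * p (j + 1))) (j - 1))"
    by (simp add: wronskian_def reproduce_def algebra_simps)
  also have "\<dots> = (1 - reproduction_multiplier m H p) * H j"
    unfolding window_diff[OF quasi_periodic_ratio(1)] quasi_periodic_ratio(2)
    using nz by (simp add: field_simps)
  finally show ?thesis .
qed

text \<open>Two solutions of the Wronskian equation differ by a constant multiple of
  \<open>p\<close>. The multiplier prescribed for \<open>p'\<close> is that of \<open>p\<close>
  times a factor other than 1, which forces the constant to be 0.\<close>

lemma reproduce_unique:
  assumes q: "reproduction_multiplier m H p \<noteq> 1"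
    and p': "\<And>j. p' (j - int m) = multiplier m p * reproduction_multiplier m H p * p' j"
    and W: "\<And>j. wronskian p p' j = (1 - reproduction_multiplier m H p) * H j"
  shows "p' = reproduce m H p"
proof -
  define D where "D j = p' j - reproduce m H p j" for j
  define q where "q = reproduction_multiplier m H p"
  have pnz: "p j \<noteq> 0" for j using quasi_periodicD(2)[OF p] .
  have step: "D (j + 1) / p (j + 1) = D j / p j" for j
  proof -
    have "wronskian p D j = wronskian p p' j - wronskian p (reproduce m H p) j"
      by (simp add: wronskian_def D_def algebra_simps)
    then have "p j * D (j + 1) = p (j + 1) * D j"
      using W[of j] wronskian_reproduce[of j] by (simp add: wronskian_def)
    then show ?thesis using pnz[of j] pnz[of "j + 1"] by (simp add: field_simps)
  qed
  have const: "D j / p j = D 0 / p 0" for j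
  proof (induction j rule: int_induct[of _ 0])
    case (step1 i) then show ?case using step[of i] by simp
  next
    case (step2 i) then show ?case using step[of "i - 1"] by simp
  qed simp
  have "D (- int m) = multiplier m p * q * D 0"
    using p'[of 0] quasi_periodicD(3)[OF quasi_periodic_reproduce(1), of 0]
    unfolding quasi_periodic_reproduce(2) by (simp add: D_def q_def algebra_simps)
  moreover have "p (- int m) = multiplier m p * p 0"
    using quasi_periodicD(3)[OF p, of 0] by simp
  ultimately have "D 0 * (q - 1) = 0"
    using const[of "- int m"] pnz[of 0] quasi_periodicD(5)[OF p] by (simp add: field_simps)
  then have "D 0 = 0" using q by (simp add: q_def)
  then have "D j = 0" for j using const[of j] pnz[of j] by simp
  then show ?thesis by (auto simp: D_def)
qed

lemma reproduction_multiplier_pos: "reproduction_multiplier m H p \<noteq> 0"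
  using quasi_periodicD(5)[OF p] quasi_periodicD(5)[OF H]
  by (simp add: reproduction_multiplier_def)

end

text \<open>Because of this scalar, sequences will only be compared up to proportionality.\<close>

lemma reproduce_twice:
  assumes m: "m > 0" and p: "quasi_periodic m p" and H: "quasi_periodic m H"
    and q1: "reproduction_multiplier m H p \<noteq> 1"
  shows "reproduce m H (reproduce m H p) j = inverse (reproduction_multiplier m H p) * p j"
proof -
  define q where "q = reproduction_multiplier m H p"
  have q0: "q \<noteq> 0" using reproduction_multiplier_pos[OF m p H] by (simp add: q_def)
  note p' = quasi_periodic_reproduce[OF m p H]
  have q': "reproduction_multiplier m H (reproduce m H p) = inverse q"
    using q0 quasi_periodicD(5)[OF p] quasi_periodicD(5)[OF H] unfolding q_def
    by (simp add: reproduction_multiplier_def[of m H "reproduce m H p"] p'(2))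
      (simp add: reproduction_multiplier_def field_simps power2_eq_square)
  have "(\<lambda>j. inverse q * p j) = reproduce m H (reproduce m H p)"
  proof (rule reproduce_unique[OF m p'(1) H])
    show "reproduction_multiplier m H (reproduce m H p) \<noteq> 1"
      using q1 by (simp add: q' q_def)
    show "inverse q * p (j - int m)
        = multiplier m (reproduce m H p) * reproduction_multiplier m H (reproduce m H p) * (inverse q * p j)" for j
      using q0 quasi_periodicD(3)[OF p, of j] by (simp add: q' p'(2) flip: q_def)
    \<comment> \<open>Interchanging the arguments changes the sign of a Wronskian, and -(1/q) (1 -
      q) = 1 - 1/q; hence the scalar \<open>inverse q\<close>.\<close>
    have "wronskian (reproduce m H p) (\<lambda>j. inverse q * p j) j = - inverse q * wronskian p (reproduce m H p) j" for j
      by (simp add: wronskian_def algebra_simps)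
    then show "wronskian (reproduce m H p) (\<lambda>j. inverse q * p j) j
        = (1 - reproduction_multiplier m H (reproduce m H p)) * H j" for j
      using q0 by (simp add: wronskian_reproduce[OF m p H] q' field_simps flip: q_def)
  qed
  then show ?thesis by (metis q_def)
qed

text \<open>The sequences \<open>p\<close>, \<open>p1\<close>, \<open>p2\<close> solve a difference equation of order three, and \<open>R\<close>, \<open>R1\<close>, \<open>R2\<close>
  are essentially their pairwise Wronskians, linked by Pluecker relations.\<close>

lemma reproduce_braid:
  fixes m :: nat and p R Y Z :: "int \<Rightarrow> 'k"
  defines "p1 \<equiv> reproduce m (\<lambda>j. Y j * R (j + 1)) p"
  defines "R1 \<equiv> reproduce m (\<lambda>j. Z j * p1 j) R"
  defines "p2 \<equiv> reproduce m (\<lambda>j. Y j * R1 (j + 1)) p1"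
  defines "R2 \<equiv> reproduce m (\<lambda>j. Z j * p j) R"
  defines "p3 \<equiv> reproduce m (\<lambda>j. Y j * R2 (j + 1)) p"
  defines "R3 \<equiv> reproduce m (\<lambda>j. Z j * p3 j) R2"
  defines "q \<equiv> reproduction_multiplier m (\<lambda>j. Y j * R (j + 1)) p"
  defines "r \<equiv> reproduction_multiplier m (\<lambda>j. Z j * p j) R"
  assumes m: "m > 0" and p: "quasi_periodic m p" and R: "quasi_periodic m R"
    and Y: "quasi_periodic m Y" and Z: "quasi_periodic m Z"
    and q1: "q \<noteq> 1" and r1: "r \<noteq> 1" and qr1: "q * r \<noteq> 1"
  shows "p3 = p2" "R3 = R1"
proof -
  note mult = quasi_periodic_mult and shift = quasi_periodic_shift
  have Hs: "quasi_periodic m (\<lambda>j. Y j * f (j + 1))"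
    "multiplier m (\<lambda>j. Y j * f (j + 1)) = multiplier m Y * multiplier m f"
    if "quasi_periodic m f" for f
    using mult[OF Y shift(1)[OF that, of 1]] shift(2)[OF that, of 1] by simp_all
  have Ht: "quasi_periodic m (\<lambda>j. Z j * f j)"
    "multiplier m (\<lambda>j. Z j * f j) = multiplier m Z * multiplier m f"
    if "quasi_periodic m f" for f
    using mult[OF Z that] by simp_all
  define cp where "cp = multiplier m p"
  define cR where "cR = multiplier m R"
  define cY where "cY = multiplier m Y"
  define cZ where "cZ = multiplier m Z"
  have nz: "cp \<noteq> 0" "cR \<noteq> 0" "cY \<noteq> 0" "cZ \<noteq> 0"
    using quasi_periodicD(5) p R Y Z by (simp_all add: cp_def cR_def cY_def cZ_def)
  have q: "q = cY * cR / cp\<^sup>2"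
    by (simp add: q_def reproduction_multiplier_def Hs R cY_def cR_def cp_def)
  have r: "r = cZ * cp / cR\<^sup>2"
    by (simp add: r_def reproduction_multiplier_def Ht p cZ_def cR_def cp_def)
  note p1 = quasi_periodic_reproduce[OF m p Hs(1)[OF R], folded p1_def q_def, folded cp_def]
  \<comment> \<open>Along each of the two words the multipliers \<open>q\<close>, \<open>r\<close>
    and \<open>q * r\<close> occur once each, like the positive roots of type A2.\<close>
  have m1: "reproduction_multiplier m (\<lambda>j. Z j * p1 j) R = q * r"
    by (simp add: reproduction_multiplier_def Ht p1 q r) (simp add: cZ_def cR_def)
  note R1 = quasi_periodic_reproduce[OF m R Ht(1)[OF p1(1)], folded R1_def, unfolded m1, folded cR_def]
  have m2: "reproduction_multiplier m (\<lambda>j. Y j * R1 (j + 1)) p1 = r"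
    using nz by (simp add: reproduction_multiplier_def Hs R1 p1 q r)
      (simp add: cY_def[symmetric] field_simps power2_eq_square)
  note p2 = quasi_periodic_reproduce[OF m p1(1) Hs(1)[OF R1(1)], folded p2_def, unfolded m2 p1(2)]
  note R2 = quasi_periodic_reproduce[OF m R Ht(1)[OF p], folded R2_def r_def, folded cR_def]
  have m3: "reproduction_multiplier m (\<lambda>j. Y j * R2 (j + 1)) p = q * r"
    by (simp add: reproduction_multiplier_def Hs R2 q r) (simp add: cY_def cp_def mult_ac)
  note p3 = quasi_periodic_reproduce[OF m p Hs(1)[OF R2(1)], folded p3_def, unfolded m3, folded cp_def]
  have m4: "reproduction_multiplier m (\<lambda>j. Z j * p3 j) R2 = q"
    using nz by (simp add: reproduction_multiplier_def Ht R2 p3 q r)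
      (simp add: cZ_def[symmetric] field_simps power2_eq_square)
  have W1: "wronskian p p1 j = (1 - q) * (Y j * R (j + 1))" for j
    using wronskian_reproduce[OF m p Hs(1)[OF R]] by (simp add: p1_def q_def)
  have W2: "wronskian R R1 j = (1 - q * r) * (Z j * p1 j)" for j
    using wronskian_reproduce[OF m R Ht(1)[OF p1(1)]] by (simp add: R1_def m1)
  have W3: "wronskian p1 p2 j = (1 - r) * (Y j * R1 (j + 1))" for j
    using wronskian_reproduce[OF m p1(1) Hs(1)[OF R1(1)]] by (simp add: p2_def m2)
  have pz: "p j \<noteq> 0" "p1 j \<noteq> 0" "Y j \<noteq> 0" for j
    using quasi_periodicD(2) p p1(1) Y by auto
  \<comment> \<open>\<open>S\<close> is the sequence from which \<open>p2\<close> would arise as the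
    reproduction of \<open>p\<close>; the aim is to recognize it as \<open>R2\<close>.\<close>
  define S where "S j = wronskian p p2 (j - 1) / ((1 - q * r) * Y (j - 1))" for j
  have S: "wronskian p p2 j = (1 - q * r) * (Y j * S (j + 1))" for j
    using qr1 pz by (simp add: S_def)
  have pl1: "(1 - r) * p j * R1 (j + 1) - (1 - q * r) * p1 j * S (j + 1) + (1 - q) * p2 j * R (j + 1) = 0" for j
  proof -
    \<comment> \<open>Expansion of a 3 by 3 determinant with two equal rows: the values of the three
      sequences at j, again at j, and at j + 1.\<close>
    have "p j * wronskian p1 p2 j - p1 j * wronskian p p2 j + p2 j * wronskian p p1 j = 0"
      by (simp add: wronskian_def algebra_simps)
    then have "Y j * ((1 - r) * p j * R1 (j + 1) - (1 - q * r) * p1 j * S (j + 1) + (1 - q) * p2 j * R (j + 1)) = 0"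
      unfolding W1 W3 S by (simp add: algebra_simps)
    then show ?thesis using pz by simp
  qed
  have pl2: "(1 - r) * p j * R1 j - (1 - q * r) * p1 j * S j + (1 - q) * p2 j * R j = 0" for j
  proof -
    have plucker: "p (i + 1) * wronskian p1 p2 i - p1 (i + 1) * wronskian p p2 i + p2 (i + 1) * wronskian p p1 i = 0" for i
      by (simp add: wronskian_def algebra_simps)
    have "Y (j - 1) * ((1 - r) * p j * R1 j - (1 - q * r) * p1 j * S j + (1 - q) * p2 j * R j) = 0"
      using plucker[of "j - 1"] unfolding W1 W3 S by (simp add: algebra_simps)
    then show ?thesis using pz by simp
  qed
  have WS: "wronskian R S j = (1 - r) * (Z j * p j)" for j
  proof -
    \<comment> \<open>This combination of \<open>pl1\<close> and \<open>pl2\<close> eliminates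
      \<open>p2\<close>; the Wronskian of \<open>R\<close> and \<open>R1\<close> is known from
      \<open>W2\<close>.\<close>
    have "(1 - r) * p j * wronskian R R1 j - (1 - q * r) * p1 j * wronskian R S j
      = R j * ((1 - r) * p j * R1 (j + 1) - (1 - q * r) * p1 j * S (j + 1) + (1 - q) * p2 j * R (j + 1))
      - R (j + 1) * ((1 - r) * p j * R1 j - (1 - q * r) * p1 j * S j + (1 - q) * p2 j * R j)"
      by (simp add: wronskian_def algebra_simps)
    then have "((1 - q * r) * p1 j) * ((1 - r) * (Z j * p j)) = ((1 - q * r) * p1 j) * wronskian R S j"
      unfolding pl1 pl2 W2 by (simp add: algebra_simps)
    then show ?thesis using qr1 pz by simp
  qed
  have WS': "wronskian S R1 j = (1 - q) * (Z j * p2 j)" for j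
  proof -
    \<comment> \<open>With \<open>S\<close> in place of \<open>R\<close> the terms in
      \<open>p1\<close> cancel instead, which gives the remaining Wronskian from
      \<open>WS\<close>.\<close>
    have "(1 - r) * p j * wronskian S R1 j - (1 - q) * p2 j * wronskian R S j
      = S j * ((1 - r) * p j * R1 (j + 1) - (1 - q * r) * p1 j * S (j + 1) + (1 - q) * p2 j * R (j + 1))
      - S (j + 1) * ((1 - r) * p j * R1 j - (1 - q * r) * p1 j * S j + (1 - q) * p2 j * R j)"
      by (simp add: wronskian_def algebra_simps)
    then have "((1 - r) * p j) * wronskian S R1 j = ((1 - r) * p j) * ((1 - q) * (Z j * p2 j))"
      unfolding pl1 pl2 WS by (simp add: algebra_simps)
    then show ?thesis using r1 pz by simp
  qed
  have Sq: "S (j - int m) = cR * r * S j" for j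
  proof -
    have w: "wronskian p p2 (j - 1 - int m) = cp * (cp * q * r) * wronskian p p2 (j - 1)"
      using quasi_periodicD(3)[OF p, of "j - 1"] quasi_periodicD(3)[OF p, of j]
        quasi_periodicD(3)[OF p2(1), of "j - 1"] quasi_periodicD(3)[OF p2(1), of j]
      by (simp add: wronskian_def p2(2) cp_def[symmetric] algebra_simps)
    have y: "Y (j - 1 - int m) = cY * Y (j - 1)"
      using quasi_periodicD(3)[OF Y, of "j - 1"] by (simp add: cY_def)
    have "S (j - int m) = wronskian p p2 (j - 1 - int m) / ((1 - q * r) * Y (j - 1 - int m))"
      by (simp add: S_def algebra_simps)
    also have "\<dots> = (cp * cp * q * r / cY) * S j"
      unfolding w y by (simp add: S_def mult_ac)
    also have "cp * cp * q * r / cY = cR * r"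
      using nz by (simp add: q power2_eq_square)
    finally show ?thesis .
  qed
  \<comment> \<open>\<open>S\<close> has the multiplier and the Wronskian with \<open>R\<close> that
    characterize the reproduction \<open>R2\<close>.\<close>
  have SR2: "S = R2"
    unfolding R2_def
    by (rule reproduce_unique[OF m R Ht(1)[OF p]])
      (use r1 Sq WS in \<open>simp_all add: r_def[symmetric] cR_def[symmetric]\<close>)
  show p32: "p3 = p2"
    unfolding p3_def
  proof (rule sym, rule reproduce_unique[OF m p Hs(1)[OF R2(1)]], unfold m3)
    show "p2 (j - int m) = multiplier m p * (q * r) * p2 j" for j
      using quasi_periodicD(3)[OF p2(1), of j] by (simp add: p2(2) cp_def mult.assoc)
  qed (use qr1 S SR2 in simp_all)
  show "R3 = R1"
    unfolding R3_def
  proof (rule sym, rule reproduce_unique[OF m R2(1) Ht(1)[OF p3(1)]], unfold m4)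
    show "R1 (j - int m) = multiplier m R2 * q * R1 j" for j
      using quasi_periodicD(3)[OF R1(1), of j] by (simp add: R1(2) R2(2) mult_ac)
  qed (use q1 WS' SR2 p32 in simp_all)
qed

end

subsection \<open>Reflections of a QQ-system\<close>

text \<open>\<open>sh i k\<close> is the offset at which the sequence of \<open>k\<close> enters the
  equation of \<open>i\<close>. It enters with exponent \<open>- C k i\<close>, the transposed
  entry, so that the multipliers transform like simple roots.\<close>

locale qq_system = positive_cone P for P :: "'k::field set" +
  fixes m :: nat and C :: "'i::finite \<Rightarrow> 'i \<Rightarrow> int" and sh :: "'i \<Rightarrow> 'i \<Rightarrow> int"
    and y :: "'i \<Rightarrow> int \<Rightarrow> 'k"
  assumes m_pos: "m > 0" and cartan: "generalized_cartan C"
    and y_quasi_periodic: "quasi_periodic m (y i)"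
begin

definition rhs :: "('i \<Rightarrow> int \<Rightarrow> 'k) \<Rightarrow> 'i \<Rightarrow> int \<Rightarrow> 'k" where
  "rhs A i j = y i j * (\<Prod>k\<in>UNIV - {i}. A k (j + sh i k) powi (- C k i))"

definition reflect :: "'i \<Rightarrow> ('i \<Rightarrow> int \<Rightarrow> 'k) \<Rightarrow> 'i \<Rightarrow> int \<Rightarrow> 'k" where
  "reflect i A = A(i := reproduce m (rhs A i) (A i))"

definition reflect_word :: "'i list \<Rightarrow> ('i \<Rightarrow> int \<Rightarrow> 'k) \<Rightarrow> 'i \<Rightarrow> int \<Rightarrow> 'k" where
  "reflect_word u A = foldr reflect u A"

lemma reflect_word_simps [simp]:
  "reflect_word [] A = A" "reflect_word (s # u) A = reflect s (reflect_word u A)"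
  "reflect_word (u @ v) A = reflect_word u (reflect_word v A)"
  by (simp_all add: reflect_word_def)

definition mult :: "('i \<Rightarrow> int \<Rightarrow> 'k) \<Rightarrow> 'i \<Rightarrow> 'k" where
  "mult A i = reproduction_multiplier m (rhs A i) (A i)"

definition regular :: "('i \<Rightarrow> int \<Rightarrow> 'k) \<Rightarrow> bool" where
  "regular A \<longleftrightarrow> (\<forall>i. quasi_periodic m (A i))"

lemma quasi_periodic_rhs:
  assumes "regular A"
  shows "quasi_periodic m (rhs A i)"
    and "multiplier m (rhs A i)
      = multiplier m (y i) * (\<Prod>k\<in>UNIV - {i}. multiplier m (A k) powi (- C k i))"
proof -
  have 1: "quasi_periodic m (\<lambda>j. A k (j + sh i k) powi (- C k i))"
    "multiplier m (\<lambda>j. A k (j + sh i k) powi (- C k i)) = multiplier m (A k) powi (- C k i)" for k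
    using quasi_periodic_power_int[OF quasi_periodic_shift(1)[of m "A k" "sh i k"]]
      quasi_periodic_shift(2)[of m "A k" "sh i k"] assms by (simp_all add: regular_def)
  note 2 = quasi_periodic_prod[of "UNIV - {i}" m "\<lambda>k j. A k (j + sh i k) powi (- C k i)", OF 1(1)]
  show "quasi_periodic m (rhs A i)" "multiplier m (rhs A i)
      = multiplier m (y i) * (\<Prod>k\<in>UNIV - {i}. multiplier m (A k) powi (- C k i))"
    using quasi_periodic_mult[OF y_quasi_periodic[of i] 2(1)] 2(2)
    by (simp_all add: rhs_def[abs_def] 1(2))
qed

lemma mult_nonzero: "regular A \<Longrightarrow> mult A i \<noteq> 0"
  unfolding mult_def
  by (rule reproduction_multiplier_pos[OF m_pos _ quasi_periodic_rhs(1)]) (simp_all add: regular_def)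

text \<open>The square in the denominator of the reproduction multiplier is absorbed as the factor
  \<open>k = i\<close>, because \<open>C i i = 2\<close>.\<close>

lemma mult_eq:
  assumes "regular A"
  shows "mult A i = multiplier m (y i) * (\<Prod>k\<in>UNIV. multiplier m (A k) powi (- C k i))"
proof -
  have "multiplier m (A i) \<noteq> 0" using assms quasi_periodicD(5) by (auto simp: regular_def)
  moreover have "C i i = 2" using cartan by (simp add: generalized_cartan_def)
  ultimately show ?thesis
    by (simp add: mult_def reproduction_multiplier_def quasi_periodic_rhs[OF assms]
        prod.remove[of UNIV i] power_int_minus divide_simps)
qed

lemma regular_reflect:
  assumes "regular A"
  shows "regular (reflect s A)"
    and "multiplier m (reflect s A k) = (if k = s then multiplier m (A s) * mult A s else multiplier m (A k))"
proof -
  have s: "quasi_periodic m (A s)" using assms by (simp add: regular_def)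
  note r = quasi_periodic_reproduce[OF m_pos s quasi_periodic_rhs(1)[OF assms, of s]]
  show "regular (reflect s A)" "multiplier m (reflect s A k)
      = (if k = s then multiplier m (A s) * mult A s else multiplier m (A k))"
    using assms r by (simp_all add: regular_def reflect_def mult_def)
qed

text \<open>Only the multiplier of \<open>A s\<close> changes, by the factor
  \<open>mult A s\<close>, and it enters \<open>mult A t\<close> with exponent
  \<open>- C s t\<close>.\<close>

lemma mult_reflect:
  assumes "regular A"
  shows "mult (reflect s A) t = mult A t * mult A s powi (- C s t)"
proof -
  have "(\<Prod>k\<in>UNIV. multiplier m (reflect s A k) powi (- C k t))
      = (\<Prod>k\<in>UNIV. multiplier m (A k) powi (- C k t) * (if k = s then mult A s powi (- C s t) else 1))"
    by (rule prod.cong) (simp_all add: regular_reflect(2)[OF assms] power_int_mult_distrib)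
  then show ?thesis
    by (simp add: mult_eq[OF assms] mult_eq[OF regular_reflect(1)[OF assms]] prod.distrib)
qed

definition root_mult :: "('i \<Rightarrow> int \<Rightarrow> 'k) \<Rightarrow> ('i \<Rightarrow> int) \<Rightarrow> 'k" where
  "root_mult A b = (\<Prod>k\<in>UNIV. mult A k powi b k)"

text \<open>Stated for an arbitrary family \<open>f\<close>, since multipliers and, in the periodic
  case, potentials obey the same rule.\<close>

lemma prod_power_int_reflection:
  fixes f f' :: "'i \<Rightarrow> 'k"
  assumes nz: "\<And>k. f k \<noteq> 0" and f': "\<And>t. f' t = f t * f s powi (- C s t)"
  shows "(\<Prod>k\<in>UNIV. f' k powi b k) = (\<Prod>k\<in>UNIV. f k powi simple_reflection C s b k)"
proof -
  let ?n = "\<Sum>t\<in>UNIV. b t * C s t"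
  have "(\<Prod>k\<in>UNIV. f' k powi b k) = (\<Prod>k\<in>UNIV. f k powi b k * f s powi (- (b k * C s k)))"
    by (rule prod.cong)
      (simp_all add: f' power_int_mult_distrib power_int_mult[symmetric] mult.commute)
  also have "\<dots> = (\<Prod>k\<in>UNIV. f k powi b k) * f s powi (- ?n)"
    by (simp add: prod.distrib sum_negf[symmetric] power_int_sum[OF nz])
  also have "f s powi (- ?n) = (\<Prod>k\<in>UNIV. f k powi (- ?n * simple_root s k))"
    by (simp add: simple_root_def of_bool_def if_distrib[of "\<lambda>n. _ powi n"]
        if_distrib[of "\<lambda>x. _ * x"] cong: if_cong)
  also have "(\<Prod>k\<in>UNIV. f k powi b k) * \<dots> = (\<Prod>k\<in>UNIV. f k powi simple_reflection C s b k)"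
    unfolding prod.distrib[symmetric]
    by (rule prod.cong) (simp_all add: simple_reflection_def power_int_add[OF disjI1[OF nz], symmetric])
  finally show ?thesis .
qed

lemma root_mult_reflect:
  assumes "regular A"
  shows "root_mult (reflect s A) b = root_mult A (simple_reflection C s b)"
  unfolding root_mult_def
  by (rule prod_power_int_reflection) (rule mult_nonzero[OF assms], rule mult_reflect[OF assms])

text \<open>The word is reversed because the reflection applied last to \<open>A\<close> is the
  first to act on the exponents.\<close>

lemma root_mult_reflect_word:
  assumes "regular A"
  shows "regular (reflect_word u A)" "root_mult (reflect_word u A) b = root_mult A (weyl_act C (rev u) b)"
proof -
  show r: "regular (reflect_word u A)" for u
    by (induction u) (simp_all add: assms regular_reflect)
  show "root_mult (reflect_word u A) b = root_mult A (weyl_act C (rev u) b)"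
    by (induction u arbitrary: b) (simp_all add: root_mult_reflect r)
qed

definition ratio :: "('i \<Rightarrow> int \<Rightarrow> 'k) \<Rightarrow> 'i \<Rightarrow> int \<Rightarrow> 'k" where
  "ratio A i j = rhs A i j / (A i j * A i (j + 1))"

lemma quasi_periodic_ratio_mult:
  assumes "regular A"
  shows "quasi_periodic m (ratio A i)" "multiplier m (ratio A i) = mult A i"
proof -
  have "quasi_periodic m (A i)" using assms by (simp add: regular_def)
  from quasi_periodic_ratio[OF m_pos this quasi_periodic_rhs(1)[OF assms, of i]]
  show "quasi_periodic m (ratio A i)" "multiplier m (ratio A i) = mult A i"
    by (simp_all add: ratio_def[abs_def] mult_def)
qed

lemma reflect_eq: "reflect s A = A(s := \<lambda>j. A s j * window m (ratio A s) (j - 1))"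
  by (simp add: reflect_def reproduce_def[abs_def] ratio_def[abs_def])

text \<open>Quotients of these formulas at \<open>j - 1\<close> and \<open>j\<close> will be matched
  with the effect of R(s) on the X-variables, on the s-cycle by the first formula and on another
  cycle by the second.\<close>

lemma ratio_reflect:
  assumes "regular A"
  shows "ratio (reflect s A) s j
      = ratio A s j / (window m (ratio A s) (j - 1) * window m (ratio A s) j)"
    and "t \<noteq> s \<Longrightarrow> ratio (reflect s A) t j
      = ratio A t j * window m (ratio A s) (j + sh t s - 1) powi (- C s t)"
proof -
  have "rhs (reflect s A) s = rhs A s"
    unfolding rhs_def reflect_def by (intro ext arg_cong2[of _ _ _ _ "(*)"] refl prod.cong) auto
  then show "ratio (reflect s A) s j
      = ratio A s j / (window m (ratio A s) (j - 1) * window m (ratio A s) j)"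
    by (simp add: ratio_def[of "reflect s A"]) (simp add: reflect_eq ratio_def[of A s j])
  assume t: "t \<noteq> s"
  have "rhs (reflect s A) t j = rhs A t j * window m (ratio A s) (j + sh t s - 1) powi (- C s t)"
    using t unfolding rhs_def
    by (subst (1 2) prod.remove[of _ s])
      (auto simp: reflect_eq power_int_mult_distrib mult_ac intro!: prod.cong)
  then show "ratio (reflect s A) t j
      = ratio A t j * window m (ratio A s) (j + sh t s - 1) powi (- C s t)"
    using t by (simp add: ratio_def[of "reflect s A"]) (simp add: reflect_eq ratio_def[of A t j])
qed

subsection \<open>The periodic case\<close>

definition periodic :: "('i \<Rightarrow> int \<Rightarrow> 'k) \<Rightarrow> bool" where
  "periodic A \<longleftrightarrow> regular A \<and> (\<forall>i. mult A i = 1)"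

text \<open>For the quiver this turns out to be the \<open>cycle_potential\<close> of the
  A-variables along the cycle with index \<open>i\<close>.\<close>

definition potential :: "('i \<Rightarrow> int \<Rightarrow> 'k) \<Rightarrow> 'i \<Rightarrow> 'k" where
  "potential A i = window m (ratio A i) 0"

lemma potential_nonzero: "periodic A \<Longrightarrow> potential A i \<noteq> 0"
  unfolding potential_def
  by (rule quasi_periodicD(2)[OF quasi_periodic_window(1)[OF quasi_periodic_ratio_mult(1) m_pos]])
    (simp add: periodic_def)

text \<open>With multiplier 1 the difference in \<open>window_diff\<close> is zero.\<close>

lemma window_eq_potential:
  assumes "periodic A"
  shows "window m (ratio A i) j = potential A i"
proof -
  have "window m (ratio A i) k = window m (ratio A i) (k - 1)" for k
    using window_diff[OF quasi_periodic_ratio_mult(1), of A i k] quasi_periodic_ratio_mult(2)[of A i] assms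
    by (simp add: periodic_def)
  note step = this
  show ?thesis
  proof (induction j rule: int_induct[of _ 0])
    case (step1 i) then show ?case using step[of "i + 1"] by simp
  next
    case (step2 i) then show ?case using step[of i] by simp
  qed (simp add: potential_def)
qed

lemma reflect_periodic:
  assumes "periodic A"
  shows "reflect s A = A(s := \<lambda>j. A s j * potential A s)" "periodic (reflect s A)"
    "potential (reflect s A) t = potential A t * potential A s powi (- C s t)"
proof -
  have A: "regular A" using assms by (simp add: periodic_def)
  show "reflect s A = A(s := \<lambda>j. A s j * potential A s)"
    by (simp add: reflect_eq window_eq_potential[OF assms])
  show "periodic (reflect s A)"
    using assms by (simp add: periodic_def regular_reflect mult_reflect)
  have "C s s = 2" using cartan by (simp add: generalized_cartan_def)
  then have "ratio (reflect s A) t j = ratio A t j * potential A s powi (- C s t)" for j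
    using ratio_reflect(1)[OF A, of s j] ratio_reflect(2)[OF A, of t s j] window_eq_potential[OF assms, of s]
    by (cases "t = s") (simp_all add: power_int_minus divide_inverse power2_eq_square)
  then show "potential (reflect s A) t = potential A t * potential A s powi (- C s t)"
    by (simp add: potential_def[of _ t] window_def sum_distrib_right)
qed

definition root_potential :: "('i \<Rightarrow> int \<Rightarrow> 'k) \<Rightarrow> ('i \<Rightarrow> int) \<Rightarrow> 'k" where
  "root_potential A b = (\<Prod>k\<in>UNIV. potential A k powi b k)"

text \<open>For \<open>w\<close> the product of the reflections in \<open>u\<close>, this is the difference \<open>\<omega> - w\<inverse> \<omega>\<close> for the
  fundamental weight \<open>\<omega>\<close> with index \<open>t\<close>.\<close>

primrec weight_shift :: "'i list \<Rightarrow> 'i \<Rightarrow> 'i \<Rightarrow> int" where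
  "weight_shift [] t = (\<lambda>_. 0)"
| "weight_shift (s # u) t = (\<lambda>x. weight_shift u t x
     + (if s = t then weyl_act C (rev u) (simple_root s) x else 0))"

lemma reflect_word_periodic:
  assumes A: "periodic A"
  shows "periodic (reflect_word u A)"
    "root_potential (reflect_word u A) b = root_potential A (weyl_act C (rev u) b)"
    "reflect_word u A t j = A t j * root_potential A (weight_shift u t)"
proof -
  have nz: "potential A k \<noteq> 0" for k using A by (rule potential_nonzero)
  show per: "periodic (reflect_word u A)" for u
    by (induction u) (simp_all add: A reflect_periodic(2))
  show pot: "root_potential (reflect_word u A) b = root_potential A (weyl_act C (rev u) b)" for u b
  proof (induction u arbitrary: b)
    case (Cons s u)
    have "root_potential (reflect s (reflect_word u A)) b
        = root_potential (reflect_word u A) (simple_reflection C s b)"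
      unfolding root_potential_def
      by (rule prod_power_int_reflection)
        (rule potential_nonzero[OF per], rule reflect_periodic(3)[OF per])
    then show ?case by (simp add: Cons)
  qed simp
  show "reflect_word u A t j = A t j * root_potential A (weight_shift u t)"
  proof (induction u)
    case Nil
    then show ?case by (simp add: root_potential_def)
  next
    case (Cons s u)
    have "potential (reflect_word u A) s = root_potential (reflect_word u A) (simple_root s)"
      by (simp add: root_potential_def simple_root_def of_bool_def if_distrib[of "\<lambda>n. _ powi n"] cong: if_cong)
    then have "potential (reflect_word u A) s = root_potential A (weyl_act C (rev u) (simple_root s))"
      by (simp add: pot)
    moreover have "root_potential A (\<lambda>x. b x + c x) = root_potential A b * root_potential A c" for b c
      using nz by (simp add: root_potential_def power_int_add prod.distrib)
    ultimately show ?case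
      using Cons by (cases "s = t") (simp_all add: reflect_periodic(1)[OF per] mult.assoc)
  qed
qed

lemma weight_shift_square: "weight_shift [s, s] t = (\<lambda>_. 0)"
  using cartan by (auto simp: simple_reflection_simple_root generalized_cartan_def)

text \<open>Both words represent the same element, so both sides are the same difference of weights.
  In root coordinates this is checked for each rank two type, the words being empty in the infinite
  one.\<close>

lemma weight_shift_braid:
  assumes st: "s \<noteq> t"
  shows "weight_shift (braid_word s t (coxeter_exponent C s t)) x
    = weight_shift (braid_word t s (coxeter_exponent C s t)) x"
proof -
  have roots: "simple_root s = root_span2 s t 1 0" "simple_root t = root_span2 s t 0 1"
    by (simp_all add: root_span2_def)
  note refl = reflection_root_span2[OF cartan, where s = s and t = t]
  show ?thesis
    by (rule cartan_rank_two_cases[OF cartan st]; cases "x = s"; cases "x = t")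
      (use st in \<open>simp_all add: eval_nat_numeral roots refl, simp_all add: root_span2_def fun_eq_iff\<close>)
qed

section \<open>Generic multipliers and the simply laced relations\<close>

definition generic :: "('i \<Rightarrow> int \<Rightarrow> 'k) \<Rightarrow> bool" where
  "generic A \<longleftrightarrow> regular A \<and> (\<forall>u i. root_mult A (weyl_act C u (simple_root i)) \<noteq> 1)"

text \<open>The condition runs over all real roots, and by \<open>root_mult_reflect\<close> a
  reflection of \<open>A\<close> merely permutes these.\<close>

lemma generic_reflect: "generic A \<Longrightarrow> generic (reflect s A)"
  unfolding generic_def
  by (auto simp: regular_reflect root_mult_reflect simp flip: weyl_act_Cons)

lemma generic_reflect_word: "generic A \<Longrightarrow> generic (reflect_word u A)"
  by (induction u) (auto intro: generic_reflect)

lemma root_mult_simple_root [simp]: "root_mult A (simple_root i) = mult A i"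
  by (simp add: root_mult_def simple_root_def of_bool_def if_distrib[of "\<lambda>n. _ powi n"] cong: if_cong)

lemma generic_mult:
  assumes "generic A"
  shows "mult A i \<noteq> 1" "i \<noteq> j \<Longrightarrow> C i j = -1 \<Longrightarrow> mult A i * mult A j \<noteq> 1"
proof -
  show "mult A i \<noteq> 1"
    using assms unfolding generic_def by (metis root_mult_simple_root weyl_act_Nil)
  assume "i \<noteq> j" "C i j = -1"
  then have "root_mult A (weyl_act C [i] (simple_root j)) = mult (reflect i A) j"
    using assms by (simp add: generic_def flip: root_mult_reflect)
  also have "\<dots> = mult A i * mult A j"
    using assms \<open>C i j = -1\<close> by (simp add: mult_reflect generic_def mult.commute)
  finally show "mult A i * mult A j \<noteq> 1"
    using assms unfolding generic_def by metis
qed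

text \<open>One scalar for each index, constant along the sequence. The X-variables, being quotients
  of neighbouring ratios, do not see these scalars.\<close>

definition proportional :: "('i \<Rightarrow> int \<Rightarrow> 'k) \<Rightarrow> ('i \<Rightarrow> int \<Rightarrow> 'k) \<Rightarrow> bool" where
  "proportional A B \<longleftrightarrow> (\<forall>i. \<exists>c. c \<noteq> 0 \<and> (\<forall>j. B i j = c * A i j))"

lemma proportional_refl [simp]: "proportional A A"
  by (auto simp: proportional_def intro: exI[of _ 1])

lemma proportional_sym: "proportional A B \<Longrightarrow> proportional B A"
  unfolding proportional_def
proof
  fix i assume "\<forall>i. \<exists>c. c \<noteq> 0 \<and> (\<forall>j. B i j = c * A i j)"
  then obtain c where "c \<noteq> 0" "\<And>j. B i j = c * A i j" by blast
  then show "\<exists>c. c \<noteq> 0 \<and> (\<forall>j. A i j = c * B i j)"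
    by (intro exI[of _ "inverse c"]) auto
qed

lemma proportional_trans: "proportional A B \<Longrightarrow> proportional B D \<Longrightarrow> proportional A D"
  unfolding proportional_def
proof
  fix i assume "\<forall>i. \<exists>c. c \<noteq> 0 \<and> (\<forall>j. B i j = c * A i j)" "\<forall>i. \<exists>c. c \<noteq> 0 \<and> (\<forall>j. D i j = c * B i j)"
  then obtain c d where "c \<noteq> 0" "\<And>j. B i j = c * A i j" "d \<noteq> 0" "\<And>j. D i j = d * B i j" by metis
  then show "\<exists>c. c \<noteq> 0 \<and> (\<forall>j. D i j = c * A i j)"
    by (intro exI[of _ "d * c"]) auto
qed

lemma reproduce_scale:
  assumes "\<And>j. H' j = a * H j" "\<And>j. p' j = c * p j" "c \<noteq> 0"
  shows "reproduce m H' p' j = (a / c) * reproduce m H p j"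
  unfolding reproduce_def window_def
  using assms(3) by (simp add: assms(1,2) sum_distrib_left mult_ac) 

lemma proportional_reflect:
  assumes "proportional A B"
  shows "proportional (reflect s A) (reflect s B)"
  unfolding proportional_def
proof
  fix i
  obtain c where c: "\<And>i. c i \<noteq> 0" "\<And>i j. B i j = c i * A i j"
    using assms unfolding proportional_def by metis
  show "\<exists>d. d \<noteq> 0 \<and> (\<forall>j. reflect s B i j = d * reflect s A i j)"
  proof (cases "i = s")
    case True
    define a where "a = (\<Prod>k\<in>UNIV - {s}. c k powi (- C k s))"
    have "rhs B s j = a * rhs A s j" for j
      by (simp add: rhs_def c(2) power_int_mult_distrib prod.distrib a_def)
    moreover have "a \<noteq> 0" using c(1) by (simp add: a_def)
    ultimately show ?thesis
      using True c reproduce_scale[of "rhs B s" a "rhs A s" "B s" "c s" "A s"]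
      by (intro exI[of _ "a / c s"]) (simp add: reflect_def)
  qed (use c in \<open>auto simp: reflect_def\<close>)
qed

lemma proportional_reflect_word:
  "proportional A B \<Longrightarrow> proportional (reflect_word u A) (reflect_word u B)"
  by (induction u) (auto intro: proportional_reflect)

lemma rhs_update: "rhs (A(s := f)) s = rhs A s"
  unfolding rhs_def by (intro ext arg_cong2[of _ _ _ _ "(*)"] refl prod.cong) auto

lemma rhs_update_zero:
  assumes "C s t = 0"
  shows "rhs (A(s := f)) t = rhs A t"
  unfolding rhs_def
  by (intro ext arg_cong2[of _ _ _ _ "(*)"] refl prod.cong) (use assms in auto)

lemma reflect_square:
  assumes "regular A" "mult A s \<noteq> 1"
  shows "proportional (reflect s (reflect s A)) A"
proof (rule proportional_sym, unfold proportional_def, rule allI)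
  fix i
  have s: "quasi_periodic m (A s)" using assms by (simp add: regular_def)
  have "reproduce m (rhs A s) (reproduce m (rhs A s) (A s)) j = inverse (mult A s) * A s j" for j
    using reproduce_twice[OF m_pos s quasi_periodic_rhs(1)[OF assms(1)]] assms(2)
    by (simp add: mult_def)
  then show "\<exists>c. c \<noteq> 0 \<and> (\<forall>j. reflect s (reflect s A) i j = c * A i j)"
    using mult_nonzero[OF assms(1), of s]
    by (cases "i = s")
      (auto simp: reflect_def rhs_update intro: exI[of _ "inverse (mult A s)"] exI[of _ 1])
qed

lemma reflect_commute:
  assumes "s \<noteq> t" "C s t = 0" "C t s = 0"
  shows "reflect s (reflect t A) = reflect t (reflect s A)"
  using assms by (simp add: reflect_def rhs_update_zero fun_upd_twist)

lemma rhs_split: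
  assumes "s \<noteq> t"
  shows "rhs A s j = (y s j * (\<Prod>k\<in>UNIV - {s} - {t}. A k (j + sh s k) powi (- C k s)))
    * A t (j + sh s t) powi (- C t s)"
proof -
  have "(\<Prod>k\<in>UNIV - {s}. A k (j + sh s k) powi (- C k s))
      = A t (j + sh s t) powi (- C t s) * (\<Prod>k\<in>UNIV - {s} - {t}. A k (j + sh s k) powi (- C k s))"
    by (rule prod.remove) (use assms in auto)
  then show ?thesis using assms by (simp add: rhs_def mult_ac)
qed

text \<open>The sequences other than those of \<open>s\<close> and \<open>t\<close> stay fixed and
  are absorbed into the coefficients \<open>Y\<close> and \<open>Z\<close>. The offsets 1 and 0 are
  those of the two equations in \<open>reproduce_braid\<close>.\<close>

lemma reflect_braid_oriented:
  assumes st: "s \<noteq> t" "C s t = -1" "C t s = -1" and sh: "sh s t = 1" "sh t s = 0"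
    and A: "regular A" and q: "mult A s \<noteq> 1" "mult A t \<noteq> 1" "mult A s * mult A t \<noteq> 1"
  shows "reflect s (reflect t (reflect s A)) = reflect t (reflect s (reflect t A))"
proof -
  define Y where "Y j = y s j * (\<Prod>k\<in>UNIV - {s} - {t}. A k (j + sh s k) powi (- C k s))" for j
  define Z where "Z j = y t j * (\<Prod>k\<in>UNIV - {t} - {s}. A k (j + sh t k) powi (- C k t))" for j
  have rs: "rhs B s = (\<lambda>j. Y j * B t (j + 1))" if "\<And>k. k \<noteq> s \<Longrightarrow> k \<noteq> t \<Longrightarrow> B k = A k" for B
  proof -
    have "(\<Prod>k\<in>UNIV - {s} - {t}. B k (j + sh s k) powi (- C k s))
        = (\<Prod>k\<in>UNIV - {s} - {t}. A k (j + sh s k) powi (- C k s))" for j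
      by (rule prod.cong) (use that in auto)
    then show ?thesis using st sh by (simp add: rhs_split fun_eq_iff Y_def)
  qed
  have rt: "rhs B t = (\<lambda>j. Z j * B s j)" if "\<And>k. k \<noteq> s \<Longrightarrow> k \<noteq> t \<Longrightarrow> B k = A k" for B
  proof -
    have "(\<Prod>k\<in>UNIV - {t} - {s}. B k (j + sh t k) powi (- C k t))
        = (\<Prod>k\<in>UNIV - {t} - {s}. A k (j + sh t k) powi (- C k t))" for j
      by (rule prod.cong) (use that in auto)
    then show ?thesis using st sh rhs_split[of t s B] by (simp add: fun_eq_iff Z_def)
  qed
  have As: "quasi_periodic m (A s)" and At: "quasi_periodic m (A t)" using A by (simp_all add: regular_def)
  have "Y = (\<lambda>j. rhs A s j / A t (j + 1))" "Z = (\<lambda>j. rhs A t j / A s j)"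
    using quasi_periodicD(2)[OF As] quasi_periodicD(2)[OF At] by (simp_all add: rs rt fun_eq_iff)
  then have Y: "quasi_periodic m Y" and Z: "quasi_periodic m Z"
    using quasi_periodic_divide(1)[OF quasi_periodic_rhs(1)[OF A] quasi_periodic_shift(1)[OF At]]
      quasi_periodic_divide(1)[OF quasi_periodic_rhs(1)[OF A] As] by simp_all
  have qs: "mult A s = reproduction_multiplier m (\<lambda>j. Y j * A t (j + 1)) (A s)"
    "mult A t = reproduction_multiplier m (\<lambda>j. Z j * A s j) (A t)"
    by (simp_all add: mult_def rs rt)
  note braid = reproduce_braid[OF m_pos As At Y Z q[unfolded qs]]
  show ?thesis
    using braid st(1)
    by (intro ext) (simp add: reflect_def rs rt)
qed

lemma reflect_braid:
  assumes st: "s \<noteq> t" "C s t = -1" "C t s = -1"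
    and sh: "(sh s t = 1 \<and> sh t s = 0) \<or> (sh s t = 0 \<and> sh t s = 1)"
    and A: "generic A"
  shows "reflect s (reflect t (reflect s A)) = reflect t (reflect s (reflect t A))"
  using sh
proof
  assume "sh s t = 1 \<and> sh t s = 0"
  then show ?thesis
    using reflect_braid_oriented[of s t A] st A generic_mult[OF A] by (auto simp: generic_def)
next
  assume "sh s t = 0 \<and> sh t s = 1"
  then show ?thesis
    using reflect_braid_oriented[of t s A] st A generic_mult[OF A] by (auto simp: generic_def)
qed

lemma simply_laced_reflect_word:
  assumes simply_laced: "\<And>s t. s \<noteq> t \<Longrightarrow> C s t = 0 \<and> C t s = 0 \<or>
      C s t = -1 \<and> C t s = -1 \<and> ((sh s t = 1 \<and> sh t s = 0) \<or> (sh s t = 0 \<and> sh t s = 1))"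
    and A: "generic A" and act: "weyl_act C u = weyl_act C v"
  shows "proportional (reflect_word u A) (reflect_word v A)"
proof -
  \<comment> \<open>Quantifying over all generic \<open>A\<close> makes this a congruence: prefixes
    respect proportionality, and suffixes preserve genericity.\<close>
  define eq where "eq u v \<longleftrightarrow> weyl_act C u = weyl_act C v \<and>
      (\<forall>A. generic A \<longrightarrow> proportional (reflect_word u A) (reflect_word v A))" for u v
  interpret weyl_word_congruence C eq
  proof
    show "generalized_cartan C" by (rule cartan)
    show "eq u u" for u by (simp add: eq_def)
    show "eq v u" if "eq u v" for u v using that by (simp add: eq_def proportional_sym)
    show "eq u w" if "eq u v" "eq v w" for u v w
      using that unfolding eq_def by (metis proportional_trans)
    show "eq (w @ u) (w @ v)" if "eq u v" for u v w
      using that unfolding eq_def by (auto intro!: ext proportional_reflect_word)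
    show "eq (u @ w) (v @ w)" if "eq u v" for u v w
      using that by (simp add: eq_def fun_eq_iff generic_reflect_word)
    show "eq [s, s] []" for s
      using generic_mult(1) reflect_square
      by (simp add: eq_def fun_eq_iff simple_reflection_involution[OF cartan] generic_def)
    show "weyl_act C u = weyl_act C v" if "eq u v" for u v using that by (simp add: eq_def)
    show "eq (braid_word s t (coxeter_exponent C s t)) (braid_word t s (coxeter_exponent C s t))"
      if "s \<noteq> t" for s t
    proof -
      have "reflect_word (braid_word s t (coxeter_exponent C s t)) A
          = reflect_word (braid_word t s (coxeter_exponent C s t)) A" if "generic A" for A
        using simply_laced[OF \<open>s \<noteq> t\<close>]
      proof
        assume "C s t = 0 \<and> C t s = 0"
        then show ?thesis
          using reflect_commute[OF \<open>s \<noteq> t\<close>]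
          by (simp add: coxeter_exponent_def eval_nat_numeral)
      next
        assume "C s t = -1 \<and> C t s = -1 \<and> ((sh s t = 1 \<and> sh t s = 0) \<or> (sh s t = 0 \<and> sh t s = 1))"
        then show ?thesis
          using reflect_braid[OF \<open>s \<noteq> t\<close> _ _ _ that]
          by (simp add: coxeter_exponent_def eval_nat_numeral)
      qed
      then show ?thesis
        using weyl_act_braid[OF cartan \<open>s \<noteq> t\<close>] unfolding eq_def by (auto intro!: ext)
    qed
  qed
  show ?thesis using eq_iff_act[of u v] act A by (simp add: eq_def)
qed

lemma quasi_periodic_outer:
  assumes "regular A"
  shows "quasi_periodic m (\<lambda>j. y s j * (\<Prod>k\<in>K. A k (j + sh s k) powi (- C k s)))"
  using assms
  by (intro quasi_periodic_mult(1) y_quasi_periodic quasi_periodic_prod(1) quasi_periodic_power_int(1)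
      quasi_periodic_shift(1)) (simp add: regular_def)

end

subsection \<open>Folding\<close>

text \<open>\<open>None\<close> is the centre of the star and the \<open>Some a\<close> are its
  leaves: type A2, A3 or D4 for one, two or three leaves.\<close>

definition star_cartan :: "'l option \<Rightarrow> 'l option \<Rightarrow> int" where
  "star_cartan a b = (if a = b then 2 else if a = None \<or> b = None then -1 else 0)"

lemma generalized_cartan_star: "generalized_cartan star_cartan"
  by (auto simp: generalized_cartan_def star_cartan_def)

lemma sum_option: "(\<Sum>i\<in>UNIV. f i) = f None + (\<Sum>a\<in>UNIV. f (Some a))" for f :: "'l::finite option \<Rightarrow> int"
  by (simp add: UNIV_option_conv sum.reindex)

lemma prod_option: "(\<Prod>i\<in>UNIV. f i) = f None * (\<Prod>a\<in>UNIV. f (Some a))"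
  for f :: "'l::finite option \<Rightarrow> 'k::comm_monoid_mult"
  by (simp add: UNIV_option_conv prod.reindex)

lemma star_reflection:
  fixes v :: "'l::finite option \<Rightarrow> int"
  shows "simple_reflection star_cartan (Some a) v = v(Some a := v None - v (Some a))"
    and "simple_reflection star_cartan None v = v(None := (\<Sum>a\<in>UNIV. v (Some a)) - v None)"
proof -
  have "(\<Sum>t\<in>UNIV. v t * star_cartan (Some a) t) = 2 * v (Some a) - v None"
    by (simp add: sum_option star_cartan_def if_distrib[of "\<lambda>x. _ * x"] cong: if_cong)
  then show "simple_reflection star_cartan (Some a) v = v(Some a := v None - v (Some a))"
    by (auto simp: simple_reflection_def simple_root_def fun_eq_iff)
  have "(\<Sum>t\<in>UNIV. v t * star_cartan None t) = 2 * v None - (\<Sum>a\<in>UNIV. v (Some a))"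
    by (simp add: sum_option star_cartan_def sum_negf)
  then show "simple_reflection star_cartan None v = v(None := (\<Sum>a\<in>UNIV. v (Some a)) - v None)"
    by (auto simp: simple_reflection_def simple_root_def fun_eq_iff)
qed

lemma star_leaves_act:
  assumes "distinct L"
  shows "weyl_act star_cartan (map Some L) v
    = (\<lambda>i. case i of None \<Rightarrow> v None | Some a \<Rightarrow> if a \<in> set L then v None - v (Some a) else v (Some a))"
  using assms by (induction L) (auto simp: star_reflection fun_eq_iff split: option.split)

definition unfold_word :: "'l list \<Rightarrow> 's \<Rightarrow> 's list \<Rightarrow> 'l option list" where
  "unfold_word L s u = concat (map (\<lambda>x. if x = s then map Some L else [None]) u)"

lemma unfold_word_simps [simp]:
  "unfold_word L s [] = []"
  "unfold_word L s (x # u) = (if x = s then map Some L else [None]) @ unfold_word L s u"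
  "unfold_word L s (u @ w) = unfold_word L s u @ unfold_word L s w"
  by (simp_all add: unfold_word_def)

text \<open>Folding the stars A2, A3 and D4 gives the rank two types with exponents 3, 4 and 6,
  hence the pairs allowed for \<open>h\<close>.\<close>

lemma star_act_braid:
  fixes L :: "'l::finite list"
  assumes L: "distinct L" "set L = UNIV" and st: "s \<noteq> t"
    and h: "(card (UNIV :: 'l set), h) \<in> {(1, 3), (2, 4), (3, 6)}"
  shows "weyl_act star_cartan (unfold_word L s (braid_word s t h))
    = weyl_act star_cartan (unfold_word L s (braid_word t s h))"
proof
  fix v :: "'l option \<Rightarrow> int"
  \<comment> \<open>A family stable under both unfolded reflections: the leaf coordinates undergo a
    common sign change and translation. The relation becomes a computation with \<open>x\<close>,
    \<open>e\<close> and \<open>z\<close>.\<close>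
  define G where "G x e z = (\<lambda>i. case i of None \<Rightarrow> z | Some a \<Rightarrow> x + e * v (Some a))" for x e z
  define \<sigma> where "\<sigma> = (\<Sum>a\<in>UNIV. v (Some a))"
  have leaves: "weyl_act star_cartan (map Some L) (G x e z) = G (z - x) (- e) z" for x e z
    by (simp add: star_leaves_act L G_def fun_eq_iff split: option.split)
  have center: "simple_reflection star_cartan None (G x e z) = G x e (int (card (UNIV :: 'l set)) * x + e * \<sigma> - z)" for x e z
    by (simp add: star_reflection G_def fun_eq_iff sum.distrib \<sigma>_def sum_distrib_left split: option.split)
  have v: "v = G 0 1 (v None)"
    by (simp add: G_def fun_eq_iff split: option.split)
  show "weyl_act star_cartan (unfold_word L s (braid_word s t h)) v
    = weyl_act star_cartan (unfold_word L s (braid_word t s h)) v"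
  \<comment> \<open>With a single leaf the parameters of \<open>G\<close> are not unique, and the
    two words lead to different parameters of the same vector.\<close>
  proof (cases "card (UNIV :: 'l set) = 1")
    case True
    then obtain b :: 'l where b: "UNIV = {b}" by (rule card_1_singletonE)
    have "v (Some a) = \<sigma>" for a
    proof -
      have "a = b" using b by blast
      then show ?thesis unfolding \<sigma>_def b by simp
    qed
    then have "G (\<sigma> - v None) (- 1) (- \<sigma>) = G (- \<sigma> - v None) 1 (- \<sigma>)"
      by (simp add: G_def fun_eq_iff split: option.split)
    then show ?thesis
      using h st True by (subst (1 2) v) (auto simp: eval_nat_numeral leaves center)
  next
    case False
    then show ?thesis
      using h st by (subst (1 2) v) (auto simp: eval_nat_numeral leaves center)
  qed
qed

context qq_system
begin

lemma reflect_word_outside: "k \<notin> set u \<Longrightarrow> reflect_word u A k = A k"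
  by (induction u) (simp_all add: reflect_def)

text \<open>All sequences other than those of \<open>s\<close> and \<open>t\<close> are absorbed
  into the coefficients \<open>Y\<close> and \<open>Z\<close>. The sequence of \<open>s\<close> is
  copied to each of \<open>- C s t\<close> leaves, so that its power in the equation of
  \<open>t\<close> becomes a product over the leaves; the type \<open>'l\<close> supplies their
  number.\<close>

lemma reflect_word_rank_two:
  fixes s t :: 'i and l :: "'l::finite itself"
  defines "h \<equiv> coxeter_exponent C s t"
  assumes st: "s \<noteq> t" "C t s = -1" "C s t = - int (card (UNIV :: 'l set))" "card (UNIV :: 'l set) \<in> {1,2,3}"
    and sh: "(sh s t = 1 \<and> sh t s = 0) \<or> (sh s t = 0 \<and> sh t s = 1)"
    and A: "regular A"
    and indep: "\<And>a b. mult A s powi a * mult A t powi b = 1 \<Longrightarrow> a = 0 \<and> b = 0"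
  shows "proportional (reflect_word (braid_word s t h) A) (reflect_word (braid_word t s h) A)"
proof -
  define Y where "Y j = y s j * (\<Prod>k\<in>UNIV - {s} - {t}. A k (j + sh s k) powi (- C k s))" for j
  define Z where "Z j = y t j * (\<Prod>k\<in>UNIV - {t} - {s}. A k (j + sh t k) powi (- C k t))" for j
  have rs: "rhs B s = (\<lambda>j. Y j * B t (j + sh s t))" if "\<And>k. k \<noteq> s \<Longrightarrow> k \<noteq> t \<Longrightarrow> B k = A k" for B
  proof -
    have "(\<Prod>k\<in>UNIV - {s} - {t}. B k (j + sh s k) powi (- C k s))
        = (\<Prod>k\<in>UNIV - {s} - {t}. A k (j + sh s k) powi (- C k s))" for j
      by (rule prod.cong) (use that in auto)
    then show ?thesis using st by (simp add: rhs_split fun_eq_iff Y_def)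
  qed
  have rt: "rhs B t = (\<lambda>j. Z j * B s (j + sh t s) ^ card (UNIV :: 'l set))" if "\<And>k. k \<noteq> s \<Longrightarrow> k \<noteq> t \<Longrightarrow> B k = A k" for B
  proof -
    have "(\<Prod>k\<in>UNIV - {t} - {s}. B k (j + sh t k) powi (- C k t))
        = (\<Prod>k\<in>UNIV - {t} - {s}. A k (j + sh t k) powi (- C k t))" for j
      by (rule prod.cong) (use that in auto)
    then show ?thesis using st rhs_split[of t s B] by (simp add: fun_eq_iff Z_def)
  qed
  define sh' where "sh' a b = (if a = None then sh t s else sh s t)" for a b :: "'l option"
  define y' where "y' a = (if a = None then Z else Y)" for a :: "'l option"
  interpret star: qq_system P m "star_cartan :: 'l option \<Rightarrow> _" sh' y'
  proof
    show "quasi_periodic m (y' i)" for i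
      using quasi_periodic_outer[OF A, of s "UNIV - {s} - {t}"] quasi_periodic_outer[OF A, of t "UNIV - {t} - {s}"]
      by (simp add: y'_def Y_def[abs_def] Z_def[abs_def])
  qed (simp_all add: m_pos generalized_cartan_star)
  obtain L :: "'l list" where L: "distinct L" "set L = UNIV"
    using finite_distinct_list[OF finite_UNIV] by auto
  define \<Phi> where "\<Phi> B i = (case i of None \<Rightarrow> B t | Some (_::'l) \<Rightarrow> B s)" for B :: "'i \<Rightarrow> int \<Rightarrow> 'k" and i
  have star_leaf: "star.rhs X (Some a) = (\<lambda>j. Y j * X None (j + sh s t))" for X a
  proof
    fix j
    have "(\<Prod>k\<in>UNIV - {Some a}. X k (j + sh' (Some a) k) powi (- star_cartan k (Some a)))
        = (\<Prod>k\<in>{None}. X k (j + sh' (Some a) k) powi (- star_cartan k (Some a)))"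
      by (rule prod.mono_neutral_right) (auto simp: star_cartan_def)
    then show "star.rhs X (Some a) j = Y j * X None (j + sh s t)"
      by (simp add: star.rhs_def y'_def sh'_def star_cartan_def)
  qed
  have star_center: "star.rhs X None = (\<lambda>j. Z j * (\<Prod>a\<in>UNIV. X (Some a) (j + sh t s)))" for X
  proof
    fix j
    have "UNIV - {None} = range (Some :: 'l \<Rightarrow> _)" by (simp add: UNIV_option_conv)
    then show "star.rhs X None j = Z j * (\<Prod>a\<in>UNIV. X (Some a) (j + sh t s))"
      by (simp add: star.rhs_def y'_def sh'_def star_cartan_def prod.reindex)
  qed
  have leaves: "star.reflect_word (map Some K) X = (\<lambda>i. case i of None \<Rightarrow> X None
      | Some a \<Rightarrow> if a \<in> set K then reproduce m (\<lambda>j. Y j * X None (j + sh s t)) (X (Some a)) else X (Some a))"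
    if "distinct K" for K X
    using that
    by (induction K) (rule ext, auto simp: star.reflect_def star_leaf split: option.split)+
  have fold_s: "star.reflect_word (map Some L) (\<Phi> B) = \<Phi> (reflect s B)"
    if "\<And>k. k \<noteq> s \<Longrightarrow> k \<noteq> t \<Longrightarrow> B k = A k" for B
    unfolding leaves[OF L(1)]
    using st by (simp add: L \<Phi>_def reflect_def rs[OF that] fun_eq_iff split: option.split)
  have fold_t: "star.reflect None (\<Phi> B) = \<Phi> (reflect t B)"
    if "\<And>k. k \<noteq> s \<Longrightarrow> k \<noteq> t \<Longrightarrow> B k = A k" for B
    using st by (simp add: star.reflect_def star_center \<Phi>_def reflect_def rt[OF that] fun_eq_iff split: option.split)
  have outside: "reflect_word u A k = A k" if "set u \<subseteq> {s, t}" "k \<noteq> s" "k \<noteq> t" for u k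
    using that by (intro reflect_word_outside) auto
  have unfold: "star.reflect_word (unfold_word L s u) (\<Phi> A) = \<Phi> (reflect_word u A)"
    if "set u \<subseteq> {s, t}" for u
    using that by (induction u) (auto simp: fold_s[OF outside] fold_t[OF outside])
  have mult: "star.mult (\<Phi> A) (Some a) = mult A s" "star.mult (\<Phi> A) None = mult A t" for a
    by (simp_all add: star.mult_def mult_def star_leaf star_center rs rt \<Phi>_def)
  have reg: "star.regular (\<Phi> A)"
    using A by (auto simp: star.regular_def regular_def \<Phi>_def split: option.split)
  \<comment> \<open>All leaves have the multiplier of \<open>s\<close>, so only the sum of the leaf
    coordinates of a root counts. Real roots have coordinates of one sign by
    \<open>root_sign\<close>; hence this sum and the centre coordinate cannot both vanish, and
    \<open>indep\<close> applies.\<close>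
  have gen: "star.generic (\<Phi> A)"
    unfolding star.generic_def
  proof (intro conjI reg allI)
    fix u and i :: "'l option"
    let ?b = "weyl_act star_cartan u (simple_root i)"
    let ?n = "\<Sum>a\<in>UNIV. ?b (Some a)"
    have "star.root_mult (\<Phi> A) ?b = mult A s powi ?n * mult A t powi ?b None"
      using power_int_sum[OF mult_nonzero[OF A], of s "\<lambda>a. ?b (Some a)" UNIV]
      by (simp add: star.root_mult_def prod_option mult mult.commute)
    moreover have "?n \<noteq> 0 \<or> ?b None \<noteq> 0"
    proof (rule ccontr)
      assume "\<not> (?n \<noteq> 0 \<or> ?b None \<noteq> 0)"
      then have z: "?n = 0" "?b None = 0" by auto
      interpret weyl_word_congruence "star_cartan :: 'l option \<Rightarrow> _"
          "\<lambda>u v. weyl_act star_cartan u = weyl_act star_cartan v"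
        by (rule weyl_act_congruence[OF generalized_cartan_star])
      have "\<forall>a. ?b (Some a) = 0"
        using root_sign[of u i]
      proof
        assume "\<forall>x. 0 \<le> ?b x"
        then show ?thesis using z(1) sum_nonneg_eq_0_iff[of UNIV "\<lambda>a. ?b (Some a)"] by simp
      next
        assume "\<forall>x. ?b x \<le> 0"
        then show ?thesis using z(1) sum_nonneg_eq_0_iff[of UNIV "\<lambda>a. - ?b (Some a)"]
          by (simp add: sum_negf)
      qed
      then have "?b = (\<lambda>x. 0)"
        using z(2) by (auto simp: fun_eq_iff split: option.split) (metis not_None_eq)
      then have "weyl_act star_cartan (rev u) ?b = (\<lambda>x. 0)" by simp
      then have "simple_root i = (\<lambda>x. 0)"
        by (simp add: weyl_act_rev_cancel[OF generalized_cartan_star])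
      then show False by (simp add: simple_root_def fun_eq_iff of_bool_def split: if_splits)
    qed
    ultimately show "star.root_mult (\<Phi> A) ?b \<noteq> 1"
      using indep by metis
  qed
  have sub: "set (braid_word x z n) \<subseteq> {x, z}" for x z :: 'i and n
    by (induction n arbitrary: x z) auto
  have h: "(card (UNIV :: 'l set), h) \<in> {(1, 3), (2, 4), (3, 6)}"
    using st by (auto simp: h_def coxeter_exponent_def)
  have "star.proportional (star.reflect_word (unfold_word L s (braid_word s t h)) (\<Phi> A))
      (star.reflect_word (unfold_word L s (braid_word t s h)) (\<Phi> A))"
  proof (rule star.simply_laced_reflect_word[OF _ gen])
    show "weyl_act star_cartan (unfold_word L s (braid_word s t h))
        = weyl_act star_cartan (unfold_word L s (braid_word t s h))"
      using L st(1) h by (rule star_act_braid)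
    show "star_cartan a b = 0 \<and> star_cartan b a = 0 \<or>
      star_cartan a b = -1 \<and> star_cartan b a = -1 \<and> ((sh' a b = 1 \<and> sh' b a = 0) \<or> (sh' a b = 0 \<and> sh' b a = 1))"
      if "a \<noteq> b" for a b :: "'l option"
      using that sh by (auto simp: star_cartan_def sh'_def)
  qed
  then have folded: "star.proportional (\<Phi> (reflect_word (braid_word s t h) A)) (\<Phi> (reflect_word (braid_word t s h) A))"
    using sub[of s t h] sub[of t s h] by (simp add: unfold insert_commute)
  show ?thesis
    unfolding proportional_def
  proof
    fix k
    let ?B = "reflect_word (braid_word s t h) A" and ?D = "reflect_word (braid_word t s h) A"
    consider "k = s" | "k = t" | "k \<noteq> s" "k \<noteq> t" by blast
    then show "\<exists>c. c \<noteq> 0 \<and> (\<forall>j. ?D k j = c * ?B k j)"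
    proof cases
      case 1
      then show ?thesis using folded unfolding star.proportional_def \<Phi>_def
        by (auto dest!: spec[of _ "Some undefined"])
    next
      case 2
      then show ?thesis using folded unfolding star.proportional_def \<Phi>_def
        by (auto dest!: spec[of _ None])
    next
      case 3
      then show ?thesis using outside[of "braid_word s t h" k] outside[of "braid_word t s h" k] sub[of s t h] sub[of t s h]
        by (auto simp: insert_commute intro: exI[of _ 1])
    qed
  qed
qed

end

section \<open>Seeds\<close>

lemma apply_seq_simps [simp]:
  "apply_seq [] S = S"
  "apply_seq (s # \<phi>) S = apply_step s (apply_seq \<phi> S)"
  "apply_seq (\<phi> @ \<psi>) S = apply_seq \<phi> (apply_seq \<psi> S)"
  by (simp_all add: apply_seq_def)

lemma svert_mutate [simp]: "svert (mutate k S) = svert S"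
  by (simp add: mutate_def Let_def)

lemma svert_permute_seed [simp]: "svert (permute_seed \<pi> S) = svert S"
  by (simp add: permute_seed_def Let_def)

lemma svert_apply_step [simp]: "svert (apply_step s S) = svert S"
  by (cases s) simp_all

lemma svert_apply_seq [simp]: "svert (apply_seq \<phi> S) = svert S"
  by (induction \<phi>) simp_all

lemma mutate_simps:
  "swt (mutate k S) = swt S"
  "sexch (mutate k S) i j = (if k = i \<or> k = j then - sexch S i j else sexch S i j +
     (\<bar>sexch S i k\<bar> * sexch S k j + sexch S i k * \<bar>sexch S k j\<bar>) div 2)"
  "sX (mutate k S) i = (if i = k then inverse (sX S k)
     else sX S i * (1 + sX S k powi (- sgn (sexch S i k))) powi (- sexch S i k))"
  "sA (mutate k S) i = (if i = k then inverse (sA S k) *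
       ((\<Prod>j | j \<in> svert S \<and> sexch S k j > 0. sA S j powi sexch S k j)
       + (\<Prod>j | j \<in> svert S \<and> sexch S k j < 0. sA S j powi (- sexch S k j)))
     else sA S i)"
  by (simp_all add: mutate_def Let_def)

lemma permute_seed_simps:
  "swt (permute_seed \<pi> S) i = swt S (inv_into UNIV \<pi> i)"
  "sexch (permute_seed \<pi> S) i j = sexch S (inv_into UNIV \<pi> i) (inv_into UNIV \<pi> j)"
  "sX (permute_seed \<pi> S) i = sX S (inv_into UNIV \<pi> i)"
  "sA (permute_seed \<pi> S) i = sA S (inv_into UNIV \<pi> i)"
  by (simp_all add: permute_seed_def Let_def)

lemma same_quiver_refl [simp]: "same_quiver S S"
  by (simp add: same_quiver_def)

lemma same_quiver_sym: "same_quiver S T \<Longrightarrow> same_quiver T S"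
  by (simp add: same_quiver_def)

lemma same_quiver_trans [trans]: "same_quiver S T \<Longrightarrow> same_quiver T U \<Longrightarrow> same_quiver S U"
  by (simp add: same_quiver_def)

lemma same_seed_refl [simp]: "same_seed S S"
  by (simp add: same_seed_def)

lemma same_seed_sym: "same_seed S T \<Longrightarrow> same_seed T S"
  by (auto simp: same_seed_def same_quiver_def)

lemma same_seed_trans [trans]: "same_seed S T \<Longrightarrow> same_seed T U \<Longrightarrow> same_seed S U"
  by (auto simp: same_seed_def same_quiver_def)

lemma same_seed_same_quiver: "same_seed S T \<Longrightarrow> same_quiver S T"
  by (simp add: same_seed_def)

lemma same_quiver_apply_step:
  assumes "same_quiver S T" "step_on (svert S) s"
  shows "same_quiver (apply_step s S) (apply_step s T)"
proof (cases s)
  case (Mut k)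
  then show ?thesis using assms by (auto simp: same_quiver_def mutate_simps)
next
  case (Perm \<pi>)
  then have "inv_into UNIV \<pi> i \<in> svert S" if "i \<in> svert S" for i
    using assms that permutes_inv permutes_in_image by fastforce
  then show ?thesis using Perm assms by (auto simp: same_quiver_def permute_seed_simps)
qed

lemma same_quiver_apply_seq:
  "same_quiver S T \<Longrightarrow> \<forall>s\<in>set \<phi>. step_on (svert S) s \<Longrightarrow>
    same_quiver (apply_seq \<phi> S) (apply_seq \<phi> T)"
  by (induction \<phi>) (auto intro: same_quiver_apply_step)

lemma same_seed_mutate:
  assumes "same_seed S T" "k \<in> svert S"
  shows "same_seed (mutate k S) (mutate k T)"
proof -
  have q: "same_quiver (mutate k S) (mutate k T)"
    using same_quiver_apply_step[of S T "Mut k"] assms by (simp add: same_seed_same_quiver)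
  have V: "svert T = svert S" and e: "\<And>i j. i \<in> svert S \<Longrightarrow> j \<in> svert S \<Longrightarrow> sexch T i j = sexch S i j"
    and A: "\<And>i. i \<in> svert S \<Longrightarrow> sA T i = sA S i" and X: "\<And>i. i \<in> svert S \<Longrightarrow> sX T i = sX S i"
    using assms(1) by (auto simp: same_seed_def same_quiver_def)
  have pos: "(\<Prod>j | j \<in> svert S \<and> sexch S k j > 0. sA S j powi sexch S k j)
      = (\<Prod>j | j \<in> svert S \<and> sexch T k j > 0. sA T j powi sexch T k j)"
    by (rule prod.cong) (use assms(2) e A in auto)
  have neg: "(\<Prod>j | j \<in> svert S \<and> sexch S k j < 0. sA S j powi - sexch S k j)
      = (\<Prod>j | j \<in> svert S \<and> sexch T k j < 0. sA T j powi - sexch T k j)"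
    by (rule prod.cong) (use assms(2) e A in auto)
  show ?thesis
    using q assms(2) by (simp add: same_seed_def mutate_simps V e A X pos neg)
qed

lemma same_seed_apply_step:
  assumes "same_seed S T" "step_on (svert S) s"
  shows "same_seed (apply_step s S) (apply_step s T)"
proof (cases s)
  case (Mut k)
  then show ?thesis using same_seed_mutate assms by auto
next
  case (Perm \<pi>)
  then have "inv_into UNIV \<pi> i \<in> svert S" if "i \<in> svert S" for i
    using assms that permutes_inv permutes_in_image by fastforce
  then show ?thesis using Perm assms
    by (auto simp: same_seed_def same_quiver_def permute_seed_simps)
qed

lemma same_seed_apply_seq:
  "same_seed S T \<Longrightarrow> \<forall>s\<in>set \<phi>. step_on (svert S) s \<Longrightarrow>
    same_seed (apply_seq \<phi> S) (apply_seq \<phi> T)"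
  by (induction \<phi>) (auto intro: same_seed_apply_step)

section \<open>Skew-symmetrizable and positive seeds\<close>

lemma exchange_mutation_term:
  "(\<bar>a\<bar> * b + a * \<bar>b\<bar>) div 2 = max a 0 * max b 0 - max (- a) 0 * max (- b) 0" for a b :: int
  by (cases "a \<ge> 0"; cases "b \<ge> 0") (auto simp: max_def)

text \<open>Skew-symmetrizability is carried along because it forces the diagonal entries to vanish,
  on which the involutivity of mutation on the A-variables rests.\<close>

definition skew_seed :: "'v seed \<Rightarrow> bool" where
  "skew_seed S \<longleftrightarrow> (\<forall>i\<in>svert S. swt S i > 0 \<and>
     (\<forall>j\<in>svert S. sexch S i j * swt S j = - sexch S j i * swt S i))"

lemma max_mult_pos: "c > 0 \<Longrightarrow> max a 0 * c = max (a * c) 0" for a c :: int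
  by (auto simp: max_def mult_le_0_iff zero_le_mult_iff)

lemma skew_seed_mutate:
  assumes S: "skew_seed S" and k: "k \<in> svert S"
  shows "skew_seed (mutate k S)"
proof -
  let ?e = "sexch S" and ?d = "swt S"
  have d: "?d i > 0" if "i \<in> svert S" for i using S that by (simp add: skew_seed_def)
  have sk: "?e i j * ?d j = - ?e j i * ?d i" if "i \<in> svert S" "j \<in> svert S" for i j
    using S that unfolding skew_seed_def by blast
  have m1: "max (?e k j) 0 * ?d j = max (- ?e j k) 0 * ?d k"
    and m2: "max (- ?e k j) 0 * ?d j = max (?e j k) 0 * ?d k" if "j \<in> svert S" for j
    using sk[OF k that] d that k by (simp_all add: max_mult_pos)
  have trm: "((\<bar>?e i k\<bar> * ?e k j + ?e i k * \<bar>?e k j\<bar>) div 2) * ?d j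
      = (max (?e i k) 0 * max (- ?e j k) 0 - max (- ?e i k) 0 * max (?e j k) 0) * ?d k"
    if "j \<in> svert S" for i j
    using m1[OF that] m2[OF that] unfolding exchange_mutation_term
    by (simp add: left_diff_distrib mult.assoc)
  show ?thesis
    unfolding skew_seed_def svert_mutate mutate_simps(1,2)
  proof (intro ballI conjI)
    fix i j assume ij: "i \<in> svert S" "j \<in> svert S"
    let ?t = "\<lambda>i j. (\<bar>?e i k\<bar> * ?e k j + ?e i k * \<bar>?e k j\<bar>) div 2"
    show "(if k = i \<or> k = j then - ?e i j else ?e i j + ?t i j) * ?d j
        = - (if k = j \<or> k = i then - ?e j i else ?e j i + ?t j i) * ?d i"
    proof (cases "k = i \<or> k = j")
      case True
      then have "k = j \<or> k = i" by blast
      then show ?thesis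
        unfolding if_P[OF True] if_P[OF \<open>k = j \<or> k = i\<close>] by (simp only: mult_minus_left sk[OF ij])
    next
      case False
      then have F: "\<not> (k = j \<or> k = i)" by blast
      have "?t i j * ?d j = - (?t j i * ?d i)"
        unfolding trm[OF ij(1)] trm[OF ij(2)] by (simp only: algebra_simps)
      then show ?thesis
        unfolding if_not_P[OF False] if_not_P[OF F]
        by (simp only: distrib_right mult_minus_left sk[OF ij] minus_add_distrib)
    qed
  qed (rule d)
qed

definition positive_seed :: "'v seed \<Rightarrow> bool" where
  "positive_seed S \<longleftrightarrow> skew_seed S \<and>
     (\<forall>i\<in>svert S. sX S i \<in> subtraction_free \<and> sA S i \<in> subtraction_free)"

lemma positive_seed_exch_diag: "positive_seed S \<Longrightarrow> k \<in> svert S \<Longrightarrow> sexch S k k = 0"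
proof -
  assume "positive_seed S" and k: "k \<in> svert S"
  then have "sexch S k k * swt S k = - sexch S k k * swt S k" "swt S k > 0"
    unfolding positive_seed_def skew_seed_def by blast+
  then show ?thesis by simp
qed

lemma positive_seed_apply_step:
  assumes "positive_seed S" "step_on (svert S) s"
  shows "positive_seed (apply_step s S)"
proof (cases s)
  case (Mut k)
  then have k: "k \<in> svert S" using assms by simp
  have "sX (mutate k S) i \<in> subtraction_free" if "i \<in> svert S" for i
    using assms(1) k that unfolding positive_seed_def mutate_simps
    by (auto intro!: subtraction_free.mult_pos subtraction_free.power_int_pos subtraction_free.add_pos)
  moreover have "sA (mutate k S) i \<in> subtraction_free" if "i \<in> svert S" for i
    using assms(1) k that unfolding positive_seed_def mutate_simps
    by (auto intro!: subtraction_free.mult_pos subtraction_free.power_int_pos subtraction_free.add_pos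
        subtraction_free.prod_pos)
  moreover have "skew_seed (mutate k S)"
    using assms(1) k by (simp add: positive_seed_def skew_seed_mutate)
  ultimately show ?thesis using Mut by (simp add: positive_seed_def)
next
  case (Perm \<pi>)
  then have "inv_into UNIV \<pi> i \<in> svert S" if "i \<in> svert S" for i
    using assms that permutes_inv permutes_in_image by fastforce
  then show ?thesis
    using Perm assms(1)
    unfolding positive_seed_def skew_seed_def Perm apply_step.simps svert_permute_seed permute_seed_simps
    by blast
qed

lemma positive_seed_apply_seq:
  "positive_seed S \<Longrightarrow> \<forall>s\<in>set \<phi>. step_on (svert S) s \<Longrightarrow> positive_seed (apply_seq \<phi> S)"
  by (induction \<phi>) (auto intro: positive_seed_apply_step)

lemma exchange_mult_wt:
  assumes "weighted_quiver Q" "i \<in> verts Q" "j \<in> verts Q"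
  shows "exchange Q i j * wt Q j = - exchange Q j i * wt Q i"
proof -
  let ?g = "gcd (wt Q i) (wt Q j)"
  have "arr Q i j = - arr Q j i"
    using assms unfolding weighted_quiver_def by blast
  moreover have "wt Q i div ?g * wt Q j = wt Q j div gcd (wt Q j) (wt Q i) * wt Q i"
    by (metis dvd_div_mult gcd.commute gcd_dvd1 mult.commute)
  ultimately show ?thesis by (simp add: exchange_def mult.assoc)
qed

lemma positive_initial_seed:
  assumes "weighted_quiver Q"
  shows "positive_seed (initial_seed Q)"
proof -
  have s: "svert (initial_seed Q) = verts Q" "swt (initial_seed Q) = wt Q"
    "sexch (initial_seed Q) = exchange Q" "sX (initial_seed Q) = ratfun_var"
    "sA (initial_seed Q) = ratfun_var"
    by (simp_all add: initial_seed_def)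
  have "wt Q i > 0" if "i \<in> verts Q" for i
    using assms that unfolding weighted_quiver_def by blast
  then show ?thesis
    unfolding positive_seed_def skew_seed_def s using exchange_mult_wt[OF assms] ratfun_var_pos by blast
qed

subsection \<open>Inverse mutation sequences\<close>

lemma sexch_mutate_mutate: "sexch (mutate k (mutate k S)) i j = sexch S i j"
proof -
  have "(\<bar>a\<bar> * b + a * \<bar>b\<bar>) div 2 + (\<bar>a\<bar> * (- b) + (- a) * \<bar>b\<bar>) div 2 = 0" for a b :: int
    by (cases "a \<ge> 0"; cases "b \<ge> 0") auto
  from this[of "sexch S i k" "sexch S k j"] show ?thesis
    by (auto simp: mutate_simps)
qed

lemma same_quiver_mutate_mutate: "same_quiver (mutate k (mutate k S)) S"
  by (simp add: same_quiver_def sexch_mutate_mutate) (simp add: mutate_simps)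

lemma mutate_involution:
  assumes "positive_seed S" "k \<in> svert S"
  shows "same_seed (mutate k (mutate k S)) S"
proof -
  have X: "sX S i \<in> subtraction_free" and A: "sA S i \<in> subtraction_free" if "i \<in> svert S" for i
    using assms(1) that by (auto simp: positive_seed_def)
  have "sX (mutate k (mutate k S)) i = sX S i" if i: "i \<in> svert S" for i
  proof (cases "i = k")
    case False
    let ?e = "sexch S i k"
    have "1 + sX S k powi (- sgn ?e) \<in> subtraction_free"
      using X[OF assms(2)] by (intro subtraction_free.add_pos subtraction_free.power_int_pos) auto
    then have "(1 + sX S k powi (- sgn ?e)) powi (- ?e) * (1 + sX S k powi (- sgn ?e)) powi ?e = 1"
      by (subst power_int_add[symmetric]) (auto dest: subtraction_free.pos_nonzero)
    then show ?thesis
      using False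
      by (simp add: mutate_simps sgn_minus mult.assoc power_int_minus power_int_inverse)
  qed (simp add: mutate_simps)
  moreover have "sA (mutate k (mutate k S)) i = sA S i" if "i \<in> svert S" for i
  proof (cases "i = k")
    case True
    let ?P = "\<lambda>S. \<Prod>j | j \<in> svert S \<and> sexch S k j > 0. sA S j powi sexch S k j"
    let ?N = "\<lambda>S. \<Prod>j | j \<in> svert S \<and> sexch S k j < 0. sA S j powi - sexch S k j"
    \<comment> \<open>A vanishing diagonal entry keeps the variable at \<open>k\<close>, the only
      one that changes, out of both exchange products; negating row \<open>k\<close> then merely
      interchanges them.\<close>
    have kk: "sexch S k k = 0" using assms by (rule positive_seed_exch_diag)
    have P: "?P (mutate k S) = ?N S"
      by (rule prod.cong) (use kk in \<open>auto simp: mutate_simps\<close>)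
    have N: "?N (mutate k S) = ?P S"
      by (rule prod.cong) (use kk in \<open>auto simp: mutate_simps\<close>)
    have "?P S + ?N S \<in> subtraction_free"
      using A by (intro subtraction_free.add_pos subtraction_free.prod_pos
          subtraction_free.power_int_pos) auto
    then have nz: "?P S + ?N S \<noteq> 0" by (rule subtraction_free.pos_nonzero)
    have "sA (mutate k (mutate k S)) k = inverse (sA (mutate k S) k) * (?P (mutate k S) + ?N (mutate k S))"
      by (simp only: mutate_simps(4)[of k "mutate k S"] refl if_True)
    also have "\<dots> = inverse (inverse (sA S k) * (?P S + ?N S)) * (?N S + ?P S)"
      unfolding P N by (simp only: mutate_simps(4) refl if_True)
    also have "\<dots> = sA S k" using nz by (simp add: add.commute)
    finally show ?thesis using True by simp
  qed (simp add: mutate_simps)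
  ultimately show ?thesis
    by (simp add: same_seed_def same_quiver_mutate_mutate)
qed

lemma permute_seed_inverse:
  assumes "\<pi> permutes svert S"
  shows "same_seed (permute_seed \<pi> (permute_seed (inv_into UNIV \<pi>) S)) S"
    and "same_seed (permute_seed (inv_into UNIV \<pi>) (permute_seed \<pi> S)) S"
proof -
  have "inv_into UNIV (inv_into UNIV \<pi>) = \<pi>"
    using assms permutes_bij inv_inv_eq by blast
  then show "same_seed (permute_seed \<pi> (permute_seed (inv_into UNIV \<pi>) S)) S"
    "same_seed (permute_seed (inv_into UNIV \<pi>) (permute_seed \<pi> S)) S"
    using permutes_inverses[OF assms]
    by (simp_all add: same_seed_def same_quiver_def permute_seed_simps)
qed

lemma step_on_step_inv: "step_on I s \<Longrightarrow> step_on I (step_inv s)"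
  by (cases s) (auto intro: permutes_inv)

lemma step_on_seq_inv: "\<forall>s\<in>set \<phi>. step_on I s \<Longrightarrow> \<forall>s\<in>set (seq_inv \<phi>). step_on I s"
  by (auto simp: seq_inv_def intro: step_on_step_inv)

lemma step_inv_cancel:
  assumes "positive_seed S" "step_on (svert S) s"
  shows "same_seed (apply_step (step_inv s) (apply_step s S)) S"
    and "same_seed (apply_step s (apply_step (step_inv s) S)) S"
  using assms by (cases s; simp add: mutate_involution permute_seed_inverse)+

lemma seq_inv_cancel_left:
  assumes "positive_seed S" "\<forall>s\<in>set \<phi>. step_on (svert S) s"
  shows "same_seed (apply_seq (seq_inv \<phi>) (apply_seq \<phi> S)) S"
  using assms(2)
proof (induction \<phi>)
  case (Cons s \<phi>)
  have "same_seed (apply_seq (seq_inv \<phi>) (apply_step (step_inv s) (apply_step s (apply_seq \<phi> S))))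
      (apply_seq (seq_inv \<phi>) (apply_seq \<phi> S))"
    using Cons.prems assms(1)
    by (intro same_seed_apply_seq step_inv_cancel) (auto intro: positive_seed_apply_seq dest: step_on_seq_inv)
  also have "same_seed \<dots> S" using Cons by simp
  finally show ?case by (simp add: seq_inv_def)
qed (simp add: seq_inv_def)

lemma seq_inv_cancel_right:
  assumes "positive_seed S" "\<forall>s\<in>set \<phi>. step_on (svert S) s"
  shows "same_seed (apply_seq \<phi> (apply_seq (seq_inv \<phi>) S)) S"
  using assms
proof (induction \<phi> arbitrary: S)
  case (Cons s \<phi>)
  have 1: "positive_seed (apply_step (step_inv s) S)"
    using Cons.prems by (intro positive_seed_apply_step step_on_step_inv) auto
  have "same_seed (apply_step s (apply_seq \<phi> (apply_seq (seq_inv \<phi>) (apply_step (step_inv s) S))))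
      (apply_step s (apply_step (step_inv s) S))"
    using Cons.prems 1 by (intro same_seed_apply_step Cons.IH) auto
  also have "same_seed \<dots> S" using Cons.prems by (simp add: step_inv_cancel)
  finally show ?case by (simp add: seq_inv_def)
qed (simp add: seq_inv_def)

subsection \<open>Naturality\<close>

definition seed_subst :: "('v \<Rightarrow> 'v ratfun) \<Rightarrow> ('v \<Rightarrow> 'v ratfun) \<Rightarrow> 'v seed \<Rightarrow> 'v seed" where
  "seed_subst x a S = S\<lparr>sX := \<lambda>i. ratfun_subst x (sX S i), sA := \<lambda>i. ratfun_subst a (sA S i)\<rparr>"

lemma seed_subst_simps [simp]:
  "svert (seed_subst x a S) = svert S" "swt (seed_subst x a S) = swt S"
  "sexch (seed_subst x a S) = sexch S"
  "sX (seed_subst x a S) i = ratfun_subst x (sX S i)"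
  "sA (seed_subst x a S) i = ratfun_subst a (sA S i)"
  by (simp_all add: seed_subst_def)

context
  fixes x a :: "'v \<Rightarrow> 'v ratfun"
  assumes x: "\<And>v. x v \<in> subtraction_free" and a: "\<And>v. a v \<in> subtraction_free"
begin

lemma same_seed_subst: "same_seed S T \<Longrightarrow> same_seed (seed_subst x a S) (seed_subst x a T)"
  by (simp add: same_seed_def same_quiver_def)

text \<open>Mutation is expressed by sums, products and integer powers of subtraction-free
  functions, and on these substitution is a homomorphism.\<close>

lemma apply_step_seed_subst:
  assumes "positive_seed S" "step_on (svert S) s"
  shows "same_seed (apply_step s (seed_subst x a S)) (seed_subst x a (apply_step s S))"
proof (cases s)
  case (Mut k)
  then have k: "k \<in> svert S" using assms by simp
  have X: "sX S i \<in> subtraction_free" and A: "sA S i \<in> subtraction_free" if "i \<in> svert S" for i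
    using assms(1) that by (auto simp: positive_seed_def)
  have P: "(\<Prod>j | j \<in> svert S \<and> R j. sA S j powi e j) \<in> subtraction_free"
    and S: "(\<Prod>j | j \<in> svert S \<and> R j. ratfun_subst a (sA S j) powi e j)
      = ratfun_subst a (\<Prod>j | j \<in> svert S \<and> R j. sA S j powi e j)" for R e
  proof -
    show "(\<Prod>j | j \<in> svert S \<and> R j. sA S j powi e j) \<in> subtraction_free"
      by (intro subtraction_free.prod_pos subtraction_free.power_int_pos A) simp
    have "ratfun_subst a (\<Prod>j | j \<in> svert S \<and> R j. sA S j powi e j)
        = (\<Prod>j | j \<in> svert S \<and> R j. ratfun_subst a (sA S j powi e j))"
      by (intro ratfun_subst_prod a subtraction_free.power_int_pos A) simp
    also have "\<dots> = (\<Prod>j | j \<in> svert S \<and> R j. ratfun_subst a (sA S j) powi e j)"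
      by (rule prod.cong) (simp_all add: ratfun_subst_power_int[OF a] A)
    finally show "(\<Prod>j | j \<in> svert S \<and> R j. ratfun_subst a (sA S j) powi e j)
      = ratfun_subst a (\<Prod>j | j \<in> svert S \<and> R j. sA S j powi e j)" ..
  qed
  have "sX (mutate k (seed_subst x a S)) i = ratfun_subst x (sX (mutate k S) i)"
    if i: "i \<in> svert S" for i
  proof -
    have 1: "sX S k powi n \<in> subtraction_free" for n
      using X[OF k] by (rule subtraction_free.power_int_pos)
    then have 2: "1 + sX S k powi n \<in> subtraction_free" for n by auto
    then have "(1 + sX S k powi n) powi m \<in> subtraction_free" for n m
      by (rule subtraction_free.power_int_pos)
    then show ?thesis
      using X[OF i] X[OF k] 1 2
      by (simp add: mutate_simps ratfun_subst_inverse[OF x, OF _ subtraction_free.one_pos]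
          ratfun_subst_mult[OF x] ratfun_subst_power_int[OF x] ratfun_subst_add[OF x] ratfun_subst_1[OF x])
  qed
  moreover have "sA (mutate k (seed_subst x a S)) i = ratfun_subst a (sA (mutate k S) i)"
    if i: "i \<in> svert S" for i
  proof -
    note P1 = P[where R = "\<lambda>j. 0 < sexch S k j" and e = "sexch S k"]
    note P2 = P[where R = "\<lambda>j. sexch S k j < 0" and e = "\<lambda>j. - sexch S k j"]
    show ?thesis
      using A[OF k] P1 P2 subtraction_free.add_pos[OF P1 P2] subtraction_free.inverse_pos[OF A[OF k]]
      by (simp add: mutate_simps ratfun_subst_inverse[OF a, OF _ subtraction_free.one_pos]
          ratfun_subst_mult[OF a] ratfun_subst_add[OF a] S)
  qed
  ultimately show ?thesis
    using Mut by (simp add: same_seed_def same_quiver_def mutate_simps(1,2))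
next
  case (Perm \<pi>)
  then show ?thesis by (simp add: same_seed_def same_quiver_def permute_seed_simps)
qed

lemma apply_seq_seed_subst:
  assumes "positive_seed S" "\<forall>s\<in>set \<phi>. step_on (svert S) s"
  shows "same_seed (apply_seq \<phi> (seed_subst x a S)) (seed_subst x a (apply_seq \<phi> S))"
  using assms(2)
proof (induction \<phi>)
  case (Cons s \<phi>)
  have "same_seed (apply_step s (apply_seq \<phi> (seed_subst x a S)))
      (apply_step s (seed_subst x a (apply_seq \<phi> S)))"
    using Cons by (intro same_seed_apply_step) auto
  also have "same_seed \<dots> (seed_subst x a (apply_step s (apply_seq \<phi> S)))"
    using Cons.prems assms(1) by (intro apply_step_seed_subst positive_seed_apply_seq) auto
  finally show ?case by simp
qed simp

end

text \<open>Outside the vertex set the substituted values are irrelevant; they are set to \<open>1\<close>.\<close>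

lemma apply_seq_natural:
  assumes Q: "weighted_quiver Q" and S: "positive_seed S" "same_quiver S (initial_seed Q)"
  obtains x a where "\<And>v. x v \<in> subtraction_free" "\<And>v. a v \<in> subtraction_free"
    "\<And>i. i \<in> verts Q \<Longrightarrow> x i = sX S i" "\<And>i. i \<in> verts Q \<Longrightarrow> a i = sA S i"
    "\<And>\<phi>. \<forall>s\<in>set \<phi>. step_on (verts Q) s \<Longrightarrow>
      same_seed (apply_seq \<phi> S) (seed_subst x a (apply_seq \<phi> (initial_seed Q)))"
proof -
  let ?S0 = "initial_seed Q"
  define x where "x i = (if i \<in> verts Q then sX S i else 1)" for i
  define a where "a i = (if i \<in> verts Q then sA S i else 1)" for i
  have V: "svert S = verts Q" using S(2) by (simp add: same_quiver_def initial_seed_def)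
  have V0: "svert ?S0 = verts Q" by (simp add: initial_seed_def)
  have x: "x v \<in> subtraction_free" and a: "a v \<in> subtraction_free" for v
    using S(1) by (simp_all add: x_def a_def positive_seed_def V)
  have "same_seed S (seed_subst x a ?S0)"
    using S(2) V by (simp add: same_seed_def same_quiver_def)
      (simp add: initial_seed_def ratfun_subst_var x_def a_def)
  note S_subst = this
  have "same_seed (apply_seq \<phi> S) (seed_subst x a (apply_seq \<phi> ?S0))"
    if \<phi>: "\<forall>s\<in>set \<phi>. step_on (verts Q) s" for \<phi>
  proof -
    have "same_seed (apply_seq \<phi> S) (apply_seq \<phi> (seed_subst x a ?S0))"
      by (rule same_seed_apply_seq[OF S_subst]) (simp add: V \<phi>)
    also have "same_seed \<dots> (seed_subst x a (apply_seq \<phi> ?S0))"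
      by (rule apply_seq_seed_subst[OF x a positive_initial_seed[OF Q]]) (simp add: V0 \<phi>)
    finally show ?thesis .
  qed
  note nat = this
  show ?thesis
    by (rule that[of x a, OF x a _ _ nat]) (simp_all add: x_def a_def)
qed

subsection \<open>The cluster modular group\<close>

lemma quiver_preserving_append:
  assumes "\<phi> \<in> quiver_preserving Q" "\<psi> \<in> quiver_preserving Q"
  shows "\<phi> @ \<psi> \<in> quiver_preserving Q"
proof -
  have "same_quiver (apply_seq \<phi> (apply_seq \<psi> (initial_seed Q))) (apply_seq \<phi> (initial_seed Q))"
    using assms by (intro same_quiver_apply_seq) (auto simp: quiver_preserving_def initial_seed_def)
  then show ?thesis
    using assms by (auto simp: quiver_preserving_def intro: same_quiver_trans)
qed

context
  fixes Q :: "'v wquiver"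
  assumes Q: "weighted_quiver Q"
begin

abbreviation "S0 \<equiv> initial_seed Q"

lemma svert_S0: "svert S0 = verts Q"
  by (simp add: initial_seed_def)

lemma quiver_preservingD:
  assumes "\<phi> \<in> quiver_preserving Q"
  shows "\<forall>s\<in>set \<phi>. step_on (verts Q) s" "same_quiver (apply_seq \<phi> S0) S0"
    "positive_seed (apply_seq \<phi> S0)"
  using assms positive_seed_apply_seq[OF positive_initial_seed[OF Q], of \<phi>]
  by (auto simp: quiver_preserving_def svert_S0)

lemma seq_inv_quiver_preserving:
  assumes "\<phi> \<in> quiver_preserving Q"
  shows "seq_inv \<phi> \<in> quiver_preserving Q"
proof -
  note \<phi> = quiver_preservingD[OF assms]
  have "same_quiver (apply_seq (seq_inv \<phi>) S0) (apply_seq (seq_inv \<phi>) (apply_seq \<phi> S0))"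
    using same_quiver_sym[OF \<phi>(2)] step_on_seq_inv[OF \<phi>(1)]
    by (intro same_quiver_apply_seq) (auto simp: svert_S0)
  also have "same_quiver \<dots> S0"
    using seq_inv_cancel_left[OF positive_initial_seed[OF Q], of \<phi>] \<phi>(1)
    by (intro same_seed_same_quiver) (simp add: svert_S0)
  finally show ?thesis
    using step_on_seq_inv[OF \<phi>(1)] by (simp add: quiver_preserving_def)
qed

text \<open>Cancelling \<open>seq_inv\<close> on either side turns the relation into a comparison of
  the two seeds reached, the form used from here on.\<close>

lemma cmg_rel_iff:
  assumes "\<phi> \<in> quiver_preserving Q" "\<psi> \<in> quiver_preserving Q"
  shows "(\<phi>, \<psi>) \<in> cmg_rel Q \<longleftrightarrow> same_seed (apply_seq \<phi> S0) (apply_seq \<psi> S0)"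
proof -
  note \<phi> = quiver_preservingD[OF assms(1)] and \<psi> = quiver_preservingD[OF assms(2)]
  note inv = step_on_seq_inv[OF \<phi>(1)]
  have "(\<phi>, \<psi>) \<in> cmg_rel Q \<longleftrightarrow> same_seed (apply_seq (seq_inv \<phi>) (apply_seq \<psi> S0)) S0"
    using assms quiver_preserving_append[OF seq_inv_quiver_preserving]
    by (simp add: cmg_rel_def seed_preserving_def)
  also have "\<dots> \<longleftrightarrow> same_seed (apply_seq \<phi> S0) (apply_seq \<psi> S0)"
  proof
    assume "same_seed (apply_seq (seq_inv \<phi>) (apply_seq \<psi> S0)) S0"
    then have "same_seed (apply_seq \<phi> (apply_seq (seq_inv \<phi>) (apply_seq \<psi> S0))) (apply_seq \<phi> S0)"
      using \<phi>(1) by (intro same_seed_apply_seq) (auto simp: svert_S0)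
    moreover have "same_seed (apply_seq \<phi> (apply_seq (seq_inv \<phi>) (apply_seq \<psi> S0))) (apply_seq \<psi> S0)"
      using \<phi>(1) \<psi>(3) by (intro seq_inv_cancel_right) (auto simp: svert_S0)
    ultimately show "same_seed (apply_seq \<phi> S0) (apply_seq \<psi> S0)"
      by (meson same_seed_sym same_seed_trans)
  next
    assume "same_seed (apply_seq \<phi> S0) (apply_seq \<psi> S0)"
    then have "same_seed (apply_seq (seq_inv \<phi>) (apply_seq \<phi> S0)) (apply_seq (seq_inv \<phi>) (apply_seq \<psi> S0))"
      using inv by (intro same_seed_apply_seq) (auto simp: svert_S0)
    moreover have "same_seed (apply_seq (seq_inv \<phi>) (apply_seq \<phi> S0)) S0"
      using \<phi>(1) by (intro seq_inv_cancel_left positive_initial_seed Q) (auto simp: svert_S0)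
    ultimately show "same_seed (apply_seq (seq_inv \<phi>) (apply_seq \<psi> S0)) S0"
      by (meson same_seed_sym same_seed_trans)
  qed
  finally show ?thesis .
qed

lemma mem_cmg_class_iff:
  assumes "\<phi> \<in> quiver_preserving Q"
  shows "\<psi> \<in> cmg_class Q \<phi> \<longleftrightarrow>
    \<psi> \<in> quiver_preserving Q \<and> same_seed (apply_seq \<phi> S0) (apply_seq \<psi> S0)"
  using cmg_rel_iff[OF assms] assms by (auto simp: cmg_class_def) (auto simp: cmg_rel_def)

lemma cmg_class_eq_iff:
  assumes "\<phi> \<in> quiver_preserving Q" "\<psi> \<in> quiver_preserving Q"
  shows "cmg_class Q \<phi> = cmg_class Q \<psi> \<longleftrightarrow> same_seed (apply_seq \<phi> S0) (apply_seq \<psi> S0)"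
proof
  assume "cmg_class Q \<phi> = cmg_class Q \<psi>"
  then have "\<psi> \<in> cmg_class Q \<phi>" using assms by (simp add: mem_cmg_class_iff)
  then show "same_seed (apply_seq \<phi> S0) (apply_seq \<psi> S0)" using assms by (simp add: mem_cmg_class_iff)
next
  assume s: "same_seed (apply_seq \<phi> S0) (apply_seq \<psi> S0)"
  show "cmg_class Q \<phi> = cmg_class Q \<psi>"
    using assms
    by (auto simp: mem_cmg_class_iff
        intro: same_seed_trans[OF s] same_seed_trans[OF same_seed_sym[OF s]])
qed

lemma cmg_class_carrier:
  "\<phi> \<in> quiver_preserving Q \<Longrightarrow> cmg_class Q \<phi> \<in> carrier (cluster_modular_group Q)"
  by (auto simp: cluster_modular_group_def cmg_class_def quotient_def)

text \<open>Since \<open>\<psi>\<close> acts first, the two sequences start from a seed other than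
  the initial one. That seed has the same quiver, so its mutations are substitution instances of
  those of the initial seed, and the equality carries over.\<close>

lemma same_seed_append_right:
  assumes "\<phi> \<in> quiver_preserving Q" "\<phi>' \<in> quiver_preserving Q" "\<psi> \<in> quiver_preserving Q"
    and "same_seed (apply_seq \<phi> S0) (apply_seq \<phi>' S0)"
  shows "same_seed (apply_seq (\<phi> @ \<psi>) S0) (apply_seq (\<phi>' @ \<psi>) S0)"
proof -
  note \<psi> = quiver_preservingD[OF assms(3)]
  obtain x a where x: "\<And>v. x v \<in> subtraction_free" "\<And>v. a v \<in> subtraction_free"
    and nat: "\<And>\<phi>. \<forall>s\<in>set \<phi>. step_on (verts Q) s \<Longrightarrow>
      same_seed (apply_seq \<phi> (apply_seq \<psi> S0)) (seed_subst x a (apply_seq \<phi> S0))"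
    using apply_seq_natural[OF Q \<psi>(3,2)] by metis
  have "same_seed (apply_seq \<phi> (apply_seq \<psi> S0)) (seed_subst x a (apply_seq \<phi> S0))"
    using assms(1) by (intro nat quiver_preservingD)
  also have "same_seed \<dots> (seed_subst x a (apply_seq \<phi>' S0))"
    using x assms(4) by (rule same_seed_subst)
  also have "same_seed \<dots> (apply_seq \<phi>' (apply_seq \<psi> S0))"
    using assms(2) by (intro same_seed_sym[OF nat] quiver_preservingD)
  finally show ?thesis by simp
qed

lemma same_seed_append_left:
  assumes "\<phi> \<in> quiver_preserving Q" "same_seed (apply_seq \<psi> S0) (apply_seq \<psi>' S0)"
  shows "same_seed (apply_seq (\<phi> @ \<psi>) S0) (apply_seq (\<phi> @ \<psi>') S0)"
  using assms quiver_preservingD(1)[OF assms(1)]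
  by (simp add: same_seed_apply_seq svert_S0)

lemma cmg_class_mult:
  assumes "\<phi> \<in> quiver_preserving Q" "\<psi> \<in> quiver_preserving Q"
  shows "cmg_class Q \<phi> \<otimes>\<^bsub>cluster_modular_group Q\<^esub> cmg_class Q \<psi> = cmg_class Q (\<phi> @ \<psi>)"
proof -
  have "cmg_class Q (\<phi>' @ \<psi>') = cmg_class Q (\<phi> @ \<psi>)"
    if "\<phi>' \<in> cmg_class Q \<phi>" "\<psi>' \<in> cmg_class Q \<psi>" for \<phi>' \<psi>'
  proof -
    have q: "\<phi>' \<in> quiver_preserving Q" "\<psi>' \<in> quiver_preserving Q"
      and s: "same_seed (apply_seq \<phi> S0) (apply_seq \<phi>' S0)" "same_seed (apply_seq \<psi> S0) (apply_seq \<psi>' S0)"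
      using that assms by (simp_all add: mem_cmg_class_iff)
    have "same_seed (apply_seq (\<phi> @ \<psi>) S0) (apply_seq (\<phi>' @ \<psi>) S0)"
      using assms q s by (intro same_seed_append_right)
    also have "same_seed \<dots> (apply_seq (\<phi>' @ \<psi>') S0)"
      using q s by (intro same_seed_append_left)
    finally have "same_seed (apply_seq (\<phi>' @ \<psi>') S0) (apply_seq (\<phi> @ \<psi>) S0)"
      by (rule same_seed_sym)
    then show ?thesis
      using assms q by (simp add: cmg_class_eq_iff quiver_preserving_append del: apply_seq_simps)
  qed
  note const = this
  have mem: "\<phi> \<in> cmg_class Q \<phi>" "\<psi> \<in> cmg_class Q \<psi>"
    using assms by (simp_all add: mem_cmg_class_iff)
  have "cmg_class Q \<phi> \<otimes>\<^bsub>cluster_modular_group Q\<^esub> cmg_class Q \<psi>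
      = (\<Union>\<phi>'\<in>cmg_class Q \<phi>. \<Union>\<psi>'\<in>cmg_class Q \<psi>. cmg_class Q (\<phi>' @ \<psi>'))"
    by (simp add: cluster_modular_group_def)
  also have "\<dots> = (\<Union>\<phi>'\<in>cmg_class Q \<phi>. \<Union>\<psi>'\<in>cmg_class Q \<psi>. cmg_class Q (\<phi> @ \<psi>))"
    by (intro SUP_cong refl const)
  also have "\<dots> = cmg_class Q (\<phi> @ \<psi>)"
    using mem by blast
  finally show ?thesis .
qed

lemma cmg_class_representative:
  assumes "\<phi> \<in> quiver_preserving Q" "i \<in> verts Q"
  shows "sX (apply_seq (SOME \<psi>. \<psi> \<in> cmg_class Q \<phi>) S0) i = sX (apply_seq \<phi> S0) i"
    and "sA (apply_seq (SOME \<psi>. \<psi> \<in> cmg_class Q \<phi>) S0) i = sA (apply_seq \<phi> S0) i"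
proof -
  have "\<phi> \<in> cmg_class Q \<phi>" using assms by (simp add: mem_cmg_class_iff)
  then have "(SOME \<psi>. \<psi> \<in> cmg_class Q \<phi>) \<in> cmg_class Q \<phi>" by (rule someI)
  then have "same_seed (apply_seq \<phi> S0) (apply_seq (SOME \<psi>. \<psi> \<in> cmg_class Q \<phi>) S0)"
    using assms by (simp add: mem_cmg_class_iff)
  then show "sX (apply_seq (SOME \<psi>. \<psi> \<in> cmg_class Q \<phi>) S0) i = sX (apply_seq \<phi> S0) i"
    "sA (apply_seq (SOME \<psi>. \<psi> \<in> cmg_class Q \<phi>) S0) i = sA (apply_seq \<phi> S0) i"
    using assms(2) by (simp_all add: same_seed_def svert_S0)
qed

lemma pullback_laurent_monomial:
  assumes "\<phi> \<in> quiver_preserving Q"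
  shows "pullback_X Q (cmg_class Q \<phi>) (\<Prod>i\<in>verts Q. ratfun_var i powi b i)
      = (\<Prod>i\<in>verts Q. sX (apply_seq \<phi> S0) i powi b i)"
    and "pullback_A Q (cmg_class Q \<phi>) (\<Prod>i\<in>verts Q. ratfun_var i powi b i)
      = (\<Prod>i\<in>verts Q. sA (apply_seq \<phi> S0) i powi b i)"
proof -
  have fin: "finite (verts Q)" using Q by (simp add: weighted_quiver_def)
  have "sX (apply_seq \<phi> S0) i \<noteq> 0" "sA (apply_seq \<phi> S0) i \<noteq> 0" if "i \<in> verts Q" for i
    using quiver_preservingD(3)[OF assms] that
    by (auto simp: positive_seed_def svert_S0 dest!: bspec[of _ _ i] subtraction_free.pos_nonzero)
  then show "pullback_X Q (cmg_class Q \<phi>) (\<Prod>i\<in>verts Q. ratfun_var i powi b i)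
      = (\<Prod>i\<in>verts Q. sX (apply_seq \<phi> S0) i powi b i)"
    "pullback_A Q (cmg_class Q \<phi>) (\<Prod>i\<in>verts Q. ratfun_var i powi b i)
      = (\<Prod>i\<in>verts Q. sA (apply_seq \<phi> S0) i powi b i)"
    unfolding pullback_X_def pullback_A_def
    by (simp_all add: ratfun_subst_laurent_monomial[OF fin] cmg_class_representative[OF assms])
qed

end

section \<open>Reflections along an oriented cycle\<close>

text \<open>The nested form of R(s), one conjugation for each vertex removed, permits induction on
  the length of the cycle; \<open>R_seq_eq\<close> identifies the two forms.\<close>

fun cycle_reflection :: "'v list \<Rightarrow> 'v mseq" where
  "cycle_reflection [v, w] = [Perm (transpose v w), Mut w, Mut v]"
| "cycle_reflection (v # ws) = Mut v # cycle_reflection ws @ [Mut v]"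
| "cycle_reflection [] = []"

lemma cycle_reflection_Cons:
  "length ws \<ge> 2 \<Longrightarrow> cycle_reflection (v # ws) = Mut v # cycle_reflection ws @ [Mut v]"
  by (cases ws rule: cycle_reflection.cases) auto

definition next_index :: "nat \<Rightarrow> nat \<Rightarrow> nat" where
  "next_index m j = (if Suc j = m then 0 else Suc j)"

text \<open>The vertices \<open>vs\<close> form an oriented cycle, and every other vertex \<open>x\<close> is joined to the cycle
  only by oriented triangles over a single edge, the one with index \<open>e x\<close>, from \<open>vs ! e x\<close> to its
  successor.  Multiplicities \<open>a x\<close> and \<open>a' x\<close> may vanish.\<close>

definition triangulated_cycle ::
    "'v set \<Rightarrow> ('v \<Rightarrow> 'v \<Rightarrow> int) \<Rightarrow> 'v list \<Rightarrow> ('v \<Rightarrow> nat) \<Rightarrow> ('v \<Rightarrow> int) \<Rightarrow> ('v \<Rightarrow> int) \<Rightarrow> bool" where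
  "triangulated_cycle V \<epsilon> vs e a a' \<longleftrightarrow> (let m = length vs in
     finite V \<and> distinct vs \<and> set vs \<subseteq> V \<and> m \<ge> 2 \<and>
     (\<forall>j<m. \<forall>k<m. \<epsilon> (vs ! j) (vs ! k) = of_bool (k = next_index m j) - of_bool (j = next_index m k)) \<and>
     (\<forall>x\<in>V - set vs. e x < m \<and> a x \<ge> 0 \<and> a' x \<ge> 0 \<and> (a x = 0 \<longleftrightarrow> a' x = 0) \<and>
       (\<forall>j<m. \<epsilon> (vs ! j) x = a x * (of_bool (j = next_index m (e x)) - of_bool (j = e x)) \<and>
          \<epsilon> x (vs ! j) = a' x * (of_bool (j = e x) - of_bool (j = next_index m (e x))))))"

lemma triangulated_cycleD:
  assumes "triangulated_cycle V \<epsilon> vs e a a'"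
  shows "finite V" "distinct vs" "set vs \<subseteq> V" "length vs \<ge> 2"
    "\<And>j k. j < length vs \<Longrightarrow> k < length vs \<Longrightarrow> \<epsilon> (vs ! j) (vs ! k) =
      of_bool (k = next_index (length vs) j) - of_bool (j = next_index (length vs) k)"
    "\<And>x. x \<in> V \<Longrightarrow> x \<notin> set vs \<Longrightarrow> e x < length vs \<and> a x \<ge> 0 \<and> a' x \<ge> 0 \<and> (a x = 0 \<longleftrightarrow> a' x = 0)"
    "\<And>x j. x \<in> V \<Longrightarrow> x \<notin> set vs \<Longrightarrow> j < length vs \<Longrightarrow>
      \<epsilon> (vs ! j) x = a x * (of_bool (j = next_index (length vs) (e x)) - of_bool (j = e x))"
    "\<And>x j. x \<in> V \<Longrightarrow> x \<notin> set vs \<Longrightarrow> j < length vs \<Longrightarrow>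
      \<epsilon> x (vs ! j) = a' x * (of_bool (j = e x) - of_bool (j = next_index (length vs) (e x)))"
  using assms unfolding triangulated_cycle_def Let_def by blast+

lemma triangulated_cycle_cong:
  assumes "triangulated_cycle V \<epsilon> vs e a a'" "\<And>i j. i \<in> V \<Longrightarrow> j \<in> V \<Longrightarrow> \<epsilon>' i j = \<epsilon> i j"
  shows "triangulated_cycle V \<epsilon>' vs e a a'"
proof -
  have "vs ! j \<in> V" if "j < length vs" for j
    using triangulated_cycleD(3)[OF assms(1)] that by auto
  then show ?thesis
    using assms unfolding triangulated_cycle_def Let_def by simp
qed

text \<open>Mutation at the first vertex of the cycle removes it from the cycle: it becomes the apex of a
  triangle over the new last edge, and the triangles over the two old edges disappear.\<close>

definition merge_edge :: "nat \<Rightarrow> 'v \<Rightarrow> ('v \<Rightarrow> nat) \<Rightarrow> 'v \<Rightarrow> nat" where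
  "merge_edge n v e x = (if x = v then n - 1 else if e x = 0 \<or> e x = n then 0 else e x - 1)"

definition merge_mult :: "nat \<Rightarrow> 'v \<Rightarrow> ('v \<Rightarrow> nat) \<Rightarrow> ('v \<Rightarrow> int) \<Rightarrow> 'v \<Rightarrow> int" where
  "merge_mult n v e a x = (if x = v then 1 else if e x = 0 \<or> e x = n then 0 else a x)"

lemma triangulated_cycle_mutate:
  assumes cyc: "triangulated_cycle (svert S) (sexch S) (v # ws) e a a'" and n: "length ws \<ge> 2"
  shows "triangulated_cycle (svert S) (sexch (mutate v S)) ws
    (merge_edge (length ws) v e) (merge_mult (length ws) v e a) (merge_mult (length ws) v e a')"
proof -
  let ?n = "length ws" and ?e = "sexch S"
  note D = triangulated_cycleD[OF cyc]
  have ws: "v \<notin> set ws" "distinct ws" "set ws \<subseteq> svert S" "v \<in> svert S" using D(2,3) by auto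
  have neq: "ws ! j \<noteq> v" if "j < ?n" for j using ws that nth_mem by metis
  have inV: "ws ! j \<in> svert S" if "j < ?n" for j using ws that nth_mem by blast
  have cc: "?e (ws ! j) (ws ! k) = of_bool (Suc k = next_index (Suc ?n) (Suc j)) - of_bool (Suc j = next_index (Suc ?n) (Suc k))"
    if "j < ?n" "k < ?n" for j k using D(5)[of "Suc j" "Suc k"] that by simp
  have cv: "?e (ws ! j) v = of_bool (Suc j = ?n) - of_bool (j = 0)" if "j < ?n" for j
    using D(5)[of "Suc j" 0] that n by (auto simp: next_index_def)
  have vc: "?e v (ws ! j) = of_bool (j = 0) - of_bool (Suc j = ?n)" if "j < ?n" for j
    using D(5)[of 0 "Suc j"] that n by (auto simp: next_index_def)
  have ex: "e x \<le> ?n" "a x \<ge> 0" "a' x \<ge> 0" "a x = 0 \<longleftrightarrow> a' x = 0"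
    and xv: "?e x v = a' x * (of_bool (e x = 0) - of_bool (e x = ?n))"
    and vx: "?e v x = a x * (of_bool (e x = ?n) - of_bool (e x = 0))"
    if "x \<in> svert S" "x \<notin> set (v # ws)" for x
    using D(6)[OF that] D(7)[OF that, of 0] D(8)[OF that, of 0] by (auto simp: next_index_def)
  have xc: "?e x (ws ! j) = a' x * (of_bool (Suc j = e x) - of_bool (Suc j = next_index (Suc ?n) (e x)))"
    and cx: "?e (ws ! j) x = a x * (of_bool (Suc j = next_index (Suc ?n) (e x)) - of_bool (Suc j = e x))"
    if "x \<in> svert S" "x \<notin> set (v # ws)" "j < ?n" for x j
    using D(7)[OF that(1,2), of "Suc j"] D(8)[OF that(1,2), of "Suc j"] that(3) by simp_all
  note m = mutate_simps(2)[of v S, unfolded exchange_mutation_term]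
  have 1: "sexch (mutate v S) (ws ! j) (ws ! k) = of_bool (k = next_index ?n j) - of_bool (j = next_index ?n k)"
    if "j < ?n" "k < ?n" for j k
    unfolding m cc[OF that] cv[OF that(1)] vc[OF that(2)]
    using that n neq[OF that(1)] neq[OF that(2)]
    by (auto simp: next_index_def of_bool_def)
  have 2: "merge_edge ?n v e x < ?n \<and> 0 \<le> merge_mult ?n v e a x \<and> 0 \<le> merge_mult ?n v e a' x \<and>
      (merge_mult ?n v e a x = 0 \<longleftrightarrow> merge_mult ?n v e a' x = 0)"
    if "x \<in> svert S - set ws" for x
    using that ex[of x] n by (auto simp: merge_edge_def merge_mult_def)
  have 3: "sexch (mutate v S) (ws ! j) x = merge_mult ?n v e a x *
        (of_bool (j = next_index ?n (merge_edge ?n v e x)) - of_bool (j = merge_edge ?n v e x))"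
    and 4: "sexch (mutate v S) x (ws ! j) = merge_mult ?n v e a' x *
        (of_bool (j = merge_edge ?n v e x) - of_bool (j = next_index ?n (merge_edge ?n v e x)))"
    if x: "x \<in> svert S - set ws" and j: "j < ?n" for x j
  proof -
    have "sexch (mutate v S) (ws ! j) x = merge_mult ?n v e a x *
        (of_bool (j = next_index ?n (merge_edge ?n v e x)) - of_bool (j = merge_edge ?n v e x)) \<and>
      sexch (mutate v S) x (ws ! j) = merge_mult ?n v e a' x *
        (of_bool (j = merge_edge ?n v e x) - of_bool (j = next_index ?n (merge_edge ?n v e x)))"
    proof (cases "x = v")
      case True
      then show ?thesis
        unfolding m using cv[OF j] vc[OF j] j n neq[OF j]
        by (auto simp: next_index_def merge_edge_def merge_mult_def of_bool_def)
    next
      case False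
      then have x': "x \<in> svert S" "x \<notin> set (v # ws)" using x by auto
      show ?thesis
        unfolding m xc[OF x' j] cx[OF x' j] vx[OF x'] xv[OF x'] cv[OF j] vc[OF j]
        using j n neq[OF j] ex[OF x'] False
        by (auto simp: next_index_def merge_edge_def merge_mult_def of_bool_def max_def)
    qed
    then show "sexch (mutate v S) (ws ! j) x = merge_mult ?n v e a x *
        (of_bool (j = next_index ?n (merge_edge ?n v e x)) - of_bool (j = merge_edge ?n v e x))"
      "sexch (mutate v S) x (ws ! j) = merge_mult ?n v e a' x *
        (of_bool (j = merge_edge ?n v e x) - of_bool (j = next_index ?n (merge_edge ?n v e x)))"
      by blast+
  qed
  show ?thesis
    unfolding triangulated_cycle_def Let_def using D(1) ws(2,3) n 1 2 3 4 by blast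
qed

lemma cycle_reflection_steps:
  assumes "set vs \<subseteq> V"
  shows "\<forall>s\<in>set (cycle_reflection vs). step_on V s"
  using assms
  by (induction vs rule: cycle_reflection.induct) (auto intro: permutes_subset[OF permutes_swap_id])

lemma permute_transpose_simps:
  "swt (permute_seed (transpose u w) S) i = swt S (transpose u w i)"
  "sexch (permute_seed (transpose u w) S) i j = sexch S (transpose u w i) (transpose u w j)"
  "sX (permute_seed (transpose u w) S) i = sX S (transpose u w i)"
  "sA (permute_seed (transpose u w) S) i = sA S (transpose u w i)"
  by (simp_all add: permute_seed_simps)

lemma two_cycle_exchange:
  assumes cyc: "triangulated_cycle V \<epsilon> [u, w] e a a'"
  shows "u \<noteq> w" "u \<in> V" "w \<in> V" "\<epsilon> u u = 0" "\<epsilon> w w = 0" "\<epsilon> u w = 0" "\<epsilon> w u = 0"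
    "\<And>x. x \<in> V \<Longrightarrow> x \<noteq> u \<Longrightarrow> x \<noteq> w \<Longrightarrow> e x = 0 \<or> e x = 1"
    "\<And>x. x \<in> V \<Longrightarrow> x \<noteq> u \<Longrightarrow> x \<noteq> w \<Longrightarrow> \<epsilon> u x = (if e x = 0 then - a x else a x)"
    "\<And>x. x \<in> V \<Longrightarrow> x \<noteq> u \<Longrightarrow> x \<noteq> w \<Longrightarrow> \<epsilon> w x = (if e x = 0 then a x else - a x)"
    "\<And>x. x \<in> V \<Longrightarrow> x \<noteq> u \<Longrightarrow> x \<noteq> w \<Longrightarrow> \<epsilon> x u = (if e x = 0 then a' x else - a' x)"
    "\<And>x. x \<in> V \<Longrightarrow> x \<noteq> u \<Longrightarrow> x \<noteq> w \<Longrightarrow> \<epsilon> x w = (if e x = 0 then - a' x else a' x)"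
proof -
  note D = triangulated_cycleD[OF cyc]
  show "u \<noteq> w" "u \<in> V" "w \<in> V" using D(2,3) by auto
  show "\<epsilon> u u = 0" "\<epsilon> w w = 0" "\<epsilon> u w = 0" "\<epsilon> w u = 0"
    using D(5)[of 0 0] D(5)[of 1 1] D(5)[of 0 1] D(5)[of 1 0] by (auto simp: next_index_def)
  fix x assume x: "x \<in> V" "x \<noteq> u" "x \<noteq> w"
  then have x': "x \<in> V" "x \<notin> set [u, w]" by auto
  show e: "e x = 0 \<or> e x = 1" using D(6)[OF x'] by auto
  show "\<epsilon> u x = (if e x = 0 then - a x else a x)" "\<epsilon> w x = (if e x = 0 then a x else - a x)"
    "\<epsilon> x u = (if e x = 0 then a' x else - a' x)" "\<epsilon> x w = (if e x = 0 then - a' x else a' x)"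
    using e D(7)[OF x', of 0] D(7)[OF x', of 1] D(8)[OF x', of 0] D(8)[OF x', of 1]
    by (auto simp: next_index_def)
qed

text \<open>The outer mutations cancel by involutivity, which leaves cycles of two vertices. There
  the second vertex has the arrows of the first reversed, so mutating at both interchanges their
  roles and the transposition restores the labels.\<close>

theorem same_quiver_cycle_reflection:
  assumes "triangulated_cycle (svert S) (sexch S) vs e a a'"
    and "\<And>v w. v \<in> set vs \<Longrightarrow> w \<in> set vs \<Longrightarrow> swt S v = swt S w"
  shows "same_quiver (apply_seq (cycle_reflection vs) S) S"
  using assms
proof (induction vs arbitrary: S e a a')
  case Nil
  then show ?case by simp
next
  case (Cons v ws)
  note D = triangulated_cycleD[OF Cons.prems(1)]
  show ?case
  proof (cases "length ws \<ge> 2")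
    case True
    let ?S1 = "mutate v S"
    have IH: "same_quiver (apply_seq (cycle_reflection ws) ?S1) ?S1"
      using Cons.IH[of ?S1] triangulated_cycle_mutate[OF Cons.prems(1) True] Cons.prems(2)
      by (simp add: mutate_simps(1))
    have "same_quiver (mutate v (apply_seq (cycle_reflection ws) ?S1)) (mutate v ?S1)"
      using same_quiver_apply_step[OF IH, of "Mut v"] D(3) by simp
    also have "same_quiver \<dots> S" by (rule same_quiver_mutate_mutate)
    finally show ?thesis using True by (simp add: cycle_reflection_Cons)
  next
    case False
    then obtain w where ws: "ws = [w]" using D(4) by (cases ws; cases "tl ws") auto
    note E = two_cycle_exchange[OF Cons.prems(1)[unfolded ws]]
    let ?T = "permute_seed (transpose v w) (mutate w (mutate v S))"
    have "swt ?T i = swt S i" if "i \<in> svert S" for i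
      using Cons.prems(2)[of v w] ws by (auto simp: permute_transpose_simps mutate_simps(1) transpose_def)
    moreover have "sexch ?T i j = sexch S i j" if ij: "i \<in> svert S" "j \<in> svert S" for i j
    proof (cases "i \<in> {v, w} \<or> j \<in> {v, w}")
      case True
      then show ?thesis
        unfolding permute_transpose_simps mutate_simps(2) exchange_mutation_term
        using E(1,4-7) E(9-12)[OF ij(1)] E(9-12)[OF ij(2)] by (auto simp: transpose_def)
    next
      case False
      \<comment> \<open>The arrows created by the mutation at \<open>v\<close> therefore cancel
        those created by the mutation at \<open>w\<close>.\<close>
      then have "sexch S i w = - sexch S i v" "sexch S w j = - sexch S v j"
        using E(9-12)[OF ij(1)] E(9-12)[OF ij(2)] by auto
      then show ?thesis
        unfolding permute_transpose_simps mutate_simps(2) exchange_mutation_term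
        using False E(1,4-7) by (auto simp: transpose_def)
    qed
    ultimately show ?thesis by (simp add: ws same_quiver_def)
  qed
qed

section \<open>The A-variables under a cycle reflection\<close>

definition edge_monomial :: "'v set \<Rightarrow> 'v list \<Rightarrow> ('v \<Rightarrow> nat) \<Rightarrow> ('v \<Rightarrow> int) \<Rightarrow> ('v \<Rightarrow> 'k::field) \<Rightarrow> nat \<Rightarrow> 'k" where
  "edge_monomial V vs e a A j = (\<Prod>x\<in>V - set vs. if e x = j then A x powi a x else 1)"

text \<open>At a puncture of a surface this is the length of the horocycle in terms of lambda
  lengths: each triangle contributes the opposite side divided by the product of the two adjacent
  ones.\<close>

definition cycle_potential :: "'v set \<Rightarrow> 'v list \<Rightarrow> ('v \<Rightarrow> nat) \<Rightarrow> ('v \<Rightarrow> int) \<Rightarrow> ('v \<Rightarrow> 'k::field) \<Rightarrow> 'k" where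
  "cycle_potential V vs e a A = (\<Sum>j<length vs. edge_monomial V vs e a A j /
      (A (vs ! j) * A (vs ! next_index (length vs) j)))"

lemma prod_filter_eq:
  fixes f :: "'v \<Rightarrow> 'k::comm_monoid_mult"
  assumes "finite V" "D \<subseteq> V" "\<And>x. x \<in> D \<Longrightarrow> \<not> R x"
    and "\<And>x. x \<in> V - D \<Longrightarrow> (if R x then f x else 1) = g x"
  shows "(\<Prod>j | j \<in> V \<and> R j. f j) = (\<Prod>x\<in>V - D. g x)"
proof -
  have "(\<Prod>j | j \<in> V \<and> R j. f j) = (\<Prod>x\<in>V. if R x then f x else 1)"
    using assms(1) by (simp add: prod.If_cases Int_def)
  also have "\<dots> = (\<Prod>x\<in>V - D. if R x then f x else 1)"
    by (rule prod.mono_neutral_right) (use assms in auto)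
  also have "\<dots> = (\<Prod>x\<in>V - D. g x)"
    by (rule prod.cong) (use assms(4) in auto)
  finally show ?thesis .
qed

lemma edge_monomial_pos:
  assumes "\<And>x. x \<in> V \<Longrightarrow> A x \<in> subtraction_free"
  shows "edge_monomial V vs e a A j \<in> subtraction_free"
  unfolding edge_monomial_def
  by (rule subtraction_free.prod_pos) (use assms in \<open>auto intro: subtraction_free.power_int_pos\<close>)

text \<open>The two edges at \<open>v\<close> have the indices 0 and \<open>length ws\<close>. The
  apex over one of them lies on the same side of the exchange relation as the cycle neighbour along
  the other.\<close>

lemma exchange_monomial_first:
  fixes A :: "'v \<Rightarrow> 'k::field"
  assumes cyc: "triangulated_cycle V \<epsilon> (v # ws) e a a'" and n: "length ws \<ge> 2"
  shows "(\<Prod>j | j \<in> V \<and> \<epsilon> v j > 0. A j powi \<epsilon> v j)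
      = A (ws ! 0) * edge_monomial V (v # ws) e a A (length ws)"
    and "(\<Prod>j | j \<in> V \<and> \<epsilon> v j < 0. A j powi (- \<epsilon> v j))
      = A (ws ! (length ws - 1)) * edge_monomial V (v # ws) e a A 0"
proof -
  let ?n = "length ws"
  note D = triangulated_cycleD[OF cyc]
  have vc: "\<epsilon> v (ws ! j) = of_bool (j = 0) - of_bool (Suc j = ?n)" if "j < ?n" for j
    using D(5)[of 0 "Suc j"] that n by (auto simp: next_index_def)
  have vv: "\<epsilon> v v = 0" using D(5)[of 0 0] n by (auto simp: next_index_def)
  have ex: "e x \<le> ?n" "a x \<ge> 0"
    and vx: "\<epsilon> v x = a x * (of_bool (e x = ?n) - of_bool (e x = 0))"
    if "x \<in> V" "x \<notin> set (v # ws)" for x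
    using D(6)[OF that] D(7)[OF that, of 0] by (auto simp: next_index_def)
  have ws: "distinct ws" "set ws \<subseteq> V" "v \<in> V" "v \<notin> set ws" using D(2,3) by auto
  have idx: "\<exists>j<?n. x = ws ! j" if "x \<in> set ws" for x using that by (metis in_set_conv_nth)
  define f where "f = ws ! 0"
  define l where "l = ws ! (?n - 1)"
  have ne: "ws \<noteq> []" using n by auto
  have fl: "f \<in> set ws" "l \<in> set ws" "f \<noteq> l"
    using n ws(1) nth_mem[of 0 ws] nth_mem[of "?n - 1" ws] nth_eq_iff_index_eq[of ws 0 "?n - 1"]
    by (auto simp: f_def l_def ne)
  have ef: "\<epsilon> v f = 1" using vc[of 0] n ne by (simp add: f_def)
  have el: "\<epsilon> v l = -1" using vc[of "?n - 1"] n by (simp add: l_def)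
  have eo: "\<epsilon> v x = 0" if "x \<in> set ws" "x \<noteq> f" "x \<noteq> l" for x
  proof -
    obtain j where j: "j < ?n" "x = ws ! j" using idx[OF \<open>x \<in> set ws\<close>] by blast
    then have "j \<noteq> 0" "j \<noteq> ?n - 1" using that unfolding f_def l_def by metis+
    then show ?thesis using vc[OF j(1)] j by auto
  qed
  have "(\<Prod>j | j \<in> V \<and> \<epsilon> v j > 0. A j powi \<epsilon> v j)
      = (\<Prod>x\<in>V - (set (v # ws) - {f}). if x = f then A f else if e x = ?n then A x powi a x else 1)"
  proof (rule prod_filter_eq)
    show "\<not> 0 < \<epsilon> v x" if "x \<in> set (v # ws) - {f}" for x
      using that vv eo[of x] el by (cases "x = l") auto
    show "(if 0 < \<epsilon> v x then A x powi \<epsilon> v x else 1)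
        = (if x = f then A f else if e x = ?n then A x powi a x else 1)"
      if "x \<in> V - (set (v # ws) - {f})" for x
    proof (cases "x = f")
      case False
      then have x: "x \<in> V" "x \<notin> set (v # ws)" using that by auto
      show ?thesis using False ex[OF x] n by (auto simp: vx[OF x])
    qed (simp add: ef)
  qed (use D(1) ws in auto)
  also have "V - (set (v # ws) - {f}) = insert f (V - set (v # ws))" using fl ws by auto
  also have "(\<Prod>x\<in>insert f (V - set (v # ws)). if x = f then A f else if e x = ?n then A x powi a x else 1)
      = A f * edge_monomial V (v # ws) e a A ?n"
  proof -
    have "(\<Prod>x\<in>V - set (v # ws). if x = f then A f else if e x = ?n then A x powi a x else 1)
        = edge_monomial V (v # ws) e a A ?n"
      unfolding edge_monomial_def by (rule prod.cong) (use fl in auto)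
    moreover have "f \<notin> V - set (v # ws)" using fl by simp
    ultimately show ?thesis using D(1) by simp
  qed
  finally show "(\<Prod>j | j \<in> V \<and> \<epsilon> v j > 0. A j powi \<epsilon> v j)
      = A (ws ! 0) * edge_monomial V (v # ws) e a A (length ws)" by (simp add: f_def)
  have "(\<Prod>j | j \<in> V \<and> \<epsilon> v j < 0. A j powi - \<epsilon> v j)
      = (\<Prod>x\<in>V - (set (v # ws) - {l}). if x = l then A l else if e x = 0 then A x powi a x else 1)"
  proof (rule prod_filter_eq)
    show "\<not> \<epsilon> v x < 0" if "x \<in> set (v # ws) - {l}" for x
      using that vv eo[of x] ef by (cases "x = f") auto
    show "(if \<epsilon> v x < 0 then A x powi - \<epsilon> v x else 1)
        = (if x = l then A l else if e x = 0 then A x powi a x else 1)"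
      if "x \<in> V - (set (v # ws) - {l})" for x
    proof (cases "x = l")
      case False
      then have x: "x \<in> V" "x \<notin> set (v # ws)" using that by auto
      show ?thesis using False ex[OF x] n by (auto simp: vx[OF x])
    qed (simp add: el)
  qed (use D(1) ws in auto)
  also have "V - (set (v # ws) - {l}) = insert l (V - set (v # ws))" using fl ws by auto
  also have "(\<Prod>x\<in>insert l (V - set (v # ws)). if x = l then A l else if e x = 0 then A x powi a x else 1)
      = A l * edge_monomial V (v # ws) e a A 0"
  proof -
    have "(\<Prod>x\<in>V - set (v # ws). if x = l then A l else if e x = 0 then A x powi a x else 1)
        = edge_monomial V (v # ws) e a A 0"
      unfolding edge_monomial_def by (rule prod.cong) (use fl in auto)
    moreover have "l \<notin> V - set (v # ws)" using fl by simp
    ultimately show ?thesis using D(1) by simp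
  qed
  finally show "(\<Prod>j | j \<in> V \<and> \<epsilon> v j < 0. A j powi (- \<epsilon> v j))
      = A (ws ! (length ws - 1)) * edge_monomial V (v # ws) e a A 0" by (simp add: l_def)
qed

text \<open>By the exchange relation the term of the new edge, with apex \<open>v\<close>, equals
  the sum of the two terms at \<open>v\<close> in the longer cycle; all other terms agree.\<close>

lemma cycle_potential_merge:
  fixes A B :: "'v \<Rightarrow> 'k::field"
  assumes cyc: "triangulated_cycle V \<epsilon> (v # ws) e a a'" and n: "length ws \<ge> 2"
    and B: "\<And>x. x \<noteq> v \<Longrightarrow> B x = A x" and nz: "\<And>x. x \<in> V \<Longrightarrow> A x \<noteq> 0"
    and Bv: "B v = (A (ws ! 0) * edge_monomial V (v # ws) e a A (length ws)
      + A (ws ! (length ws - 1)) * edge_monomial V (v # ws) e a A 0) / A v"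
  shows "cycle_potential V ws (merge_edge (length ws) v e) (merge_mult (length ws) v e a) B
    = cycle_potential V (v # ws) e a A"
proof -
  let ?n = "length ws" and ?N = "edge_monomial V (v # ws) e a A"
  let ?N' = "edge_monomial V ws (merge_edge (length ws) v e) (merge_mult (length ws) v e a) B"
  note D = triangulated_cycleD[OF cyc]
  have ws: "v \<in> V" "v \<notin> set ws" "set ws \<subseteq> V" using D(2,3) by auto
  have V: "V - set ws = insert v (V - set (v # ws))" using ws by auto
  have N': "?N' j = (if j = ?n - 1 then B v else ?N (Suc j))" if "j < ?n" for j
  proof -
    have "?N' j = (if j = ?n - 1 then B v else 1) * (\<Prod>x\<in>V - set (v # ws).
        if merge_edge ?n v e x = j then B x powi merge_mult ?n v e a x else 1)"
      unfolding edge_monomial_def V using D(1)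
      by (subst prod.insert) (auto simp: merge_edge_def merge_mult_def)
    also have "(\<Prod>x\<in>V - set (v # ws). if merge_edge ?n v e x = j then B x powi merge_mult ?n v e a x else 1)
        = (if j = ?n - 1 then 1 else ?N (Suc j))"
    proof (cases "j = ?n - 1")
      case True
      have "merge_edge ?n v e x \<noteq> j" if "x \<in> V - set (v # ws)" for x
        using D(6)[of x] that n True by (auto simp: merge_edge_def)
      then show ?thesis using True by (simp add: prod.neutral)
    next
      case False
      have "(if merge_edge ?n v e x = j then B x powi merge_mult ?n v e a x else 1)
          = (if e x = Suc j then A x powi a x else 1)" if "x \<in> V - set (v # ws)" for x
        using that \<open>j < ?n\<close> False n B[of x] by (auto simp: merge_edge_def merge_mult_def)
      then show ?thesis
        using False unfolding edge_monomial_def by simp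
    qed
    finally show ?thesis by simp
  qed
  have Bw: "B (ws ! j) = A (ws ! j)" if "j < ?n" for j
    using B ws(2) that nth_mem by metis
  define t where "t j = ?N (Suc j) / (A (ws ! j) * A (ws ! Suc j))" for j
  have ne: "ws \<noteq> []" using n by auto
  have "ws ! 0 \<in> V" "ws ! (?n - 1) \<in> V"
    using ne ws(3) nth_mem[of 0 ws] nth_mem[of "?n - 1" ws] by auto
  then have f: "A (ws ! 0) \<noteq> 0" "A (ws ! (?n - 1)) \<noteq> 0" "A v \<noteq> 0"
    using nz ws(1) by blast+
  have n': "?n = Suc (?n - 1)" using n by simp
  have "cycle_potential V ws (merge_edge ?n v e) (merge_mult ?n v e a) B
      = (\<Sum>j<Suc (?n - 1). ?N' j / (B (ws ! j) * B (ws ! next_index ?n j)))"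
    unfolding cycle_potential_def using n' by simp
  also have "\<dots> = (\<Sum>j<?n - 1. ?N' j / (B (ws ! j) * B (ws ! next_index ?n j)))
      + B v / (A (ws ! (?n - 1)) * A (ws ! 0))"
    unfolding sum.lessThan_Suc
    using n ne N'[of "?n - 1"] Bw[of "?n - 1"] Bw[of 0] by (simp add: next_index_def)
  also have "(\<Sum>j<?n - 1. ?N' j / (B (ws ! j) * B (ws ! next_index ?n j))) = (\<Sum>j<?n - 1. t j)"
    by (rule sum.cong) (auto simp: t_def N' Bw next_index_def)
  also have "B v / (A (ws ! (?n - 1)) * A (ws ! 0))
      = ?N 0 / (A v * A (ws ! 0)) + ?N ?n / (A (ws ! (?n - 1)) * A v)"
    unfolding Bv using f by (simp add: field_simps)
  finally have 1: "cycle_potential V ws (merge_edge ?n v e) (merge_mult ?n v e a) B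
      = (\<Sum>j<?n - 1. t j) + (?N 0 / (A v * A (ws ! 0)) + ?N ?n / (A (ws ! (?n - 1)) * A v))" .
  have "cycle_potential V (v # ws) e a A
      = ?N 0 / (A v * A (ws ! 0)) + (\<Sum>j<?n. ?N (Suc j) / (A (ws ! j) * A ((v # ws) ! next_index (Suc ?n) (Suc j))))"
    unfolding cycle_potential_def using ne
    by (simp add: sum.lessThan_Suc_shift next_index_def del: sum.lessThan_Suc)
  also have "(\<Sum>j<?n. ?N (Suc j) / (A (ws ! j) * A ((v # ws) ! next_index (Suc ?n) (Suc j))))
      = (\<Sum>j<Suc (?n - 1). ?N (Suc j) / (A (ws ! j) * A ((v # ws) ! next_index (Suc ?n) (Suc j))))"
    using n' by simp
  also have "\<dots> = (\<Sum>j<?n - 1. ?N (Suc j) / (A (ws ! j) * A ((v # ws) ! next_index (Suc ?n) (Suc j))))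
      + ?N ?n / (A (ws ! (?n - 1)) * A v)"
    unfolding sum.lessThan_Suc using n ne by (simp add: next_index_def)
  also have "(\<Sum>j<?n - 1. ?N (Suc j) / (A (ws ! j) * A ((v # ws) ! next_index (Suc ?n) (Suc j)))) = (\<Sum>j<?n - 1. t j)"
    by (rule sum.cong) (auto simp: t_def next_index_def)
  finally show ?thesis using 1 by simp
qed

text \<open>By induction the variables of the shorter cycle are multiplied by the potential, which
  the mutation at \<open>v\<close> does not change. Each exchange monomial at \<open>v\<close>
  contains exactly one of them, so undoing that mutation multiplies the variable at \<open>v\<close>
  by the same factor.\<close>

theorem cycle_reflection_A:
  assumes "triangulated_cycle (svert S) (sexch S) vs e a a'" "positive_seed S"
    and "\<And>v w. v \<in> set vs \<Longrightarrow> w \<in> set vs \<Longrightarrow> swt S v = swt S w"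
    and "x \<in> svert S"
  shows "sA (apply_seq (cycle_reflection vs) S) x
    = (if x \<in> set vs then sA S x * cycle_potential (svert S) vs e a (sA S) else sA S x)"
  using assms
proof (induction vs arbitrary: S e a a' x)
  case Nil
  then show ?case by simp
next
  case (Cons v ws)
  let ?V = "svert S" and ?n = "length ws" and ?A = "sA S"
  let ?N = "edge_monomial ?V (v # ws) e a ?A"
  note cyc = Cons.prems(1)
  note D = triangulated_cycleD[OF cyc]
  have A: "?A x \<in> subtraction_free" if "x \<in> ?V" for x
    using Cons.prems(2) that by (auto simp: positive_seed_def)
  then have nz: "?A x \<noteq> 0" if "x \<in> ?V" for x using that subtraction_free.pos_nonzero by blast
  have N: "?N j \<in> subtraction_free" for j using A by (rule edge_monomial_pos)
  show ?case
  proof (cases "?n \<ge> 2")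
    case True
    let ?S1 = "mutate v S"
    let ?S2 = "apply_seq (cycle_reflection ws) ?S1"
    let ?f = "cycle_potential ?V (v # ws) e a ?A"
    have v: "v \<in> ?V" "v \<notin> set ws" using D(2,3) by auto
    note mon = exchange_monomial_first[OF cyc True, of ?A]
    have ne: "ws \<noteq> []" using True by auto
    have wsV: "ws ! 0 \<in> set ws" "ws ! (?n - 1) \<in> set ws" "set ws \<subseteq> ?V"
      using True D(3) nth_mem[of 0 ws] nth_mem[of "?n - 1" ws] by (auto simp: ne)
    have A1v: "sA ?S1 v = (?A (ws ! 0) * ?N ?n + ?A (ws ! (?n - 1)) * ?N 0) / ?A v"
      unfolding mutate_simps mon by (simp add: divide_inverse mult.commute)
    have A1: "sA ?S1 x = ?A x" if "x \<noteq> v" for x using that by (simp add: mutate_simps)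
    have cyc1': "triangulated_cycle (svert ?S1) (sexch ?S1) ws
        (merge_edge ?n v e) (merge_mult ?n v e a) (merge_mult ?n v e a')"
      using triangulated_cycle_mutate[OF cyc True] by simp
    have f1: "cycle_potential ?V ws (merge_edge ?n v e) (merge_mult ?n v e a) (sA ?S1) = ?f"
      by (rule cycle_potential_merge[OF cyc True A1 nz A1v])
    have pos1: "positive_seed ?S1"
      using positive_seed_apply_step[of S "Mut v"] Cons.prems(2) v by simp
    have w1: "swt ?S1 x = swt ?S1 y" if "x \<in> set ws" "y \<in> set ws" for x y
      using Cons.prems(3)[of x y] that by (simp add: mutate_simps(1))
    have A2: "sA ?S2 x = (if x \<in> set ws then sA ?S1 x * ?f else sA ?S1 x)" if "x \<in> ?V" for x
    proof -
      have "x \<in> svert ?S1" using that by simp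
      from Cons.IH[OF cyc1' pos1 w1 this] show ?thesis using f1 by simp
    qed
    have "same_quiver ?S2 ?S1"
      by (rule same_quiver_cycle_reflection[OF cyc1' w1])
    then have e2: "sexch ?S2 v x = - sexch S v x" if "x \<in> ?V" for x
      using v that by (simp add: same_quiver_def mutate_simps(2))
    have ext: "edge_monomial ?V (v # ws) e a (sA ?S2) j = ?N j" for j
      unfolding edge_monomial_def by (rule prod.cong) (auto simp: A2 A1)
    have p: "(\<Prod>j | j \<in> ?V \<and> sexch ?S2 v j > 0. sA ?S2 j powi sexch ?S2 v j)
        = sA ?S2 (ws ! (?n - 1)) * edge_monomial ?V (v # ws) e a (sA ?S2) 0"
      unfolding exchange_monomial_first(2)[OF cyc True, of "sA ?S2", symmetric]
      by (rule prod.cong) (auto simp: e2)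
    have q: "(\<Prod>j | j \<in> ?V \<and> sexch ?S2 v j < 0. sA ?S2 j powi - sexch ?S2 v j)
        = sA ?S2 (ws ! 0) * edge_monomial ?V (v # ws) e a (sA ?S2) ?n"
      unfolding exchange_monomial_first(1)[OF cyc True, of "sA ?S2", symmetric]
      by (rule prod.cong) (auto simp: e2)
    have A2w: "sA ?S2 x = ?A x * ?f" if "x \<in> set ws" for x
    proof -
      have "x \<in> ?V" "x \<noteq> v" using that wsV v by auto
      then show ?thesis using A2 A1 that by simp
    qed
    have A2v: "sA ?S2 v = sA ?S1 v" using A2[OF v(1)] v by simp
    have sv: "svert ?S2 = ?V" by simp
    have s: "?A (ws ! 0) * ?N ?n + ?A (ws ! (?n - 1)) * ?N 0 \<noteq> 0"
      using A N wsV by (intro subtraction_free.pos_nonzero subtraction_free.add_pos subtraction_free.mult_pos) auto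
    have "sA (mutate v ?S2) v = inverse (sA ?S1 v) * (?f * (?A (ws ! 0) * ?N ?n + ?A (ws ! (?n - 1)) * ?N 0))"
      unfolding mutate_simps(4) sv p q ext A2v A2w[OF wsV(1)] A2w[OF wsV(2)]
      by (simp only: refl if_True algebra_simps)
    also have "\<dots> = ?A v * ?f"
      unfolding A1v using s nz[OF v(1)] by simp
    finally have fin: "sA (mutate v ?S2) v = ?A v * ?f" .
    show ?thesis
    proof (cases "x = v")
      case True
      then show ?thesis using fin \<open>?n \<ge> 2\<close> by (simp add: cycle_reflection_Cons)
    next
      case False
      then have "sA (mutate v ?S2) x = sA ?S2 x" by (simp add: mutate_simps)
      then show ?thesis using False A2[OF Cons.prems(4)] A1[of x] \<open>?n \<ge> 2\<close>
        by (simp add: cycle_reflection_Cons)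
    qed
  next
    case False
    then obtain w where ws: "ws = [w]" using D(4) by (cases ws; cases "tl ws") auto
    note E = two_cycle_exchange[OF cyc[unfolded ws]]
    let ?S1 = "mutate v S" and ?S2 = "mutate w (mutate v S)"
    have ext: "x \<in> ?V \<and> x \<noteq> v \<and> x \<noteq> w" if "x \<in> ?V - set (v # ws)" for x using that ws by auto
    have a0: "a x \<ge> 0" if "x \<in> ?V - set (v # ws)" for x using D(6) that by auto
    have e1: "sexch ?S1 w x = sexch S w x" if "x \<in> ?V" for x
      using E(1,7) by (auto simp: mutate_simps(2))
    have A1: "sA ?S1 x = ?A x" if "x \<noteq> v" for x using that by (simp add: mutate_simps)
    have eq: "(if sexch S v x > 0 then ?A x powi sexch S v x else 1) = (if e x = 1 then ?A x powi a x else 1)"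
      "(if sexch S v x < 0 then ?A x powi - sexch S v x else 1) = (if e x = 0 then ?A x powi a x else 1)"
      "(if sexch ?S1 w x > 0 then sA ?S1 x powi sexch ?S1 w x else 1) = (if e x = 0 then ?A x powi a x else 1)"
      "(if sexch ?S1 w x < 0 then sA ?S1 x powi - sexch ?S1 w x else 1) = (if e x = 1 then ?A x powi a x else 1)"
      if x: "x \<in> ?V - set (v # ws)" for x
    proof -
      have x': "x \<in> ?V" "x \<noteq> v" "x \<noteq> w" using ext[OF x] by auto
      show "(if sexch S v x > 0 then ?A x powi sexch S v x else 1) = (if e x = 1 then ?A x powi a x else 1)"
        "(if sexch S v x < 0 then ?A x powi - sexch S v x else 1) = (if e x = 0 then ?A x powi a x else 1)"
        "(if sexch ?S1 w x > 0 then sA ?S1 x powi sexch ?S1 w x else 1) = (if e x = 0 then ?A x powi a x else 1)"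
        "(if sexch ?S1 w x < 0 then sA ?S1 x powi - sexch ?S1 w x else 1) = (if e x = 1 then ?A x powi a x else 1)"
        unfolding e1[OF x'(1)] A1[OF x'(2)] E(9)[OF x'] E(10)[OF x']
        using E(8)[OF x'] a0[OF x] by auto
    qed
    have zero: "sexch S v x = 0" "sexch ?S1 w x = 0" if "x \<in> set (v # ws)" for x
      using that E(2-7) e1 by (auto simp: ws)
    note filter = prod_filter_eq[OF D(1,3)]
    have pv: "(\<Prod>j | j \<in> ?V \<and> sexch S v j > 0. ?A j powi sexch S v j) = ?N 1"
      unfolding edge_monomial_def by (rule filter[OF _ eq(1)]) (simp_all add: zero)
    have qv: "(\<Prod>j | j \<in> ?V \<and> sexch S v j < 0. ?A j powi - sexch S v j) = ?N 0"
      unfolding edge_monomial_def by (rule filter[OF _ eq(2)]) (simp_all add: zero)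
    have pw: "(\<Prod>j | j \<in> ?V \<and> sexch ?S1 w j > 0. sA ?S1 j powi sexch ?S1 w j) = ?N 0"
      unfolding edge_monomial_def by (rule filter[OF _ eq(3)]) (simp_all add: zero)
    have qw: "(\<Prod>j | j \<in> ?V \<and> sexch ?S1 w j < 0. sA ?S1 j powi - sexch ?S1 w j) = ?N 1"
      unfolding edge_monomial_def by (rule filter[OF _ eq(4)]) (simp_all add: zero)
    have f: "cycle_potential ?V (v # ws) e a ?A = (?N 0 + ?N 1) / (?A v * ?A w)"
      by (simp add: cycle_potential_def ws next_index_def add_divide_distrib mult.commute)
    have A2v: "sA ?S2 v = ?A w * cycle_potential ?V (v # ws) e a ?A"
      using E(1) nz[OF E(2)] nz[OF E(3)] unfolding f mutate_simps(4)[of w] mutate_simps(4)[of v] pv qv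
      by (simp add: field_simps)
    have A2w: "sA ?S2 w = ?A v * cycle_potential ?V (v # ws) e a ?A"
      using E(1) nz[OF E(2)] nz[OF E(3)] A1[of w] unfolding f mutate_simps(4)[of w ?S1] svert_mutate pw qw
      by (simp add: field_simps)
    show ?thesis
      using A2v A2w A1 ws by (auto simp: permute_transpose_simps transpose_def) (simp_all add: mutate_simps)
  qed
qed

text \<open>Window sums of the sequence \<open>T\<close> extended by \<open>T (j - m) = q * T j\<close>, at the positions
  \<open>j\<close>, \<open>j - 1\<close> and \<open>j - 2\<close>.\<close>

definition cycle_sum :: "nat \<Rightarrow> 'k \<Rightarrow> (nat \<Rightarrow> 'k) \<Rightarrow> nat \<Rightarrow> 'k::field" where
  "cycle_sum m q T j = (\<Sum>k<m. if k \<le> j then T k else q * T k)"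

definition cycle_sum1 :: "nat \<Rightarrow> 'k \<Rightarrow> (nat \<Rightarrow> 'k) \<Rightarrow> nat \<Rightarrow> 'k::field" where
  "cycle_sum1 m q T j = (if j = 0 then q * cycle_sum m q T (m - 1) else cycle_sum m q T (j - 1))"

definition cycle_sum2 :: "nat \<Rightarrow> 'k \<Rightarrow> (nat \<Rightarrow> 'k) \<Rightarrow> nat \<Rightarrow> 'k::field" where
  "cycle_sum2 m q T j = (if j = 0 then q * cycle_sum m q T (m - 2)
     else if j = 1 then q * cycle_sum m q T (m - 1) else cycle_sum m q T (j - 2))"

text \<open>The two edges at \<open>v\<close> merge, so two neighbouring terms are added. In the
  extension with period n + 1 the term after \<open>T n\<close> is \<open>T 0 / q\<close>.\<close>

definition merge_T :: "nat \<Rightarrow> 'k \<Rightarrow> (nat \<Rightarrow> 'k) \<Rightarrow> nat \<Rightarrow> 'k::field" where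
  "merge_T n q T j = (if j = n - 1 then T n + T 0 / q else T (Suc j))"

text \<open>A window of the longer cycle that does not separate the merged terms is a window of the
  shorter one. The value at \<open>j = n - 1\<close> is the window ending at n + 1, one period after
  position 0, whence the division by \<open>q\<close>.\<close>

lemma cycle_sum_merge:
  assumes n: "n \<ge> 2" and q: "q \<noteq> 0" and j: "j < n"
  shows "cycle_sum n q (merge_T n q T) j
    = (if j = n - 1 then cycle_sum (Suc n) q T 0 / q else cycle_sum (Suc n) q T (Suc j))"
proof -
  obtain p where p: "n = Suc p" using n by (cases n) auto
  have M: "merge_T (Suc p) q T k = T (Suc k)" if "k < p" for k
    using that by (simp add: merge_T_def)
  have Mp: "merge_T (Suc p) q T p = T (Suc p) + T 0 / q" by (simp add: merge_T_def)
  have L: "cycle_sum n q (merge_T n q T) j = (\<Sum>k<p. if k \<le> j then T (Suc k) else q * T (Suc k))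
      + (if p \<le> j then T (Suc p) + T 0 / q else q * (T (Suc p) + T 0 / q))"
    unfolding cycle_sum_def p sum.lessThan_Suc Mp
    by (intro arg_cong2[of _ _ _ _ "(+)"] sum.cong refl) (auto simp: M)
  have R: "cycle_sum (Suc n) q T i = T 0 + (\<Sum>k<p. if Suc k \<le> i then T (Suc k) else q * T (Suc k))
      + (if Suc p \<le> i then T (Suc p) else q * T (Suc p))" for i
    unfolding cycle_sum_def p sum.lessThan_Suc_shift[of _ "Suc p"] sum.lessThan_Suc[of _ p] by simp
  show ?thesis
  proof (cases "j = p")
    case True
    have "(\<Sum>k<p. if k \<le> j then T (Suc k) else q * T (Suc k)) = (\<Sum>k<p. T (Suc k))"
      using True by (intro sum.cong) auto
    moreover have "(\<Sum>k<p. q * T (Suc k)) = q * (\<Sum>k<p. T (Suc k))" by (simp add: sum_distrib_left)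
    ultimately show ?thesis unfolding L R using True q p by (simp add: field_simps)
  next
    case False
    then show ?thesis unfolding L R using j q p by (simp add: field_simps)
  qed
qed

lemma cycle_sum_last:
  assumes "n \<ge> 1"
  shows "cycle_sum (Suc n) q T (n - 1) = cycle_sum (Suc n) q T n - (1 - q) * T n"
    and "cycle_sum (Suc n) q T 0 = q * cycle_sum (Suc n) q T n + (1 - q) * T 0"
proof -
  have "(\<Sum>k<n. if k \<le> n - 1 then T k else q * T k) = (\<Sum>k<n. if k \<le> n then T k else q * T k)"
    by (rule sum.cong) auto
  then show "cycle_sum (Suc n) q T (n - 1) = cycle_sum (Suc n) q T n - (1 - q) * T n"
    using assms unfolding cycle_sum_def sum.lessThan_Suc by (auto simp: algebra_simps)
  have "(\<Sum>k<n. if Suc k \<le> n then T (Suc k) else q * T (Suc k)) = (\<Sum>k<n. T (Suc k))"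
    by (rule sum.cong) auto
  then show "cycle_sum (Suc n) q T 0 = q * cycle_sum (Suc n) q T n + (1 - q) * T 0"
    unfolding cycle_sum_def sum.lessThan_Suc_shift by (simp add: algebra_simps sum_distrib_left)
qed

lemma cycle_sum_pos:
  assumes "\<And>j. T j \<in> subtraction_free" "q \<in> subtraction_free" "m > 0"
  shows "cycle_sum m q T j \<in> subtraction_free"
  unfolding cycle_sum_def
  by (rule subtraction_free.sum_pos)
    (use assms in \<open>auto intro: subtraction_free.mult_pos simp: lessThan_empty_iff\<close>)

section \<open>The X-variables under a cycle reflection\<close>

definition cycle_X :: "'v seed \<Rightarrow> 'v list \<Rightarrow> 'v ratfun \<Rightarrow> (nat \<Rightarrow> 'v ratfun) \<Rightarrow> bool" where
  "cycle_X S vs q T \<longleftrightarrow> (\<forall>j<length vs. sX S (vs ! j) =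
     (if j = 0 then q * T (length vs - 1) / T 0 else T (j - 1) / T j))"

lemma mutate_X_factor:
  assumes "x \<noteq> v"
  shows "sexch S x v = b \<Longrightarrow> b > 0 \<Longrightarrow> sX (mutate v S) x = sX S x * (1 + inverse (sX S v)) powi (- b)"
    and "sexch S x v = - b \<Longrightarrow> b > 0 \<Longrightarrow> sX (mutate v S) x = sX S x * (1 + sX S v) powi b"
    and "sexch S x v = 0 \<Longrightarrow> sX (mutate v S) x = sX S x"
  using assms by (simp_all add: mutate_simps power_int_minus)

lemma cycle_reflection_X_two:
  assumes cyc: "triangulated_cycle (svert S) (sexch S) [v, w] e a a'"
    and T: "\<And>j. T j \<in> subtraction_free" and q: "q \<in> subtraction_free"
    and X: "cycle_X S [v, w] q T" and x: "x \<in> svert S"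
  shows "sX (permute_seed (transpose v w) (mutate w (mutate v S))) x =
    (if x = v then sX S v * cycle_sum 2 q T 0 / cycle_sum2 2 q T 0
     else if x = w then sX S w * cycle_sum 2 q T 1 / cycle_sum2 2 q T 1
     else sX S x * (cycle_sum1 2 q T (e x) / cycle_sum 2 q T (e x)) powi a' x)"
proof -
  note E = two_cycle_exchange[OF cyc]
  let ?S1 = "mutate v S" and ?S2 = "mutate w (mutate v S)"
  have nz: "T j \<noteq> 0" "q \<noteq> 0" for j using T q subtraction_free.pos_nonzero by blast+
  have Xv: "sX S v = q * T 1 / T 0" and Xw: "sX S w = T 0 / T 1"
    using X by (auto simp: cycle_X_def less_Suc_eq)
  have g: "cycle_sum 2 q T 0 = T 0 + q * T 1" "cycle_sum 2 q T 1 = T 0 + T 1"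
    by (simp_all add: cycle_sum_def eval_nat_numeral)
  have gnz: "T 0 + q * T 1 \<noteq> 0" "T 0 + T 1 \<noteq> 0"
    using T q by (intro subtraction_free.pos_nonzero subtraction_free.add_pos subtraction_free.mult_pos; simp)+
  have X1w: "sX ?S1 w = sX S w" using E(1,7) by (intro mutate_X_factor(3)) auto
  have X1v: "sX ?S1 v = inverse (sX S v)" by (simp add: mutate_simps)
  have X2w: "sX ?S2 w = inverse (sX S w)" using X1w by (simp add: mutate_simps(3)[of w])
  have e1: "sexch ?S1 x w = sexch S x w" if "x \<noteq> v" for x
    using that E(1,6) by (simp add: mutate_simps(2))
  have X2v: "sX ?S2 v = inverse (sX S v)"
    using X1v E(1,6) by (subst mutate_X_factor(3)) (auto simp: mutate_simps(2))
  consider "x = v" | "x = w" | "x \<noteq> v" "x \<noteq> w" by blast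
  then show ?thesis
  proof cases
    case 1
    then show ?thesis using nz gnz E(1)
      by (simp add: permute_transpose_simps X2w Xv Xw g cycle_sum2_def)
  next
    case 2
    then show ?thesis using nz gnz E(1)
      by (simp add: permute_transpose_simps X2v Xv Xw g[simplified] cycle_sum2_def)
  next
    case 3
    then have e: "e x = 0 \<or> e x = 1"
      and xv: "sexch S x v = (if e x = 0 then a' x else - a' x)"
      and xw: "sexch ?S1 x w = (if e x = 0 then - a' x else a' x)"
      using E(8,11,12) x e1 by auto
    have a'0: "a' x \<ge> 0" using triangulated_cycleD(6)[OF cyc x] 3 by auto
    have T2: "sX (permute_seed (transpose v w) ?S2) x = sX ?S2 x"
      using 3 by (simp add: permute_transpose_simps transpose_def)
    show ?thesis
    proof (cases "a' x = 0")
      case True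
      then have "sX ?S1 x = sX S x" "sX ?S2 x = sX ?S1 x"
        using 3 xv xw by (intro mutate_X_factor(3); simp)+
      then show ?thesis using 3 True T2 by simp
    next
      case False
      then have pos: "a' x > 0" using a'0 by simp
      show ?thesis
      proof (cases "e x = 0")
        case True
        have "sX ?S1 x = sX S x * (1 + inverse (sX S v)) powi (- a' x)"
          using 3 xv True pos by (intro mutate_X_factor(1)) auto
        moreover have "sX ?S2 x = sX ?S1 x * (1 + sX ?S1 w) powi a' x"
          using 3 xw True pos by (intro mutate_X_factor(2)) auto
        ultimately have "sX ?S2 x = sX S x * ((1 + sX S w) / (1 + inverse (sX S v))) powi a' x"
          by (simp add: X1w power_int_minus power_int_divide_distrib divide_inverse power_int_mult_distrib
              power_int_inverse mult_ac)
        also have "1 + sX S w = (T 0 + T 1) / T 1"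
          using nz by (simp add: Xw add_divide_distrib)
        also have "1 + inverse (sX S v) = (T 0 + q * T 1) / (q * T 1)"
          using nz by (simp add: Xv add_divide_distrib)
        also have "(T 0 + T 1) / T 1 / ((T 0 + q * T 1) / (q * T 1)) = cycle_sum1 2 q T 0 / cycle_sum 2 q T 0"
          using nz by (simp add: g[simplified] cycle_sum1_def)
        finally show ?thesis using 3 True T2 by simp
      next
        case False
        then have e1: "e x = 1" using e by simp
        have "sX ?S1 x = sX S x * (1 + sX S v) powi a' x"
          using 3 xv False pos by (intro mutate_X_factor(2)) auto
        moreover have "sX ?S2 x = sX ?S1 x * (1 + inverse (sX ?S1 w)) powi (- a' x)"
          using 3 xw False pos by (intro mutate_X_factor(1)) auto
        ultimately have "sX ?S2 x = sX S x * ((1 + sX S v) / (1 + inverse (sX S w))) powi a' x"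
          by (simp add: X1w power_int_minus power_int_divide_distrib divide_inverse power_int_mult_distrib
              power_int_inverse mult_ac)
        also have "1 + sX S v = (T 0 + q * T 1) / T 0"
          using nz by (simp add: Xv add_divide_distrib)
        also have "1 + inverse (sX S w) = (T 0 + T 1) / T 0"
          using nz by (simp add: Xw add_divide_distrib)
        also have "(T 0 + q * T 1) / T 0 / ((T 0 + T 1) / T 0) = cycle_sum1 2 q T 1 / cycle_sum 2 q T 1"
          using nz by (simp add: g[simplified] cycle_sum1_def)
        finally show ?thesis using 3 e1 T2 by simp
      qed
    qed
  qed
qed

text \<open>After the first mutation the shorter cycle is described by \<open>merge_T\<close>, whose
  windows are windows of \<open>T\<close>. The removed vertex \<open>v\<close> is then an apex over
  the last edge, so the induction hypothesis yields its variable too, and the second mutation at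
  \<open>v\<close> removes the factors introduced by the first.\<close>

theorem cycle_reflection_X:
  assumes "triangulated_cycle (svert S) (sexch S) vs e a a'"
    and "positive_seed S"
    and "\<And>v w. v \<in> set vs \<Longrightarrow> w \<in> set vs \<Longrightarrow> swt S v = swt S w"
    and "\<And>j. T j \<in> subtraction_free" "q \<in> subtraction_free" "cycle_X S vs q T"
  shows "(\<forall>j<length vs. sX (apply_seq (cycle_reflection vs) S) (vs ! j)
        = sX S (vs ! j) * cycle_sum (length vs) q T j / cycle_sum2 (length vs) q T j) \<and>
     (\<forall>x\<in>svert S - set vs. sX (apply_seq (cycle_reflection vs) S) x
        = sX S x * (cycle_sum1 (length vs) q T (e x) / cycle_sum (length vs) q T (e x)) powi a' x)"
  using assms
proof (induction vs arbitrary: S e a a' T)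
  case Nil
  then show ?case using triangulated_cycleD(4)[OF Nil.prems(1)] by simp
next
  case (Cons v ws)
  note cyc = Cons.prems(1) and T = Cons.prems(4) and q = Cons.prems(5) and X = Cons.prems(6)
  let ?V = "svert S" and ?n = "length ws"
  note D = triangulated_cycleD[OF cyc]
  show ?case
  proof (cases "?n \<ge> 2")
    case False
    then obtain w where ws: "ws = [w]" using D(4) by (cases ws; cases "tl ws") auto
    have vw: "v \<noteq> w" "v \<in> ?V" "w \<in> ?V" using D(2,3) ws by auto
    show ?thesis
      using cycle_reflection_X_two[OF cyc[unfolded ws] T q X[unfolded ws]] vw
      by (auto simp: ws less_Suc_eq numeral_2_eq_2)
  next
    case n: True
    let ?S1 = "mutate v S"
    let ?S2 = "apply_seq (cycle_reflection ws) ?S1"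
    let ?S3 = "mutate v ?S2"
    define M where "M = merge_T ?n q T"
    define g where "g = cycle_sum (Suc ?n) q T"
    define h where "h = cycle_sum ?n q M"
    have ne: "ws \<noteq> []" using n by auto
    have v: "v \<in> ?V" "v \<notin> set ws" using D(2,3) by auto
    have inV: "ws ! j \<in> ?V" "ws ! j \<noteq> v" "ws ! j \<in> set ws" if "j < ?n" for j
      using D(3) v nth_mem[OF that] by auto
    have nz: "T j \<noteq> 0" "q \<noteq> 0" for j using T q subtraction_free.pos_nonzero by blast+
    have g_pos: "g j \<in> subtraction_free" for j unfolding g_def using T q by (rule cycle_sum_pos) simp
    then have g_nz: "g j \<noteq> 0" for j by (rule subtraction_free.pos_nonzero)
    have M_pos: "M j \<in> subtraction_free" for j
      unfolding M_def merge_T_def using T q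
      by (auto intro: subtraction_free.add_pos subtraction_free.divide_pos)
    have h: "h j = (if j = ?n - 1 then g 0 / q else g (Suc j))" if "j < ?n" for j
      unfolding h_def M_def g_def using n nz(2) that by (rule cycle_sum_merge)
    have gl: "g (?n - 1) = g ?n - (1 - q) * T ?n" "g 0 = q * g ?n + (1 - q) * T 0"
      unfolding g_def using n by (intro cycle_sum_last; simp)+
    define x0 where "x0 = sX S v"
    have x0: "x0 = q * T ?n / T 0" using X unfolding x0_def cycle_X_def by (auto dest: spec[of _ 0])
    have x0_pos: "x0 \<in> subtraction_free" unfolding x0
      using T q by (intro subtraction_free.divide_pos subtraction_free.mult_pos) auto
    have x0_nz: "x0 \<noteq> 0" "1 + x0 \<noteq> 0"
      using x0_pos by (auto intro!: subtraction_free.pos_nonzero subtraction_free.add_pos)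
    have Xw: "sX S (ws ! j) = T j / T (Suc j)" if "j < ?n" for j
      using X that unfolding cycle_X_def by (auto dest!: spec[of _ "Suc j"])
    define s where "s = x0 * g 0 + q * g (?n - 1)"
    have s_nz: "s \<noteq> 0" unfolding s_def using x0_pos g_pos q
      by (intro subtraction_free.pos_nonzero subtraction_free.add_pos subtraction_free.mult_pos)
    define z where "z = 1 + x0"
    have z_nz: "z \<noteq> 0" using x0_nz(2) by (simp add: z_def)
    have xz: "1 + inverse x0 = z / x0" using x0_nz(1) by (simp add: z_def field_simps)
    \<comment> \<open>\<open>s\<close> is the common numerator of \<open>1 + y\<close> and
      \<open>1 + inverse y\<close>, where \<open>y\<close> is the variable at \<open>v\<close>
      before the second mutation. Its factor \<open>z\<close>, which is \<open>1 + x0\<close>,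
      cancels the one left by the first mutation.\<close>
    have key: "s = q * g ?n * z"
      unfolding s_def gl x0 z_def using nz by (simp add: field_simps)
    have cv: "sexch S (ws ! j) v = of_bool (Suc j = ?n) - of_bool (j = 0)" if "j < ?n" for j
      using D(5)[of "Suc j" 0] that n by (auto simp: next_index_def)
    have xv: "sexch S x v = a' x * (of_bool (e x = 0) - of_bool (e x = ?n))"
      and ex: "e x \<le> ?n" "a' x \<ge> 0" if "x \<in> ?V" "x \<notin> set (v # ws)" for x
      using D(6)[OF that] D(8)[OF that, of 0] by (auto simp: next_index_def)
    have X1v: "sX ?S1 v = inverse x0" by (simp add: mutate_simps x0_def)
    have X1w: "sX ?S1 (ws ! j) = (if j = 0 then T 0 / T 1 * (1 + x0)
        else if j = ?n - 1 then T j / T ?n * (x0 / (1 + x0)) else T j / T (Suc j))" if "j < ?n" for j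
    proof -
      consider "j = 0" | "j \<noteq> 0" "Suc j = ?n" | "j \<noteq> 0" "Suc j \<noteq> ?n" by blast
      then show ?thesis
      proof cases
        case 1
        then show ?thesis
          using mutate_X_factor(2)[of "ws ! j" v S 1] inV[OF that] cv[OF that] Xw[OF that] n
          by (simp add: x0_def)
      next
        case 2
        then have "sX ?S1 (ws ! j) = sX S (ws ! j) * (1 + inverse x0) powi (- 1)"
          using mutate_X_factor(1)[of "ws ! j" v S 1] inV[OF that] cv[OF that]
          by (simp add: x0_def)
        also have "(1 + inverse x0) powi (- 1) = x0 / (1 + x0)"
          using x0_nz by (simp add: power_int_minus field_simps)
        finally show ?thesis using 2 Xw[OF that] by auto
      next
        case 3
        then have "j \<noteq> ?n - 1" using that by auto
        then show ?thesis
          using 3 mutate_X_factor(3)[of "ws ! j" v S] inV[OF that] cv[OF that] Xw[OF that] by simp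
      qed
    qed
    have cyc1: "triangulated_cycle (svert ?S1) (sexch ?S1) ws
        (merge_edge ?n v e) (merge_mult ?n v e a) (merge_mult ?n v e a')"
      using triangulated_cycle_mutate[OF cyc n] by simp
    have pos1: "positive_seed ?S1"
      using positive_seed_apply_step[of S "Mut v"] Cons.prems(2) v by simp
    have w1: "swt ?S1 x = swt ?S1 y" if "x \<in> set ws" "y \<in> set ws" for x y
      using Cons.prems(3)[of x y] that by (simp add: mutate_simps(1))
    \<comment> \<open>On the cycle the mutation at \<open>v\<close> affects only its two neighbours,
      and their factors \<open>1 + x0\<close> and \<open>x0 / (1 + x0)\<close> are what the merging
      of two terms of \<open>T\<close> produces.\<close>
    have cX1: "cycle_X ?S1 ws q M"
      unfolding cycle_X_def
    proof (intro allI impI)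
      fix j assume j: "j < ?n"
      have M: "M i = (if i = ?n - 1 then T ?n + T 0 / q else T (Suc i))" for i
        by (simp add: M_def merge_T_def)
      consider "j = 0" | "j \<noteq> 0" "j = ?n - 1" | "j \<noteq> 0" "j \<noteq> ?n - 1" by blast
      then show "sX ?S1 (ws ! j) = (if j = 0 then q * M (?n - 1) / M 0 else M (j - 1) / M j)"
      proof cases
        case 1
        then show ?thesis using n nz ne unfolding X1w[OF j] M x0 by (simp add: field_simps)
      next
        case 2
        have "j - 1 \<noteq> ?n - 1" "Suc (j - 1) = j" using 2 n by auto
        then have "sX ?S1 (ws ! j) = T j / T ?n * (x0 / (1 + x0))" "M (j - 1) = T j" "M j = T ?n + T 0 / q"
          using 2 unfolding X1w[OF j] M by auto
        moreover have "T 0 + q * T ?n \<noteq> 0"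
          using x0_nz(2) nz(1)[of 0] unfolding x0 by (simp add: field_simps)
        moreover have "T j / T ?n * (x0 / (1 + x0)) = T j / (T ?n + T 0 / q)"
          using nz \<open>T 0 + q * T ?n \<noteq> 0\<close> unfolding x0 by (simp add: divide_simps) (simp add: algebra_simps)
        ultimately show ?thesis using 2 by simp
      next
        case 3
        have "j - 1 \<noteq> ?n - 1" "Suc (j - 1) = j" using 3 j by auto
        then show ?thesis using 3 unfolding X1w[OF j] M by auto
      qed
    qed
    note IH = Cons.IH[OF cyc1 pos1 w1 M_pos q cX1, folded h_def]
    have IHw: "sX ?S2 (ws ! j) = sX ?S1 (ws ! j) * h j / cycle_sum2 ?n q M j" if "j < ?n" for j
      using IH that by blast
    have IHx: "sX ?S2 x = sX ?S1 x * (cycle_sum1 ?n q M (merge_edge ?n v e x) / h (merge_edge ?n v e x))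
        powi merge_mult ?n v e a' x" if "x \<in> ?V" "x \<notin> set ws" for x
      using IH that by simp
    \<comment> \<open>Passing to the longer cycle raises the index by one, so one position back in
      the shorter cycle is position \<open>j\<close> itself.\<close>
    have h1: "cycle_sum1 ?n q M j = g j" if "j < ?n" for j
      unfolding cycle_sum1_def h_def[symmetric] using n nz that h[of "?n - 1"] h[of "j - 1"] by auto
    have h2: "cycle_sum2 ?n q M j = (if j = 0 then q * g (?n - 1) else g (j - 1))" if "j < ?n" for j
    proof -
      have "?n - 2 < ?n" "?n - 2 \<noteq> ?n - 1" "Suc (?n - 2) = ?n - 1" using n by auto
      then have "h (?n - 2) = g (?n - 1)" using h by metis
      moreover have "h (?n - 1) = g 0 / q" using h[of "?n - 1"] n by simp
      moreover have "h (j - 2) = g (j - 1)" if "j \<ge> 2"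
      proof -
        have "j - 2 < ?n" "j - 2 \<noteq> ?n - 1" "Suc (j - 2) = j - 1" using that \<open>j < ?n\<close> by auto
        then show ?thesis using h by metis
      qed
      ultimately show ?thesis unfolding cycle_sum2_def h_def[symmetric] using nz by auto
    qed
    have "same_quiver ?S2 ?S1"
      by (rule same_quiver_cycle_reflection[OF cyc1 w1])
    then have e2: "sexch ?S2 x v = - sexch S x v" if "x \<in> ?V" for x
      using v that by (simp add: same_quiver_def mutate_simps(2))
    define y where "y = sX ?S2 v"
    have y: "y = q * g (?n - 1) / (x0 * g 0)"
    proof -
      have l: "?n - 1 < ?n" using n by linarith
      have "y = inverse x0 * (cycle_sum1 ?n q M (?n - 1) / h (?n - 1))"
        using IHx[OF v] by (simp add: y_def X1v merge_edge_def merge_mult_def)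
      also have "\<dots> = q * g (?n - 1) / (x0 * g 0)"
        unfolding h1[OF l] h[OF l] by (simp add: divide_inverse)
      finally show ?thesis .
    qed
    have y1: "1 + y = s / (x0 * g 0)" "1 + inverse y = s / (q * g (?n - 1))"
      unfolding y s_def using x0_nz g_nz nz by (simp_all add: field_simps)
    have y_nz: "y \<noteq> 0" unfolding y using x0_nz g_nz nz by simp
    have r: "apply_seq (cycle_reflection (v # ws)) S = ?S3"
      using n by (simp add: cycle_reflection_Cons)
    have A0: "sX ?S3 v = x0 * g 0 / (q * g (?n - 1))"
      using y_nz by (simp add: mutate_simps(3)[of v ?S2] y_def[symmetric]) (simp add: y)
    have Aw: "sX ?S3 (ws ! j) = sX S (ws ! j) * g (Suc j) / (if j = 0 then q * g ?n else g (j - 1))" if j: "j < ?n" for j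
    proof -
      have ev: "sexch ?S2 (ws ! j) v = of_bool (j = 0) - of_bool (Suc j = ?n)"
        using e2[OF inV(1)[OF j]] cv[OF j] by simp
      consider "j = 0" | "j \<noteq> 0" "Suc j = ?n" | "j \<noteq> 0" "Suc j \<noteq> ?n" by blast
      then show ?thesis
      proof cases
        case 1
        then have "sX ?S3 (ws ! j) = sX ?S2 (ws ! j) * (1 + inverse y) powi (- 1)"
          using mutate_X_factor(1)[of "ws ! j" v ?S2 1] inV[OF j] ev n by (simp add: y_def)
        also have "\<dots> = T 0 / T 1 * (1 + x0) * g 1 / (q * g (?n - 1)) * (q * g (?n - 1) / s)"
          unfolding IHw[OF j] X1w[OF j] h[OF j] h2[OF j] y1 using 1 n by (simp add: power_int_minus)
        also have "\<dots> = T 0 / T 1 * g 1 / (q * g ?n)"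
          unfolding key z_def[symmetric] using x0_nz z_nz g_nz nz by (simp add: field_simps)
        finally show ?thesis using 1 Xw[OF j] by simp
      next
        case 2
        then have "sX ?S3 (ws ! j) = sX ?S2 (ws ! j) * (1 + y) powi 1"
          using mutate_X_factor(2)[of "ws ! j" v ?S2 1] inV[OF j] ev by (simp add: y_def)
        also have "\<dots> = T j / T ?n * (x0 / (1 + x0)) * (g 0 / q) / g (j - 1) * (s / (x0 * g 0))"
          unfolding IHw[OF j] X1w[OF j] h[OF j] h2[OF j] y1 using 2 by auto
        also have "\<dots> = T j / T ?n * g ?n / g (j - 1)"
          unfolding key z_def[symmetric] using x0_nz z_nz g_nz nz by (simp add: field_simps)
        finally show ?thesis using 2 Xw[OF j] by simp
      next
        case 3
        then have "sX ?S3 (ws ! j) = sX ?S2 (ws ! j)"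
          using mutate_X_factor(3)[of "ws ! j" v ?S2] inV[OF j] ev by simp
        also have "\<dots> = T j / T (Suc j) * g (Suc j) / g (j - 1)"
          unfolding IHw[OF j] X1w[OF j] h[OF j] h2[OF j] using 3 by auto
        finally show ?thesis using 3 Xw[OF j] by simp
      qed
    qed
    have Ax: "sX ?S3 x = sX S x * ((if e x = 0 then q * g ?n else g (e x - 1)) / g (e x)) powi a' x"
      if x: "x \<in> ?V" "x \<notin> set (v # ws)" for x
    proof -
      have x': "x \<noteq> v" "x \<notin> set ws" using x by auto
      note a'0 = ex(2)[OF x]
      have ev: "sexch ?S2 x v = a' x * (of_bool (e x = ?n) - of_bool (e x = 0))"
        using e2[OF x(1)] xv[OF x] by (simp add: algebra_simps)
      have X2: "sX ?S2 x = sX ?S1 x * (g (merge_edge ?n v e x) / h (merge_edge ?n v e x)) powi merge_mult ?n v e a' x"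
        using IHx[OF x(1) x'(2)] h1[of "merge_edge ?n v e x"] ex[OF x] n ne x'
        by (auto simp: merge_edge_def)
      show ?thesis
      proof (cases "a' x = 0")
        case True
        then have "sX ?S3 x = sX ?S2 x" "sX ?S1 x = sX S x"
          using ev xv[OF x] x' by (intro mutate_X_factor(3); simp)+
        then show ?thesis using X2 True x' by (simp add: merge_mult_def)
      next
        case False
        then have pos: "a' x > 0" using a'0 by simp
        consider "e x = 0" | "e x = ?n" "e x \<noteq> 0" | "e x \<noteq> 0" "e x \<noteq> ?n" by blast
        then show ?thesis
        proof cases
          case 1
          then have m0: "merge_mult ?n v e a' x = 0" by (simp add: merge_mult_def x')
          have "sX ?S1 x = sX S x * (1 + inverse x0) powi (- a' x)"
            using mutate_X_factor(1)[of x v S "a' x"] x' xv[OF x] 1 pos ne by (simp add: x0_def)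
          moreover have "sX ?S3 x = sX ?S2 x * (1 + y) powi a' x"
            using mutate_X_factor(2)[of x v ?S2 "a' x"] x' ev 1 pos ne by (simp add: y_def)
          ultimately have "sX ?S3 x = sX S x * ((1 + y) / (1 + inverse x0)) powi a' x"
            using X2 m0
            by (simp add: power_int_minus power_int_divide_distrib divide_inverse power_int_mult_distrib
                power_int_inverse mult_ac)
          also have "(1 + y) / (1 + inverse x0) = q * g ?n / g 0"
            unfolding y1 xz key z_def[symmetric] using x0_nz z_nz g_nz nz by (simp add: field_simps)
          finally show ?thesis using 1 by simp
        next
          case 2
          then have m0: "merge_mult ?n v e a' x = 0" by (simp add: merge_mult_def x')
          have "sX ?S1 x = sX S x * (1 + x0) powi a' x"
            using mutate_X_factor(2)[of x v S "a' x"] x' xv[OF x] 2 pos ne by (simp add: x0_def)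
          moreover have "sX ?S3 x = sX ?S2 x * (1 + inverse y) powi (- a' x)"
            using mutate_X_factor(1)[of x v ?S2 "a' x"] x' ev 2 pos ne by (simp add: y_def)
          ultimately have "sX ?S3 x = sX S x * ((1 + x0) / (1 + inverse y)) powi a' x"
            using X2 m0
            by (simp add: power_int_minus power_int_divide_distrib divide_inverse power_int_mult_distrib
                power_int_inverse mult_ac)
          also have "(1 + x0) / (1 + inverse y) = g (?n - 1) / g ?n"
            unfolding y1 xz key z_def[symmetric] using x0_nz z_nz g_nz nz by (simp add: field_simps)
          finally show ?thesis using 2 ne by simp
        next
          case 3
          then have "sX ?S3 x = sX ?S2 x" "sX ?S1 x = sX S x"
            using ev xv[OF x] x' by (intro mutate_X_factor(3); simp)+
          moreover have "h (e x - 1) = g (e x)"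
            using h[of "e x - 1"] 3 ex[OF x] by auto
          ultimately show ?thesis using X2 3 x' by (simp add: merge_edge_def merge_mult_def)
        qed
      qed
    qed
    show ?thesis
      unfolding r list.size One_nat_def add_Suc_right add_0_right
    proof (intro conjI allI impI ballI)
      fix j assume j: "j < Suc ?n"
      show "sX ?S3 ((v # ws) ! j) = sX S ((v # ws) ! j) * cycle_sum (Suc ?n) q T j / cycle_sum2 (Suc ?n) q T j"
      proof (cases j)
        case 0
        then show ?thesis using A0 n unfolding cycle_sum2_def g_def[symmetric] by (simp add: x0_def)
      next
        case (Suc i)
        then show ?thesis
          using Aw[of i] j unfolding cycle_sum2_def g_def[symmetric] by auto
      qed
    next
      fix x assume "x \<in> ?V - set (v # ws)"
      then show "sX ?S3 x = sX S x * (cycle_sum1 (Suc ?n) q T (e x) / cycle_sum (Suc ?n) q T (e x)) powi a' x"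
        using Ax[of x] unfolding cycle_sum1_def g_def[symmetric] by simp
    qed
  qed
qed

section \<open>The quivers of a Kac-Moody algebra\<close>

lemma add_mod_eq_iff:
  fixes i j k m :: nat
  assumes "j < m" "k < m"
  shows "(i + j) mod m = (i + k) mod m \<longleftrightarrow> j = k"
proof -
  have "j = k" if "j < m" "k < m" "j \<le> k" "(i + j) mod m = (i + k) mod m" for j k
  proof -
    have "m dvd (i + k) - (i + j)"
      using that by (subst mod_eq_dvd_iff_nat[symmetric]) auto
    then show ?thesis using that by (auto dest: dvd_imp_le)
  qed
  then show ?thesis using assms by (metis nat_le_linear)
qed

lemma add_next_index_mod:
  assumes "j < m"
  shows "(i + next_index m j) mod m = Suc ((i + j) mod m) mod m"
proof (cases "Suc j = m")
  case True
  then have "Suc (i + j) = i + m" by simp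
  then have "Suc ((i + j) mod m) mod m = (i + m) mod m" by (metis mod_Suc_eq)
  then show ?thesis using True by (simp add: next_index_def)
qed (simp add: next_index_def mod_Suc_eq)

lemma cycle_reflection_eq:
  assumes "length vs \<ge> 2"
  shows "cycle_reflection vs = map Mut (take (length vs - 2) vs)
    @ [Perm (transpose (vs ! (length vs - 2)) (vs ! (length vs - 1))), Mut (vs ! (length vs - 1)),
       Mut (vs ! (length vs - 2))] @ map Mut (rev (take (length vs - 2) vs))"
  using assms
proof (induction vs)
  case (Cons v ws)
  show ?case
  proof (cases "length ws \<ge> 2")
    case True
    then obtain p where p: "length ws = Suc (Suc p)" by (metis add_2_eq_Suc le_Suc_ex)
    show ?thesis using Cons.IH[OF True] p by (simp add: cycle_reflection_Cons)
  next
    case False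
    then obtain w where "ws = [w]" using Cons.prems by (cases ws; cases "tl ws") auto
    then show ?thesis by simp
  qed
qed simp

locale coxeter_setting =
  fixes C :: "'s::finite \<Rightarrow> 's \<Rightarrow> int" and d :: "'s \<Rightarrow> int" and Q :: "'s wquiver" and m :: nat
  assumes cartan: "generalized_cartan C"
    and coxeter: "coxeter_quiver C d Q"
    and m: "m \<ge> 2"
begin

abbreviation "eps \<equiv> exchange Q"
abbreviation "V \<equiv> verts (Qm m Q)"
abbreviation "\<epsilon> \<equiv> exchange (Qm m Q)"

lemma m_pos: "m > 0" using m by simp

lemma weighted_Q: "weighted_quiver Q" and verts_Q: "verts Q = UNIV"
  and abs_eps: "s \<noteq> t \<Longrightarrow> \<bar>eps s t\<bar> = - C t s"
  using coxeter by (auto simp: coxeter_quiver_def)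

lemma V_eq: "V = UNIV \<times> {..<m}"
  by (simp add: Qm_def verts_Q)

lemma finite_V [simp]: "finite V"
  by (simp add: V_eq)

lemma mem_V [simp]: "(s, i) \<in> V \<longleftrightarrow> i < m"
  by (simp add: V_eq)

lemma wt_pos: "wt Q s > 0"
  using weighted_Q verts_Q unfolding weighted_quiver_def by blast

lemma wt_Qm [simp]: "wt (Qm m Q) (s, i) = wt Q s"
  by (simp add: Qm_def)

lemma arr_Q_skew: "arr Q s t = - arr Q t s"
  using weighted_Q verts_Q unfolding weighted_quiver_def by blast

lemma weighted_Qm: "weighted_quiver (Qm m Q)"
  unfolding weighted_quiver_def using wt_pos by (auto simp: Qm_def verts_Q)

lemma weight_ratio_pos: "wt Q s div gcd (wt Q s) (wt Q t) > 0"
  using wt_pos[of s] by (simp add: pos_imp_zdiv_pos_iff zdvd_imp_le)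

lemma sgn_eps: "sgn (eps s t) = sgn (arr Q s t)" "\<bar>eps s t\<bar> = \<bar>arr Q s t\<bar> * (wt Q s div gcd (wt Q s) (wt Q t))"
  using weight_ratio_pos[of s t] by (simp_all add: exchange_def sgn_mult abs_mult)

lemma eps_pos_iff: "eps s t > 0 \<longleftrightarrow> arr Q s t > 0"
  using sgn_eps(1)[of s t] by (metis sgn_1_pos)

lemma eps_flip:
  shows "eps s t > 0 \<longleftrightarrow> eps t s < 0" "eps s t = 0 \<longleftrightarrow> eps t s = 0"
proof -
  have "sgn (eps t s) = - sgn (eps s t)"
    unfolding sgn_eps(1) arr_Q_skew[of t s] by (simp add: sgn_if)
  then show "eps s t > 0 \<longleftrightarrow> eps t s < 0" "eps s t = 0 \<longleftrightarrow> eps t s = 0"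
    by (metis sgn_1_neg sgn_1_pos minus_equation_iff) (metis \<open>sgn (eps t s) = - sgn (eps s t)\<close> sgn_0_0 neg_equal_0_iff_equal)
qed

lemma exchange_Qm_same:
  "\<epsilon> (s, i) (s, j) = of_bool (j = Suc i mod m) - of_bool (i = Suc j mod m)"
proof -
  have "arr Q s s = 0" using arr_Q_skew[of s s] by linarith
  then show ?thesis
    using wt_pos[of s] by (simp add: exchange_def Qm_def)
qed

lemma exchange_Qm:
  assumes "s \<noteq> t"
  shows "\<epsilon> (s, i) (t, j) = \<bar>eps s t\<bar> *
    (if eps s t > 0 then of_bool (i = j) - of_bool (Suc i mod m = j)
     else of_bool (i = Suc j mod m) - of_bool (i = j))"
  using assms unfolding eps_pos_iff sgn_eps(2) using arr_Q_skew[of t s]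
  by (auto simp: exchange_def Qm_def)

text \<open>By \<open>source_eq\<close> the vertex (t, l) is an apex over the edge of the s-cycle
  that starts at \<open>l - shift s t\<close>, read modulo \<open>m\<close>. Through this number the
  orientation of the Coxeter quiver enters the QQ-system.\<close>

definition shift :: "'s \<Rightarrow> 's \<Rightarrow> int" where
  "shift s t = of_bool (eps s t > 0)"

lemma shift_cases:
  assumes "s \<noteq> t" "C t s \<noteq> 0"
  shows "(shift s t = 1 \<and> shift t s = 0) \<or> (shift s t = 0 \<and> shift t s = 1)"
proof -
  have "eps s t \<noteq> 0" using abs_eps[OF assms(1)] assms(2) by auto
  then show ?thesis using eps_flip(1)[of s t] eps_flip(1)[of t s] eps_flip(2)[of s t]
    by (auto simp: shift_def)
qed

text \<open>The position of the edge of the \<open>s\<close>-cycle over which the vertex \<open>(t, l)\<close> sits.\<close>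

definition source :: "'s \<Rightarrow> 's \<times> nat \<Rightarrow> nat" where
  "source s x = (if eps s (fst x) > 0 then (snd x + m - 1) mod m else snd x)"

lemma source_less: "x \<in> V \<Longrightarrow> source s x < m"
  using m_pos by (cases x) (auto simp: source_def)

lemma Suc_source: "l < m \<Longrightarrow> eps s t > 0 \<Longrightarrow> Suc (source s (t, l)) mod m = l"
  using m_pos by (simp add: source_def mod_Suc_eq)

lemma Suc_mod_eq_iff: "p < m \<Longrightarrow> q < m \<Longrightarrow> Suc p mod m = Suc q mod m \<longleftrightarrow> p = q"
  using add_mod_eq_iff[of p m q 1] by simp

lemma exchange_Qm_source:
  assumes "s \<noteq> t" "p < m" "l < m"
  shows "\<epsilon> (s, p) (t, l) = \<bar>eps s t\<bar> *
      (of_bool (p = Suc (source s (t, l)) mod m) - of_bool (p = source s (t, l)))"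
    and "\<epsilon> (t, l) (s, p) = \<bar>eps t s\<bar> *
      (of_bool (p = source s (t, l)) - of_bool (p = Suc (source s (t, l)) mod m))"
proof -
  have src: "source s (t, l) < m" using source_less assms by simp
  have pos: "p = source s (t, l) \<longleftrightarrow> Suc p mod m = l" if "eps s t > 0"
    using Suc_source[OF assms(3) that] Suc_mod_eq_iff[OF assms(2) src] by metis
  consider "eps s t > 0" "eps t s < 0" | "eps s t = 0" "eps t s = 0" | "eps s t < 0" "eps t s > 0"
    using eps_flip[of s t] eps_flip[of t s] by linarith
  then have "\<epsilon> (s, p) (t, l) = \<bar>eps s t\<bar> *
      (of_bool (p = Suc (source s (t, l)) mod m) - of_bool (p = source s (t, l))) \<and>
    \<epsilon> (t, l) (s, p) = \<bar>eps t s\<bar> *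
      (of_bool (p = source s (t, l)) - of_bool (p = Suc (source s (t, l)) mod m))"
  proof cases
    case 1
    then have "Suc (source s (t, l)) mod m = l" "p = source s (t, l) \<longleftrightarrow> Suc p mod m = l"
      using pos Suc_source[OF assms(3)] by auto
    then show ?thesis
      using 1 unfolding exchange_Qm[OF assms(1)] exchange_Qm[OF assms(1)[symmetric]]
      by (auto simp: of_bool_def)
  next
    case 2
    then show ?thesis
      unfolding exchange_Qm[OF assms(1)] exchange_Qm[OF assms(1)[symmetric]] by simp_all
  next
    case 3
    then have "source s (t, l) = l" by (simp add: source_def)
    then show ?thesis
      using 3 unfolding exchange_Qm[OF assms(1)] exchange_Qm[OF assms(1)[symmetric]]
      by (auto simp: of_bool_def)
  qed
  then show "\<epsilon> (s, p) (t, l) = \<bar>eps s t\<bar> *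
      (of_bool (p = Suc (source s (t, l)) mod m) - of_bool (p = source s (t, l)))"
    "\<epsilon> (t, l) (s, p) = \<bar>eps t s\<bar> *
      (of_bool (p = source s (t, l)) - of_bool (p = Suc (source s (t, l)) mod m))"
    by blast+
qed

section \<open>The cycles of Q_m as triangulated cycles\<close>

definition cycle :: "'s \<Rightarrow> nat \<Rightarrow> ('s \<times> nat) list" where
  "cycle s i = map (\<lambda>j. (s, (i + j) mod m)) [0..<m]"

definition edge :: "'s \<Rightarrow> nat \<Rightarrow> 's \<times> nat \<Rightarrow> nat" where
  "edge s i x = (source s x + m - i) mod m"

lemma length_cycle [simp]: "length (cycle s i) = m"
  by (simp add: cycle_def)

lemma nth_cycle [simp]: "j < m \<Longrightarrow> cycle s i ! j = (s, (i + j) mod m)"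
  by (simp add: cycle_def)

lemma ex_cycle_index:
  assumes "i < m" "l < m"
  obtains j where "j < m" "l = (i + j) mod m"
proof
  show "(l + m - i) mod m < m" using m_pos by simp
  show "l = (i + (l + m - i) mod m) mod m" using assms by (simp add: mod_add_right_eq)
qed

lemma set_cycle:
  assumes "i < m"
  shows "set (cycle s i) = {s} \<times> {..<m}"
proof -
  have "l \<in> (\<lambda>j. (i + j) mod m) ` {..<m}" if "l < m" for l
    using ex_cycle_index[OF assms that] by blast
  then show ?thesis using m_pos by (auto simp: cycle_def image_iff Bex_def)
qed

lemma edge_less: "edge s i x < m"
  using m_pos by (simp add: edge_def)

lemma add_edge: "i < m \<Longrightarrow> x \<in> V \<Longrightarrow> (i + edge s i x) mod m = source s x"
  using source_less[of x s] by (simp add: edge_def mod_add_right_eq)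

lemma eq_edge_iff:
  assumes "i < m" "x \<in> V" "j < m"
  shows "j = edge s i x \<longleftrightarrow> (i + j) mod m = source s x"
    and "j = next_index m (edge s i x) \<longleftrightarrow> (i + j) mod m = Suc (source s x) mod m"
proof -
  have n: "next_index m (edge s i x) < m"
    using edge_less[of s i x] m_pos by (auto simp: next_index_def)
  show "j = edge s i x \<longleftrightarrow> (i + j) mod m = source s x"
    using add_mod_eq_iff[OF assms(3) edge_less, of i s i x] add_edge[OF assms(1,2)] by simp
  show "j = next_index m (edge s i x) \<longleftrightarrow> (i + j) mod m = Suc (source s x) mod m"
    using add_mod_eq_iff[OF assms(3) n, of i] add_next_index_mod[OF edge_less, of i s i x]
      add_edge[OF assms(1,2)] by simp
qed

lemma triangulated_cycle_Qm:
  assumes i: "i < m"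
  shows "triangulated_cycle V \<epsilon> (cycle s i) (edge s i)
    (\<lambda>x. \<bar>eps s (fst x)\<bar>) (\<lambda>x. \<bar>eps (fst x) s\<bar>)"
  unfolding triangulated_cycle_def Let_def length_cycle
proof (intro conjI allI impI ballI)
  show "distinct (cycle s i)"
    using add_mod_eq_iff[of _ m _ i] by (auto simp: cycle_def distinct_map inj_on_def)
  show "set (cycle s i) \<subseteq> V" using i by (auto simp: set_cycle V_eq)
  fix j k assume jk: "j < m" "k < m"
  have n: "next_index m l < m" if "l < m" for l using that m_pos by (auto simp: next_index_def)
  have "(i + k) mod m = Suc ((i + j) mod m) mod m \<longleftrightarrow> k = next_index m j"
    "(i + j) mod m = Suc ((i + k) mod m) mod m \<longleftrightarrow> j = next_index m k"
    using add_mod_eq_iff[OF jk(2) n[OF jk(1)], of i] add_mod_eq_iff[OF jk(1) n[OF jk(2)], of i]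
      add_next_index_mod[OF jk(1), of i] add_next_index_mod[OF jk(2), of i] by simp_all
  then show "\<epsilon> (cycle s i ! j) (cycle s i ! k) = of_bool (k = next_index m j) - of_bool (j = next_index m k)"
    using jk by (simp add: exchange_Qm_same)
next
  fix x assume x: "x \<in> V - set (cycle s i)"
  then obtain t l where tl: "x = (t, l)" "s \<noteq> t" "l < m" "(t, l) \<in> V"
    using i by (cases x) (auto simp: set_cycle V_eq)
  show "edge s i x < m" by (rule edge_less)
  show "(\<bar>eps s (fst x)\<bar> = 0) = (\<bar>eps (fst x) s\<bar> = 0)"
    using eps_flip(2)[of s "fst x"] by simp
  fix j assume j: "j < m"
  have p: "(i + j) mod m < m" using m_pos by simp
  show "\<epsilon> (cycle s i ! j) x = \<bar>eps s (fst x)\<bar> *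
      (of_bool (j = next_index m (edge s i x)) - of_bool (j = edge s i x))"
    "\<epsilon> x (cycle s i ! j) = \<bar>eps (fst x) s\<bar> *
      (of_bool (j = edge s i x) - of_bool (j = next_index m (edge s i x)))"
    using exchange_Qm_source[OF tl(2) p tl(3)] eq_edge_iff[OF i tl(4) j, of s] j
    by (simp_all add: tl(1))
qed (use m in simp_all)

lemma R_seq_eq: "R_seq m s i = cycle_reflection (cycle s i)"
proof -
  have a: "cycle s i ! (m - 2) = (s, (m + i - 2) mod m)" "cycle s i ! (m - 1) = (s, (m + i - 1) mod m)"
    using m by (simp_all add: add.commute)
  have "take (m - 2) (cycle s i) = map (\<lambda>j. (s, (i + j) mod m)) [0..<m - 2]"
    by (simp add: cycle_def take_map)
  then have M: "M_seq m s i = map Mut (rev (take (m - 2) (cycle s i)))"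
    by (simp add: M_seq_def rev_map)
  have "seq_inv (M_seq m s i) = map Mut (take (m - 2) (cycle s i))"
    unfolding M seq_inv_def by (simp add: rev_map)
  then show ?thesis
    using m M a cycle_reflection_eq[of "cycle s i"] by (simp add: R_seq_def Let_def)
qed

abbreviation "initial \<equiv> initial_seed (Qm m Q)"

lemma initial_simps [simp]:
  "svert initial = V" "swt initial = wt (Qm m Q)" "sexch initial = \<epsilon>"
  "sX initial = ratfun_var" "sA initial = ratfun_var"
  by (simp_all add: initial_seed_def)

lemma R_seq_steps: "i < m \<Longrightarrow> \<forall>x\<in>set (R_seq m s i). step_on V x"
  unfolding R_seq_eq by (rule cycle_reflection_steps) (auto simp: set_cycle V_eq)

lemma seed_cycle:
  assumes "same_quiver S initial" "i < m"
  shows "svert S = V" "triangulated_cycle (svert S) (sexch S) (cycle s i) (edge s i)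
      (\<lambda>x. \<bar>eps s (fst x)\<bar>) (\<lambda>x. \<bar>eps (fst x) s\<bar>)"
    "\<And>v w. v \<in> set (cycle s i) \<Longrightarrow> w \<in> set (cycle s i) \<Longrightarrow> swt S v = swt S w"
proof -
  show V: "svert S = V" using assms by (simp add: same_quiver_def)
  show "triangulated_cycle (svert S) (sexch S) (cycle s i) (edge s i)
      (\<lambda>x. \<bar>eps s (fst x)\<bar>) (\<lambda>x. \<bar>eps (fst x) s\<bar>)"
    unfolding V
    by (rule triangulated_cycle_cong[OF triangulated_cycle_Qm[OF assms(2)]])
      (use assms(1) V in \<open>simp add: same_quiver_def\<close>)
  show "swt S v = swt S w" if "v \<in> set (cycle s i)" "w \<in> set (cycle s i)" for v w
    using assms that V by (auto simp: set_cycle same_quiver_def)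
qed

lemma R_seq_same_quiver:
  assumes "same_quiver S initial" "i < m"
  shows "same_quiver (apply_seq (R_seq m s i) S) initial"
  unfolding R_seq_eq
  by (rule same_quiver_trans[OF same_quiver_cycle_reflection[OF
        seed_cycle(2)[OF assms] seed_cycle(3)[OF assms, where s = s]] assms(1)])

lemma R_seq_quiver_preserving: "i < m \<Longrightarrow> R_seq m s i \<in> quiver_preserving (Qm m Q)"
  using R_seq_steps R_seq_same_quiver[of initial] by (simp add: quiver_preserving_def)

definition R_word :: "'s list \<Rightarrow> ('s \<times> nat) mseq" where
  "R_word u = concat (map (\<lambda>s. R_seq m s 0) u)"

lemma R_word_simps [simp]:
  "R_word [] = []" "R_word (s # u) = R_seq m s 0 @ R_word u" "R_word (u @ w) = R_word u @ R_word w"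
  by (simp_all add: R_word_def)

lemma R_word_quiver_preserving: "R_word u \<in> quiver_preserving (Qm m Q)"
proof (induction u)
  case (Cons s u)
  then show ?case
    unfolding R_word_simps by (intro quiver_preserving_append R_seq_quiver_preserving m_pos)
qed (simp add: quiver_preserving_def)

end

lemma int_periodic:
  fixes F :: "int \<Rightarrow> 'a"
  assumes F: "\<And>j. F (j - int m) = F j" and jk: "j mod int m = k mod int m"
  shows "F j = F k"
proof -
  have "F (r + z * int m) = F r" for r z
  proof (induction z rule: int_induct[of _ 0])
    case (step1 z)
    then show ?case using F[of "r + (z + 1) * int m"] by (simp add: algebra_simps)
  next
    case (step2 z)
    then show ?case using F[of "r + z * int m"] by (simp add: algebra_simps)
  qed simp
  from this[of "j mod int m" "j div int m"] this[of "k mod int m" "k div int m"]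
  have "F j = F (j mod int m)" "F k = F (k mod int m)" by (simp_all only: mod_div_mult_eq)
  then show ?thesis by (simp only: jk)
qed

context positive_cone
begin

text \<open>The multiplier cancels in a quotient, which is therefore periodic. This permits passing
  between vertex labels modulo \<open>m\<close> and integer positions.\<close>

lemma quasi_periodic_quotient:
  assumes "quasi_periodic m T" "j mod int m = k mod int m"
  shows "T (j + a) / T (j + b) = T (k + a) / T (k + b)"
proof (rule int_periodic[of "\<lambda>j. T (j + a) / T (j + b)"])
  fix j
  have "T (j - int m + c) = multiplier m T * T (j + c)" for c
    using quasi_periodicD(3)[OF assms(1), of "j + c"] by (simp add: algebra_simps)
  then show "T (j - int m + a) / T (j - int m + b) = T (j + a) / T (j + b)"
    using quasi_periodicD(5)[OF assms(1)] by simp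
qed (rule assms(2))

text \<open>Terms at positions beyond \<open>j\<close> are moved back by one period, which costs a
  factor \<open>multiplier m T\<close>.\<close>

lemma cycle_sum_eq_window:
  assumes T: "quasi_periodic m T" and j: "j < m"
  shows "cycle_sum m (multiplier m T) (\<lambda>k. T (i + int k)) j = window m T (i + int j)"
    and "cycle_sum1 m (multiplier m T) (\<lambda>k. T (i + int k)) j = window m T (i + int j - 1)"
    and "m \<ge> 2 \<Longrightarrow> cycle_sum2 m (multiplier m T) (\<lambda>k. T (i + int k)) j = window m T (i + int j - 2)"
proof -
  have m: "m > 0" using j by simp
  have 1: "cycle_sum m (multiplier m T) (\<lambda>k. T (i + int k)) j = window m T (i + int j)" if j: "j < m" for j
    unfolding cycle_sum_def window_def
  proof (rule sum.reindex_bij_witness[of _ "\<lambda>k. if k \<le> j then j - k else j + m - k" "\<lambda>k. if k \<le> j then j - k else j + m - k"])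
    fix k assume k: "k \<in> {..<m}"
    show "T (i + int j - int (if k \<le> j then j - k else j + m - k))
        = (if k \<le> j then T (i + int k) else multiplier m T * T (i + int k))"
      using k quasi_periodicD(3)[OF T, of "i + int k"]
      by (auto simp: of_nat_diff algebra_simps)
  qed (use j in auto)
  have w: "multiplier m T * window m T k = window m T (k - int m)" for k
    using quasi_periodicD(3)[OF quasi_periodic_window(1)[OF T m]] quasi_periodic_window(2)[OF T m] by simp
  show "cycle_sum m (multiplier m T) (\<lambda>k. T (i + int k)) j = window m T (i + int j)"
    using j by (rule 1)
  show "cycle_sum1 m (multiplier m T) (\<lambda>k. T (i + int k)) j = window m T (i + int j - 1)"
    unfolding cycle_sum1_def using 1[of "m - 1"] 1[of "j - 1"] j
    by (auto simp: w of_nat_diff algebra_simps)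
  assume "m \<ge> 2"
  then show "cycle_sum2 m (multiplier m T) (\<lambda>k. T (i + int k)) j = window m T (i + int j - 2)"
    unfolding cycle_sum2_def using 1[of "m - 1"] 1[of "m - 2"] 1[of "j - 2"] j
    by (auto simp: w of_nat_diff algebra_simps)
qed

end

section \<open>Lifting the seeds of Q_m to solutions of QQ-systems\<close>

locale coxeter_lift = coxeter_setting C d Q m +
    qq: qq_system "subtraction_free :: ('s \<times> nat) ratfun set" m C "coxeter_setting.shift Q" y
  for C :: "'s::finite \<Rightarrow> 's \<Rightarrow> int" and d :: "'s \<Rightarrow> int" and Q :: "'s wquiver" and m :: nat
    and y :: "'s \<Rightarrow> int \<Rightarrow> ('s \<times> nat) ratfun"
begin

definition lifts_X :: "('s \<times> nat) seed \<Rightarrow> ('s \<Rightarrow> int \<Rightarrow> ('s \<times> nat) ratfun) \<Rightarrow> bool" where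
  "lifts_X S A \<longleftrightarrow> (\<forall>s. \<forall>l<m. sX S (s, l) = qq.ratio A s (int l - 1) / qq.ratio A s (int l))"

definition lifts_A :: "('s \<times> nat) seed \<Rightarrow> ('s \<Rightarrow> int \<Rightarrow> ('s \<times> nat) ratfun) \<Rightarrow> bool" where
  "lifts_A S A \<longleftrightarrow> (\<forall>s. \<forall>l<m. sA S (s, l) = A s (int l))"

lemma source_eq: "x \<in> V \<Longrightarrow> int (source s x) = (int (snd x) - shift s (fst x)) mod int m"
proof -
  assume "x \<in> V"
  then have l: "snd x < m" by (cases x) simp
  show ?thesis
  proof (cases "eps s (fst x) > 0")
    case True
    have "int (snd x + m - 1) = (int (snd x) - 1) + int m" using m_pos by simp
    then have "int ((snd x + m - 1) mod m) = (int (snd x) - 1) mod int m"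
      by (simp only: zmod_int mod_add_self2)
    then show ?thesis using True by (simp add: source_def shift_def)
  next
    case False
    then show ?thesis using l by (simp add: source_def shift_def)
  qed
qed

text \<open>\<open>cycle_reflection_X\<close> speaks of positions counted from \<open>i\<close>.
  Since quotients of a quasi-periodic sequence depend on positions modulo \<open>m\<close> only,
  \<open>i\<close> disappears from the result.\<close>

theorem lifts_X_R_seq:
  assumes S: "same_quiver S initial" "positive_seed S" and A: "qq.regular A"
    and lift: "lifts_X S A" and i: "i < m"
  shows "lifts_X (apply_seq (R_seq m s i) S) (qq.reflect s A)"
proof -
  define T where "T = qq.ratio A s"
  define w where "w = qq.window m T"
  note T = qq.quasi_periodic_ratio_mult[OF A, of s, folded T_def]
  note w = qq.quasi_periodic_window(1)[OF T(1) m_pos, folded w_def]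
  let ?q = "qq.multiplier m T" and ?T = "\<lambda>k. T (int i + int k)"
  note cyc = seed_cycle(1)[OF S(1) i] seed_cycle(2)[OF S(1) i, of s] seed_cycle(3)[OF S(1) i, where s = s]
  have quot: "T (j + a) / T (j + b) = T (k + a) / T (k + b)"
    "w (j + a) / w (j + b) = w (k + a) / w (k + b)"
    if "j mod int m = k mod int m" for j k a b
    using qq.quasi_periodic_quotient[OF T(1) that] qq.quasi_periodic_quotient[OF w that] by auto
  have X: "sX S (s, l) = T (int l - 1) / T (int l)" if "l < m" for l
    using lift that by (simp add: lifts_X_def T_def)
  have cX: "cycle_X S (cycle s i) ?q ?T"
    unfolding cycle_X_def length_cycle
  proof (intro allI impI)
    fix j assume j: "j < m"
    have "sX S (cycle s i ! j) = T (int ((i + j) mod m) - 1) / T (int ((i + j) mod m))"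
      using j m_pos by (simp add: X)
    also have "\<dots> = T (int i + int j - 1) / T (int i + int j)"
      using quot(1)[of "int ((i + j) mod m)" "int i + int j" "-1" 0] by (simp add: zmod_int)
    also have "\<dots> = (if j = 0 then ?q * ?T (m - 1) / ?T 0 else ?T (j - 1) / ?T j)"
    proof (cases "j = 0")
      case True
      have "T (int i - 1) = ?q * T (int i - 1 + int m)"
        using qq.quasi_periodicD(3)[OF T(1), of "int i - 1 + int m"] by simp
      then show ?thesis using True m_pos by (simp add: of_nat_diff algebra_simps)
    next
      case False
      then have "int (j - 1) = int j - 1" by simp
      then show ?thesis using False by (simp add: algebra_simps)
    qed
    finally show "sX S (cycle s i ! j) = (if j = 0 then ?q * ?T (m - 1) / ?T 0 else ?T (j - 1) / ?T j)" .
  qed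
  have pos: "?T k \<in> subtraction_free" "?q \<in> subtraction_free" for k
    using qq.quasi_periodicD(1,4)[OF T(1)] by auto
  note R = cycle_reflection_X[OF cyc(2) S(2) cyc(3) pos cX, unfolded length_cycle, folded R_seq_eq]
  note sums = qq.cycle_sum_eq_window[OF T(1), of _ "int i", folded w_def]
  let ?S = "apply_seq (R_seq m s i) S"
  show ?thesis
    unfolding lifts_X_def
  proof (intro allI impI)
    fix t l assume l: "l < m"
    show "sX ?S (t, l) = qq.ratio (qq.reflect s A) t (int l - 1) / qq.ratio (qq.reflect s A) t (int l)"
    proof (cases "t = s")
      case True
      obtain j where j: "j < m" "l = (i + j) mod m" using ex_cycle_index[OF i l] by blast
      have "sX ?S (s, l) = sX S (s, l) * (w (int i + int j) / w (int i + int j - 2))"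
        using R j sums(1)[OF j(1)] sums(3)[OF j(1) m] by auto
      also have "w (int i + int j) / w (int i + int j - 2) = w (int l) / w (int l - 2)"
        using quot(2)[of "int i + int j" "int l" 0 "-2"] j by (simp add: zmod_int)
      finally show ?thesis
        using True X[OF l] qq.quasi_periodicD(2)[OF w]
        by (simp add: qq.ratio_reflect(1)[OF A] T_def[symmetric] w_def[symmetric])
    next
      case False
      then have x: "(t, l) \<in> svert S - set (cycle s i)" using l i cyc(1) by (auto simp: set_cycle)
      let ?e = "edge s i (t, l)"
      have e: "?e < m" by (rule edge_less)
      have ce: "- C s t = \<bar>eps t s\<bar>" using abs_eps[OF False] by simp
      have "sX ?S (t, l) = sX S (t, l) * (w (int i + int ?e - 1) / w (int i + int ?e)) powi \<bar>eps t s\<bar>"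
        using R x sums(1,2)[OF e] by auto
      also have "w (int i + int ?e - 1) / w (int i + int ?e)
          = w (int l - shift s t - 1) / w (int l - shift s t)"
      proof -
        have "(int i + int ?e) mod int m = int (source s (t, l))"
          using add_edge[OF i, of "(t, l)" s] l by (simp flip: zmod_int of_nat_add)
        also have "\<dots> = (int l - shift s t) mod int m"
          using source_eq[of "(t, l)" s] l by simp
        finally show ?thesis
          using quot(2)[of "int i + int ?e" "int l - shift s t" "-1" 0] by simp
      qed
      \<comment> \<open>For joined nodes exactly one of the two offsets is 1, whence
        \<open>shift t s - 1 = - shift s t\<close>; for unjoined nodes the exponent is zero.\<close>
      also have "(w (int l - shift s t - 1) / w (int l - shift s t)) powi \<bar>eps t s\<bar>
          = (w (int l - 1 + shift t s - 1) / w (int l + shift t s - 1)) powi (- C s t)"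
      proof (cases "C s t = 0")
        case False
        then have "shift t s - 1 = - shift s t" using shift_cases[of t s] \<open>t \<noteq> s\<close> by auto
        then have "int l - 1 + shift t s - 1 = int l - shift s t - 1" "int l + shift t s - 1 = int l - shift s t"
          by linarith+
        then show ?thesis by (simp only: ce)
      qed (use ce in simp)
      finally show ?thesis
        using lift l False
        by (simp add: qq.ratio_reflect(2)[OF A False] T_def[symmetric] w_def[symmetric] lifts_X_def
            power_int_divide_distrib)
    qed
  qed
qed

lemma window_shift_period:
  "qq.window m T (i + int m - 1) = (\<Sum>j<m. T (i + int j))"
  unfolding qq.window_def
  by (rule sum.reindex_bij_witness[of _ "\<lambda>k. m - 1 - k" "\<lambda>k. m - 1 - k"]) (auto simp: of_nat_diff algebra_simps)

text \<open>With all coefficients 1 the edge monomials are the values of \<open>rhs\<close>, so the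
  cycle potential is a full window of \<open>ratio\<close>. Such a window is constant, so the
  starting index \<open>i\<close> does not matter.\<close>

theorem lifts_A_R_seq:
  assumes S: "same_quiver S initial" "positive_seed S" and A: "qq.periodic A"
    and per: "\<And>s j. A s (j - int m) = A s j" and y: "\<And>s j. y s j = 1"
    and lift: "lifts_A S A" and i: "i < m"
  shows "lifts_A (apply_seq (R_seq m s i) S) (qq.reflect s A)"
proof -
  note cyc = seed_cycle(1)[OF S(1) i] seed_cycle(2)[OF S(1) i, of s] seed_cycle(3)[OF S(1) i, where s = s]
  have AS: "sA S (u, k mod m) = A u (int k)" for u k
  proof -
    have "sA S (u, k mod m) = A u (int (k mod m))" using lift m_pos by (simp add: lifts_A_def)
    also have "\<dots> = A u (int k)" 
      by (rule int_periodic[of "A u", OF per]) (simp add: zmod_int)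
    finally show ?thesis .
  qed
  have shift01: "shift s u = 0 \<or> shift s u = 1" for u by (simp add: shift_def)
  have mono: "edge_monomial V (cycle s i) (edge s i) (\<lambda>x. \<bar>eps s (fst x)\<bar>) (sA S) j = qq.rhs A s (int i + int j)"
    if j: "j < m" for j
  proof -
    have "edge_monomial V (cycle s i) (edge s i) (\<lambda>x. \<bar>eps s (fst x)\<bar>) (sA S) j
      = (\<Prod>x\<in>(UNIV - {s}) \<times> {..<m}. if edge s i x = j then sA S x powi \<bar>eps s (fst x)\<bar> else 1)"
      unfolding edge_monomial_def using i by (intro prod.cong) (auto simp: V_eq set_cycle)
    also have "\<dots> = (\<Prod>u\<in>UNIV - {s}. \<Prod>l<m. if edge s i (u, l) = j then sA S (u, l) powi \<bar>eps s u\<bar> else 1)"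
      unfolding prod.cartesian_product by (rule prod.cong) auto
    also have "\<dots> = (\<Prod>u\<in>UNIV - {s}. A u (int i + int j + shift s u) powi (- C u s))"
    proof (rule prod.cong[OF refl])
      fix u assume u: "u \<in> UNIV - {s}"
      define k where "k = i + j + nat (shift s u)"
      have kint: "int k = int i + int j + shift s u" using shift01[of u] by (auto simp: k_def)
      have "edge s i (u, l) = j \<longleftrightarrow> l = k mod m" if l: "l < m" for l
      proof -
        have "edge s i (u, l) = j \<longleftrightarrow> (i + j) mod m = source s (u, l)"
          using eq_edge_iff(1)[OF i _ j, of "(u, l)" s] l by auto
        also have "\<dots> \<longleftrightarrow> l = k mod m"
        proof (cases "eps s u > 0")
          case True
          then have k: "k mod m = Suc ((i + j) mod m) mod m" by (simp add: k_def shift_def mod_Suc_eq)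
          have "(i + j) mod m = source s (u, l) \<longleftrightarrow> Suc ((i + j) mod m) mod m = Suc (source s (u, l)) mod m"
            using Suc_mod_eq_iff[of "(i + j) mod m" "source s (u, l)"] source_less[of "(u, l)" s] l m_pos by simp
          then show ?thesis using Suc_source[OF l True] k by auto
        next
          case False
          then show ?thesis by (auto simp: source_def k_def shift_def)
        qed
        finally show ?thesis .
      qed
      then have "(\<Prod>l<m. if edge s i (u, l) = j then sA S (u, l) powi \<bar>eps s u\<bar> else 1)
          = (\<Prod>l<m. if l = k mod m then sA S (u, l) powi \<bar>eps s u\<bar> else 1)"
        by (intro prod.cong) auto
      also have "\<dots> = sA S (u, k mod m) powi \<bar>eps s u\<bar>"
        using m_pos by simp
      finally show "(\<Prod>l<m. if edge s i (u, l) = j then sA S (u, l) powi \<bar>eps s u\<bar> else 1)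
          = A u (int i + int j + shift s u) powi (- C u s)"
        using abs_eps[of s u] u by (simp add: AS kint)
    qed
    finally show ?thesis by (simp add: qq.rhs_def y)
  qed
  have "cycle_potential V (cycle s i) (edge s i) (\<lambda>x. \<bar>eps s (fst x)\<bar>) (sA S)
      = (\<Sum>j<m. qq.ratio A s (int i + int j))"
    unfolding cycle_potential_def length_cycle
  proof (rule sum.cong[OF refl])
    fix j assume "j \<in> {..<m}"
    then have j: "j < m" "next_index m j < m" using m_pos by (auto simp: next_index_def)
    have "sA S (cycle s i ! next_index m j) = A s (int i + int j + 1)"
      using j AS[of s "Suc (i + j)"] add_next_index_mod[OF j(1), of i]
      by (simp add: mod_Suc_eq algebra_simps)
    moreover have "sA S (cycle s i ! j) = A s (int i + int j)"
      using j AS[of s "i + j"] by simp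
    ultimately show "edge_monomial V (cycle s i) (edge s i) (\<lambda>x. \<bar>eps s (fst x)\<bar>) (sA S) j /
        (sA S (cycle s i ! j) * sA S (cycle s i ! next_index m j)) = qq.ratio A s (int i + int j)"
      by (simp add: mono[OF j(1)] qq.ratio_def)
  qed
  also have "\<dots> = qq.potential A s"
    using window_shift_period[of "qq.ratio A s" "int i"] qq.window_eq_potential[OF A] by simp
  finally have pot: "cycle_potential (svert S) (cycle s i) (edge s i) (\<lambda>x. \<bar>eps s (fst x)\<bar>) (sA S) = qq.potential A s"
    using cyc(1) by simp
  show ?thesis
    unfolding lifts_A_def
  proof (intro allI impI)
    fix t l assume l: "l < m"
    then have "(t, l) \<in> svert S" using cyc(1) by simp
    from cycle_reflection_A[OF cyc(2) S(2) cyc(3) this] pot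
    show "sA (apply_seq (R_seq m s i) S) (t, l) = qq.reflect s A t (int l)"
      using lift l i by (auto simp: R_seq_eq set_cycle qq.reflect_periodic(1)[OF A] lifts_A_def)
  qed
qed

end

section \<open>The Weyl group in terms of words\<close>

lemma weyl_act_bij: "generalized_cartan C \<Longrightarrow> bij (weyl_act C u)"
  by (rule o_bij[of "weyl_act C (rev u)"]) (simp_all add: fun_eq_iff weyl_act_rev_cancel)

lemma BijGroup_UNIV:
  "carrier (BijGroup UNIV) = {f. bij f}" "\<one>\<^bsub>BijGroup UNIV\<^esub> = id"
  "bij f \<Longrightarrow> bij g \<Longrightarrow> f \<otimes>\<^bsub>BijGroup UNIV\<^esub> g = f \<circ> g"
  by (auto simp: BijGroup_def Bij_def compose_def fun_eq_iff)

text \<open>The generators are involutions, so the subgroup they generate consists of words without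
  inverses.\<close>

lemma weyl_group_eq:
  assumes "generalized_cartan C"
  shows "carrier (weyl_group C) = range (weyl_act C)"
proof -
  let ?G = "BijGroup (UNIV :: ('a \<Rightarrow> int) set)"
  have G: "group ?G" by (rule group_BijGroup)
  have r: "simple_reflection C s \<in> carrier ?G" for s
    by (rule simple_reflection_in_BijGroup[OF assms])
  have inv: "inv\<^bsub>?G\<^esub> (simple_reflection C s) = simple_reflection C s" for s
    by (rule group.inv_equality[OF G _ r r])
      (use r in \<open>auto simp: BijGroup_UNIV fun_eq_iff simple_reflection_involution[OF assms]\<close>)
  have carrier: "carrier (weyl_group C) = generate ?G (range (simple_reflection C))"
    using r by (simp add: weyl_group_def carrier_subgroup_generated Int_absorb1 image_subset_iff)
  have "w \<in> range (weyl_act C)" if "w \<in> generate ?G (range (simple_reflection C))" for w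
    using that
  proof induction
    case one
    have "weyl_act C [] = id" by (simp add: fun_eq_iff)
    then show ?case unfolding BijGroup_UNIV by (metis rangeI)
  next
    case (incl h)
    then obtain s where "h = simple_reflection C s" by blast
    then have "weyl_act C [s] = h" by (simp add: fun_eq_iff)
    then show ?case by (metis rangeI)
  next
    case (inv h)
    then obtain s where "h = simple_reflection C s" by blast
    then have "weyl_act C [s] = inv\<^bsub>?G\<^esub> h"
      by (intro ext) (simp add: \<open>\<And>s. inv\<^bsub>?G\<^esub> (simple_reflection C s) = simple_reflection C s\<close>)
    then show ?case by (metis rangeI)
  next
    case (eng h1 h2)
    then obtain u v where uv: "h1 = weyl_act C u" "h2 = weyl_act C v" by blast
    have "weyl_act C (u @ v) = h1 \<otimes>\<^bsub>?G\<^esub> h2"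
      using weyl_act_bij[OF assms] by (simp add: uv BijGroup_UNIV fun_eq_iff)
    then show ?case by (metis rangeI)
  qed
  moreover have "weyl_act C u \<in> generate ?G (range (simple_reflection C))" for u
  proof (induction u)
    case Nil
    have "weyl_act C [] = \<one>\<^bsub>?G\<^esub>" by (simp add: fun_eq_iff BijGroup_UNIV)
    then show ?case by (metis generate.one)
  next
    case (Cons s u)
    have "weyl_act C (s # u) = simple_reflection C s \<otimes>\<^bsub>?G\<^esub> weyl_act C u"
      using weyl_act_bij[OF assms] r[of s] by (simp add: BijGroup_UNIV fun_eq_iff)
    then show ?case using Cons by (simp add: generate.eng generate.incl)
  qed
  ultimately show ?thesis unfolding carrier by blast
qed

lemma weyl_group_mult:
  assumes "generalized_cartan C"
  shows "weyl_act C u \<otimes>\<^bsub>weyl_group C\<^esub> weyl_act C v = weyl_act C (u @ v)"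
  using weyl_act_bij[OF assms] by (simp add: weyl_group_def BijGroup_UNIV fun_eq_iff)

lemma weyl_group_inv:
  assumes "generalized_cartan C"
  shows "inv\<^bsub>weyl_group C\<^esub> (weyl_act C u) = weyl_act C (rev u)"
proof (rule group.inv_equality)
  show "group (weyl_group C)"
    unfolding weyl_group_def by (rule group.group_subgroup_generated[OF group_BijGroup])
  have "\<one>\<^bsub>weyl_group C\<^esub> = id" by (simp add: weyl_group_def BijGroup_UNIV)
  then show "weyl_act C (rev u) \<otimes>\<^bsub>weyl_group C\<^esub> weyl_act C u = \<one>\<^bsub>weyl_group C\<^esub>"
    by (simp add: weyl_group_mult[OF assms] fun_eq_iff weyl_act_rev_cancel[OF assms])
qed (simp_all add: weyl_group_eq[OF assms])

context qq_system
begin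

text \<open>Rescaling the sequences multiplies each ratio by a constant, which cancels in quotients.
  Proportional solutions thus describe the same X-variables.\<close>

lemma proportional_ratio_quotient:
  assumes "proportional A B"
  shows "ratio B i j / ratio B i k = ratio A i j / ratio A i k"
proof -
  obtain c where c: "\<And>i. c i \<noteq> 0" "\<And>i j. B i j = c i * A i j"
    using assms unfolding proportional_def by metis
  define a where "a = (\<Prod>k\<in>UNIV - {i}. c k powi (- C k i))"
  have "rhs B i j = a * rhs A i j" for j
    by (simp add: rhs_def c(2) power_int_mult_distrib prod.distrib a_def)
  then have "ratio B i j = (a / (c i * c i)) * ratio A i j" for j
    by (simp add: ratio_def c(2))
  moreover have "a / (c i * c i) \<noteq> 0" using c(1) by (simp add: a_def)
  ultimately show ?thesis by simp
qed

end

section \<open>Casimirs, the initial lifts and the relations between the R(s)\<close>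

context coxeter_setting
begin

text \<open>The exponent is constant along every cycle, so a simple root goes to the product of the
  X-variables along its cycle.\<close>

definition casimir :: "('s \<Rightarrow> int) \<Rightarrow> ('s \<times> nat) ratfun" where
  "casimir b = (\<Prod>x\<in>V. ratfun_var x powi b (fst x))"

lemma casimir_add: "casimir (\<lambda>s. b s + c s) = casimir b * casimir c"
  by (simp add: casimir_def power_int_add subtraction_free.pos_nonzero prod.distrib)

lemma casimir_eq_1_iff: "casimir b = 1 \<longleftrightarrow> (\<forall>s. b s = 0)"
  using m_pos by (auto simp: casimir_def laurent_monomial_eq_1_iff V_eq)

lemma casimir_inj: "inj casimir"
proof (rule injI)
  fix b c :: "'s \<Rightarrow> int" assume eq: "casimir b = casimir c"
  have "casimir (\<lambda>s. b s - c s) * casimir c = casimir b"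
    by (simp flip: casimir_add)
  moreover have "casimir c \<noteq> 0" by (simp add: casimir_def subtraction_free.pos_nonzero)
  ultimately have "casimir (\<lambda>s. b s - c s) = 1" using eq by simp
  then show "b = c" by (simp add: casimir_eq_1_iff fun_eq_iff)
qed

definition cycle_prod :: "'s \<Rightarrow> ('s \<times> nat) ratfun" where
  "cycle_prod s = (\<Prod>l<m. ratfun_var (s, l))"

lemma cycle_prod_pos: "cycle_prod s \<in> subtraction_free"
  by (auto simp: cycle_prod_def intro: subtraction_free.prod_pos)

lemma prod_V: "(\<Prod>x\<in>V. f x) = (\<Prod>s\<in>UNIV. \<Prod>l<m. f (s, l))"
  for f :: "'s \<times> nat \<Rightarrow> 'k::comm_monoid_mult"
  unfolding V_eq prod.cartesian_product by (rule prod.cong) auto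

lemma sum_V: "(\<Sum>x\<in>V. f x) = (\<Sum>s\<in>UNIV. \<Sum>l<m. f (s, l))"
  for f :: "'s \<times> nat \<Rightarrow> int"
  unfolding V_eq sum.cartesian_product by (rule sum.cong) auto

lemma casimir_eq: "casimir b = (\<Prod>s\<in>UNIV. cycle_prod s powi b s)"
  unfolding casimir_def prod_V by (simp add: cycle_prod_def power_int_prod)

text \<open>With these coefficients the initial \<open>X\<close>-variables are described by the constant sequences \<open>1\<close>.\<close>

definition y0 :: "'s \<Rightarrow> int \<Rightarrow> ('s \<times> nat) ratfun" where
  "y0 s k = cycle_prod s powi (- (k div int m)) *
     (\<Prod>j=1..nat (k mod int m). inverse (ratfun_var (s, j)))"

lemma quasi_periodic_y0:
  "subtraction_free.quasi_periodic m (y0 s)"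
  "subtraction_free.multiplier m (y0 s) = cycle_prod s"
proof -
  have pos: "y0 s k \<in> subtraction_free" for k
    unfolding y0_def
    by (intro subtraction_free.mult_pos subtraction_free.power_int_pos subtraction_free.prod_pos
        subtraction_free.inverse_pos cycle_prod_pos ratfun_var_pos)
  have "y0 s (k - int m) = cycle_prod s * y0 s k" for k
  proof -
    have "(k - int m) div int m = k div int m - 1" 
      using div_add_self2[of "int m" "k - int m"] m_pos by simp
    moreover have "cycle_prod s powi (1 - k div int m) = cycle_prod s * cycle_prod s powi (- (k div int m))"
      using cycle_prod_pos[of s] power_int_add[of "cycle_prod s" 1 "- (k div int m)"]
      by (auto dest: subtraction_free.pos_nonzero)
    ultimately show ?thesis by (simp add: y0_def mult.assoc)
  qed
  then show "subtraction_free.quasi_periodic m (y0 s)"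
    "subtraction_free.multiplier m (y0 s) = cycle_prod s"
    using pos subtraction_free.quasi_periodicI[of "y0 s" m "cycle_prod s"] by blast+
qed

lemma y0_quotient:
  assumes "l < m"
  shows "y0 s (int l - 1) / y0 s (int l) = ratfun_var (s, l)"
proof (cases l)
  case 0
  have var: "ratfun_var (s, j) \<noteq> 0" for j by (simp add: subtraction_free.pos_nonzero)
  obtain p where p: "m = Suc p" using m_pos by (cases m) auto
  \<comment> \<open>At the wrap-around the index -1 lies in the preceding period, where
    \<open>y0\<close> picks up the full cycle product.\<close>
  have "(-1) div int m = -1" "(-1) mod int m = int p"
    using m_pos p by (simp_all add: div_eq_minus1 zmod_minus1)
  then have "y0 s (- 1) = cycle_prod s * (\<Prod>j=1..p. inverse (ratfun_var (s, j)))"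
    by (simp add: y0_def)
  also have "cycle_prod s = ratfun_var (s, 0) * (\<Prod>j=1..p. ratfun_var (s, j))"
    unfolding cycle_prod_def unfolding p
    by (simp add: prod.lessThan_Suc_shift prod.atLeast1_atMost_eq del: prod.lessThan_Suc)
  finally have "y0 s (- 1) = ratfun_var (s, 0) * ((\<Prod>j=1..p. ratfun_var (s, j)) * (\<Prod>j=1..p. inverse (ratfun_var (s, j))))"
    by (simp only: mult.assoc)
  also have "(\<Prod>j=1..p. ratfun_var (s, j)) * (\<Prod>j=1..p. inverse (ratfun_var (s, j))) = 1"
    unfolding prod.distrib[symmetric] by (rule prod.neutral) (simp add: right_inverse[OF var])
  finally show ?thesis using 0 by (simp add: y0_def)
next
  case (Suc p)
  have y0: "y0 s (int n) = (\<Prod>j=1..n. inverse (ratfun_var (s, j)))" if "n < m" for n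
    using that by (simp add: y0_def flip: zmod_int zdiv_int)
  have "int l - 1 = int p" using Suc by simp
  then have "y0 s (int l - 1) = (\<Prod>j=1..p. inverse (ratfun_var (s, j)))"
    "y0 s (int l) = (\<Prod>j=1..Suc p. inverse (ratfun_var (s, j)))"
    using y0[of p] y0[of l] Suc assms by simp_all
  moreover have "(\<Prod>j=1..p. inverse (ratfun_var (s, j))) \<noteq> 0"
    by (simp add: subtraction_free.pos_nonzero)
  ultimately show ?thesis using Suc by (simp add: divide_inverse prod.cl_ivl_Suc)
qed

abbreviation (input) "A0 \<equiv> (\<lambda>_ _. 1) :: 's \<Rightarrow> int \<Rightarrow> ('s \<times> nat) ratfun"

definition a0 :: "'s \<Rightarrow> int \<Rightarrow> ('s \<times> nat) ratfun" where
  "a0 s k = ratfun_var (s, nat (k mod int m))"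

lemma coxeter_lift_y:
  assumes "\<And>s. subtraction_free.quasi_periodic m (y s)"
  shows "coxeter_lift C d Q m y"
  by unfold_locales (use assms m_pos cartan in auto)

interpretation X: coxeter_lift C d Q m y0
  by (rule coxeter_lift_y) (rule quasi_periodic_y0)

interpretation A: coxeter_lift C d Q m "\<lambda>_ _. 1"
  by (rule coxeter_lift_y) (simp add: subtraction_free.quasi_periodic_const)

lemma X_initial:
  "X.qq.regular A0" "X.qq.ratio A0 s = y0 s" "X.lifts_X initial A0" "X.qq.mult A0 s = cycle_prod s"
proof -
  show reg: "X.qq.regular A0"
    by (simp add: X.qq.regular_def subtraction_free.quasi_periodic_const)
  show ratio: "X.qq.ratio A0 s = y0 s" for s
    by (simp add: fun_eq_iff X.qq.ratio_def X.qq.rhs_def)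
  show "X.lifts_X initial A0"
    by (simp add: X.lifts_X_def ratio y0_quotient)
  show "X.qq.mult A0 s = cycle_prod s"
    using X.qq.quasi_periodic_ratio_mult(2)[OF reg, of s] by (simp add: ratio quasi_periodic_y0)
qed

lemma a0_periodic: "a0 s (j - int m) = a0 s j"
  by (simp add: a0_def)

lemma A_initial: "A.qq.periodic a0" "A.lifts_A initial a0"
proof -
  have q: "subtraction_free.quasi_periodic m (a0 s)" "subtraction_free.multiplier m (a0 s) = 1" for s
    using subtraction_free.quasi_periodicI[of "a0 s" m 1] a0_periodic[of s]
    by (simp_all add: a0_def)
  have reg: "A.qq.regular a0" by (simp add: A.qq.regular_def q)
  then show "A.qq.periodic a0"
    by (simp add: A.qq.periodic_def A.qq.mult_eq q subtraction_free.quasi_periodic_const)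
  show "A.lifts_A initial a0"
    by (simp add: A.lifts_A_def a0_def)
qed

abbreviation "seed u \<equiv> apply_seq (R_word u) initial"

lemma seed_word:
  "same_quiver (seed u) initial" "positive_seed (seed u)"
  using quiver_preservingD(2,3)[OF weighted_Qm R_word_quiver_preserving] by auto

lemma lifts_word:
  "X.lifts_X (seed u) (X.qq.reflect_word u A0)"
  "A.lifts_A (seed u) (A.qq.reflect_word u a0)"
proof -
  show "X.lifts_X (seed u) (X.qq.reflect_word u A0)"
  proof (induction u)
    case (Cons s u)
    then show ?case
      using X.lifts_X_R_seq[OF seed_word X.qq.root_mult_reflect_word(1)[OF X_initial(1)] Cons m_pos]
      by simp
  qed (simp add: X_initial)
  show "A.lifts_A (seed u) (A.qq.reflect_word u a0)"
  proof (induction u)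
    case (Cons s u)
    have per: "A.qq.reflect_word u a0 t (j - int m) = A.qq.reflect_word u a0 t j" for t j
      by (simp add: A.qq.reflect_word_periodic(3)[OF A_initial(1)] a0_periodic)
    show ?case
      using A.lifts_A_R_seq[OF seed_word A.qq.reflect_word_periodic(1)[OF A_initial(1)] per _ Cons m_pos]
      by simp
  qed (simp add: A_initial)
qed

lemma same_seed_of_lifts:
  assumes S: "same_quiver S initial" "X.lifts_X S B" "A.lifts_A S a"
    and T: "same_quiver T initial" "X.lifts_X T D" "A.lifts_A T a'"
    and BD: "X.qq.proportional B D" and a: "a = a'"
  shows "same_seed S T"
proof -
  have q: "same_quiver S T" using S(1) T(1) same_quiver_sym same_quiver_trans by blast
  have V: "svert S = V" using S(1) by (simp add: same_quiver_def)
  have "sX S x = sX T x \<and> sA S x = sA T x" if "x \<in> V" for x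
    using that S(2,3) T(2,3) X.qq.proportional_ratio_quotient[OF BD] a
    by (cases x) (simp add: X.lifts_X_def A.lifts_A_def)
  then show ?thesis using q V by (simp add: same_seed_def)
qed

lemma same_seed_words:
  assumes "X.qq.proportional (X.qq.reflect_word u A0) (X.qq.reflect_word v A0)"
    and "A.qq.reflect_word u a0 = A.qq.reflect_word v a0"
  shows "same_seed (seed u) (seed v)"
  using same_seed_of_lifts[OF seed_word(1) lifts_word seed_word(1) lifts_word assms] .

text \<open>The lifting theorems describe the new seed by the reflected sequences, whatever the
  starting index; this is the independence of R(s) from \<open>i\<close>.\<close>

lemma R_seq_index: "i < m \<Longrightarrow> same_seed (apply_seq (R_seq m s i) initial) (seed [s])"
proof -
  assume i: "i < m"
  have pos: "positive_seed initial" by (rule positive_initial_seed[OF weighted_Qm])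
  show ?thesis
    by (rule same_seed_of_lifts[OF R_seq_same_quiver[OF same_quiver_refl i]
          X.lifts_X_R_seq[OF same_quiver_refl pos X_initial(1,3) i]
          A.lifts_A_R_seq[OF same_quiver_refl pos A_initial(1) a0_periodic refl A_initial(2) i]
          seed_word(1) lifts_word[of "[s]"]]) simp_all
qed

lemma cycle_prod_independent:
  assumes "s \<noteq> t" "cycle_prod s powi a * cycle_prod t powi b = 1"
  shows "a = 0 \<and> b = 0"
proof -
  have nz: "cycle_prod k \<noteq> 0" for k using cycle_prod_pos by (rule subtraction_free.pos_nonzero)
  have one: "casimir (\<lambda>k. if k = s then n else 0) = cycle_prod s powi n" for s n
    by (simp add: casimir_eq if_distrib[of "\<lambda>n. _ powi n"] cong: if_cong)
  have "casimir (\<lambda>k. (if k = s then a else 0) + (if k = t then b else 0)) = 1"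
    using assms(2) by (simp add: casimir_add one)
  then have "\<forall>k. (if k = s then a else 0) + (if k = t then b else 0) = 0"
    by (simp add: casimir_eq_1_iff)
  then show ?thesis using assms(1) by (metis add_0 add_0_right)
qed

text \<open>Types with one, two and three elements serve as sets of leaves. Folding yields the case
  \<open>C t s = -1\<close>; in \<open>braid_seed\<close> the opposite case follows by exchanging
  \<open>s\<close> and \<open>t\<close>.\<close>

lemma braid_word_rank_two:
  assumes st: "s \<noteq> t" and C: "C t s = -1" "C s t \<in> {-1, -2, -3}"
  shows "X.qq.proportional (X.qq.reflect_word (braid_word s t (coxeter_exponent C s t)) A0)
    (X.qq.reflect_word (braid_word t s (coxeter_exponent C s t)) A0)"
proof -
  have sh: "(shift s t = 1 \<and> shift t s = 0) \<or> (shift s t = 0 \<and> shift t s = 1)"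
    using shift_cases[OF st] C by simp
  have ind: "a = 0 \<and> b = 0" if "X.qq.mult A0 s powi a * X.qq.mult A0 t powi b = 1" for a b
    using cycle_prod_independent[OF st] that by (simp add: X_initial)
  note R = X.qq.reflect_word_rank_two[OF st C(1) _ _ sh X_initial(1) ind]
  consider "C s t = -1" | "C s t = -2" | "C s t = -3" using C by auto
  then show ?thesis
  proof cases
    case 1
    then show ?thesis using R[where 'l = unit] by simp
  next
    case 2
    then show ?thesis using R[where 'l = bool] by simp
  next
    case 3
    have "card (UNIV :: Enum.finite_3 set) = 3" by (simp add: UNIV_finite_3)
    then show ?thesis using R[where 'l = Enum.finite_3] 3 by simp
  qed
qed

lemma braid_seed:
  assumes st: "s \<noteq> t"
  shows "same_seed (seed (braid_word s t (coxeter_exponent C s t)))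
    (seed (braid_word t s (coxeter_exponent C s t)))"
proof (rule same_seed_words)
  have sym: "coxeter_exponent C t s = coxeter_exponent C s t"
    by (simp add: coxeter_exponent_def mult.commute)
  show "A.qq.reflect_word (braid_word s t (coxeter_exponent C s t)) a0
      = A.qq.reflect_word (braid_word t s (coxeter_exponent C s t)) a0"
    by (intro ext) (simp add: A.qq.reflect_word_periodic(3)[OF A_initial(1)] A.qq.weight_shift_braid[OF st])
  show "X.qq.proportional (X.qq.reflect_word (braid_word s t (coxeter_exponent C s t)) A0)
    (X.qq.reflect_word (braid_word t s (coxeter_exponent C s t)) A0)"
    using cartan st
  proof (cases rule: cartan_rank_two_cases)
    case zero
    then show ?thesis by (simp add: eval_nat_numeral X.qq.reflect_commute[OF st])
  next
    case inf
    then show ?thesis by simp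
  next
    case one
    then show ?thesis by (intro braid_word_rank_two[OF st]) simp_all
  next
    case two'
    then show ?thesis by (intro braid_word_rank_two[OF st]) simp_all
  next
    case three'
    then show ?thesis by (intro braid_word_rank_two[OF st]) simp_all
  next
    case two
    then show ?thesis
      by (intro X.qq.proportional_sym[OF braid_word_rank_two[OF st[symmetric], unfolded sym]]) simp_all
  next
    case three
    then show ?thesis
      by (intro X.qq.proportional_sym[OF braid_word_rank_two[OF st[symmetric], unfolded sym]]) simp_all
  qed
qed

lemma square_seed: "same_seed (seed [s, s]) (seed [])"
proof (rule same_seed_words)
  have "cycle_prod s \<noteq> 1"
    using cycle_prod_pos[of s] casimir_eq_1_iff[of "simple_root s"]
    by (simp add: casimir_eq simple_root_def of_bool_def if_distrib[of "\<lambda>n. _ powi n"] cong: if_cong)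
  then show "X.qq.proportional (X.qq.reflect_word [s, s] A0) (X.qq.reflect_word [] A0)"
    using X.qq.reflect_square[OF X_initial(1), of s] by (simp add: X_initial)
  show "A.qq.reflect_word [s, s] a0 = A.qq.reflect_word [] a0"
    by (intro ext)
      (simp only: A.qq.reflect_word_periodic(3)[OF A_initial(1)] A.qq.weight_shift_square A.qq.weight_shift.simps(1))
qed

text \<open>Equality of the actions is built into the congruence so that \<open>eq_act\<close>
  holds. The relations come from \<open>braid_seed\<close> and \<open>square_seed\<close>, and
  compatibility with suffixes is naturality of mutations.\<close>

theorem seed_eq_if_act_eq:
  assumes "weyl_act C u = weyl_act C v"
  shows "same_seed (seed u) (seed v)"
proof -
  interpret weyl_word_congruence C "\<lambda>u v. weyl_act C u = weyl_act C v \<and> same_seed (seed u) (seed v)"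
  proof
    fix u v w
    assume uv: "weyl_act C u = weyl_act C v \<and> same_seed (seed u) (seed v)"
    then show "weyl_act C v = weyl_act C u \<and> same_seed (seed v) (seed u)"
      by (auto dest: same_seed_sym)
    show "weyl_act C (w @ u) = weyl_act C (w @ v) \<and> same_seed (seed (w @ u)) (seed (w @ v))"
      using uv same_seed_append_left[OF weighted_Qm R_word_quiver_preserving, of "R_word u" "R_word v" w]
      unfolding R_word_simps by (auto intro!: ext)
    show "weyl_act C (u @ w) = weyl_act C (v @ w) \<and> same_seed (seed (u @ w)) (seed (v @ w))"
      using uv same_seed_append_right[OF weighted_Qm R_word_quiver_preserving R_word_quiver_preserving
          R_word_quiver_preserving, of u v w]
      unfolding R_word_simps by (auto intro!: ext)
  next
    fix u v w
    assume "weyl_act C u = weyl_act C v \<and> same_seed (seed u) (seed v)"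
      "weyl_act C v = weyl_act C w \<and> same_seed (seed v) (seed w)"
    then show "weyl_act C u = weyl_act C w \<and> same_seed (seed u) (seed w)"
      using same_seed_trans[of "seed u" "seed v" "seed w"] by simp
  next
    fix s
    show "weyl_act C [s, s] = weyl_act C [] \<and> same_seed (seed [s, s]) (seed [])"
      using square_seed[of s] simple_reflection_involution[OF cartan] by (auto intro!: ext)
  next
    fix s t :: 's
    assume st: "s \<noteq> t"
    show "weyl_act C (braid_word s t (coxeter_exponent C s t))
        = weyl_act C (braid_word t s (coxeter_exponent C s t)) \<and>
      same_seed (seed (braid_word s t (coxeter_exponent C s t))) (seed (braid_word t s (coxeter_exponent C s t)))"
      using braid_seed[OF st] weyl_act_braid[OF cartan st] by (blast intro: ext)
  qed (use cartan in auto)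
  show ?thesis using eq_iff_act[of u v] assms by simp
qed

text \<open>The product telescopes to a quotient of two ratios one period apart, which is the
  multiplier.\<close>

lemma seed_cycle_prod: "(\<Prod>l<m. sX (seed u) (s, l)) = X.qq.mult (X.qq.reflect_word u A0) s"
proof -
  let ?B = "X.qq.reflect_word u A0"
  note T = X.qq.quasi_periodic_ratio_mult[OF X.qq.root_mult_reflect_word(1)[OF X_initial(1)], of u s]
  have nz: "X.qq.ratio ?B s j \<noteq> 0" for j using subtraction_free.quasi_periodicD(2)[OF T(1)] .
  have "(\<Prod>l<n. X.qq.ratio ?B s (int l - 1) / X.qq.ratio ?B s (int l))
      = X.qq.ratio ?B s (-1) / X.qq.ratio ?B s (int n - 1)" for n
    using nz by (induction n) simp_all
  moreover have "(\<Prod>l<m. sX (seed u) (s, l))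
      = (\<Prod>l<m. X.qq.ratio ?B s (int l - 1) / X.qq.ratio ?B s (int l))"
    by (rule prod.cong) (use lifts_word(1)[of u] in \<open>auto simp: X.lifts_X_def\<close>)
  moreover have "X.qq.ratio ?B s (-1) = X.qq.mult ?B s * X.qq.ratio ?B s (int m - 1)"
    using subtraction_free.quasi_periodicD(3)[OF T(1), of "int m - 1"] by (simp add: T(2))
  ultimately show ?thesis using nz by simp
qed

text \<open>Cycle products of a seed are multipliers, so the rule for root multipliers applies. The
  word \<open>rev u\<close> represents the inverse, as equivariance requires.\<close>

theorem pullback_casimir:
  "pullback_X (Qm m Q) (cmg_class (Qm m Q) (R_word u)) (casimir b) = casimir (weyl_act C (rev u) b)"
proof -
  have "pullback_X (Qm m Q) (cmg_class (Qm m Q) (R_word u)) (casimir b)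
      = (\<Prod>x\<in>V. sX (seed u) x powi b (fst x))"
    unfolding casimir_def by (rule pullback_laurent_monomial(1)[OF weighted_Qm R_word_quiver_preserving])
  also have "\<dots> = (\<Prod>s\<in>UNIV. (\<Prod>l<m. sX (seed u) (s, l)) powi b s)"
    unfolding prod_V by (simp add: power_int_prod)
  also have "\<dots> = X.qq.root_mult (X.qq.reflect_word u A0) b"
    by (simp add: seed_cycle_prod X.qq.root_mult_def)
  also have "\<dots> = X.qq.root_mult A0 (weyl_act C (rev u) b)"
    by (rule X.qq.root_mult_reflect_word(2)[OF X_initial(1)])
  also have "\<dots> = casimir (weyl_act C (rev u) b)"
    by (simp add: X.qq.root_mult_def X_initial casimir_eq)
  finally show ?thesis .
qed

text \<open>A vertex meets another cycle only through oriented triangles, each of which contributes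
  one arrow in either direction; on its own cycle it has one predecessor and one successor. The
  column sums give the Casimir condition and the row sums peripherality.\<close>

lemma sum_exchange_cycle:
  assumes "x \<in> V"
  shows "(\<Sum>l<m. \<epsilon> x (t, l)) = 0" "(\<Sum>l<m. \<epsilon> (t, l) x) = 0"
proof -
  obtain s i where x: "x = (s, i)" "i < m" using assms by (cases x) auto
  have src: "source t (s, i) < m" using source_less[of "(s, i)" t] x by simp
  have d: "(\<Sum>l<m. of_bool (l = c) :: int) = 1" if "c < m" for c
    using that by (simp add: of_bool_def)
  have e: "(\<Sum>l<m. of_bool (i = Suc l mod m) :: int) = 1"
  proof -
    obtain j where j: "j < m" "i = (1 + j) mod m" using ex_cycle_index[of 1 i] m x(2) by auto
    have "i = Suc l mod m \<longleftrightarrow> l = j" if "l < m" for l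
      using Suc_mod_eq_iff[OF that j(1)] j(2) by auto
    then have "(\<Sum>l<m. of_bool (i = Suc l mod m) :: int) = (\<Sum>l<m. of_bool (l = j))"
      by (intro sum.cong) auto
    then show ?thesis using d[OF j(1)] by simp
  qed
  have m1: "k mod m < m" for k using m_pos by simp
  show "(\<Sum>l<m. \<epsilon> x (t, l)) = 0"
  proof (cases "s = t")
    case True
    then show ?thesis using d[OF m1[of "Suc i"]] e by (simp add: x exchange_Qm_same sum_subtractf)
  next
    case False
    then have "(\<Sum>l<m. \<epsilon> x (t, l)) = (\<Sum>l<m. \<bar>eps s t\<bar> *
        (of_bool (l = source t (s, i)) - of_bool (l = Suc (source t (s, i)) mod m)))"
      using x by (intro sum.cong) (auto simp: exchange_Qm_source(2))
    also have "\<dots> = 0"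
      unfolding sum_distrib_left[symmetric] sum_subtractf d[OF src] d[OF m1] by simp
    finally show ?thesis .
  qed
  show "(\<Sum>l<m. \<epsilon> (t, l) x) = 0"
  proof (cases "s = t")
    case True
    then show ?thesis using d[OF m1[of "Suc i"]] e by (simp add: x exchange_Qm_same sum_subtractf)
  next
    case False
    then have "(\<Sum>l<m. \<epsilon> (t, l) x) = (\<Sum>l<m. \<bar>eps t s\<bar> *
        (of_bool (l = Suc (source t (s, i)) mod m) - of_bool (l = source t (s, i))))"
      using x by (intro sum.cong) (auto simp: exchange_Qm_source(1))
    also have "\<dots> = 0"
      unfolding sum_distrib_left[symmetric] sum_subtractf d[OF src] d[OF m1] by simp
    finally show ?thesis .
  qed
qed

lemma casimir_carrier: "casimir b \<in> carrier (monomial_casimirs (Qm m Q))"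
proof -
  have "(\<Sum>x\<in>V. b (fst x) * \<epsilon> x j * wt (Qm m Q) j) = 0" if "j \<in> V" for j
  proof -
    have "(\<Sum>x\<in>V. b (fst x) * \<epsilon> x j * wt (Qm m Q) j) = (\<Sum>s\<in>UNIV. b s * (\<Sum>l<m. \<epsilon> (s, l) j) * wt (Qm m Q) j)"
      unfolding sum_V by (simp add: sum_distrib_left sum_distrib_right)
    then show ?thesis by (simp add: sum_exchange_cycle[OF that])
  qed
  then show ?thesis unfolding monomial_casimirs_def casimir_def by auto
qed

text \<open>All A-variables of one cycle are multiplied by the same factor, and in
  \<open>p_star\<close> the exponents along each cycle add up to zero.\<close>

theorem R_word_peripheral:
  assumes "k \<in> V"
  shows "pullback_A (Qm m Q) (cmg_class (Qm m Q) (R_word u)) (p_star (Qm m Q) k) = p_star (Qm m Q) k"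
proof -
  define f where "f t = A.qq.root_potential a0 (A.qq.weight_shift u t)" for t
  have f_nz: "f t \<noteq> 0" for t
    using A.qq.potential_nonzero[OF A_initial(1)] by (simp add: f_def A.qq.root_potential_def)
  have sA: "sA (seed u) x = ratfun_var x * f (fst x)" if "x \<in> V" for x
    using that lifts_word(2)[of u] A_initial(2)
    by (cases x) (simp add: A.lifts_A_def A.qq.reflect_word_periodic(3)[OF A_initial(1)] f_def)
  have "pullback_A (Qm m Q) (cmg_class (Qm m Q) (R_word u)) (p_star (Qm m Q) k)
      = (\<Prod>x\<in>V. sA (seed u) x powi \<epsilon> k x)"
    unfolding p_star_def by (rule pullback_laurent_monomial(2)[OF weighted_Qm R_word_quiver_preserving])
  also have "\<dots> = p_star (Qm m Q) k * (\<Prod>x\<in>V. f (fst x) powi \<epsilon> k x)"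
    by (simp add: sA power_int_mult_distrib prod.distrib p_star_def)
  also have "(\<Prod>x\<in>V. f (fst x) powi \<epsilon> k x) = (\<Prod>t\<in>UNIV. f t powi (\<Sum>l<m. \<epsilon> k (t, l)))"
    unfolding prod_V by (simp add: power_int_sum[OF f_nz])
  also have "\<dots> = 1" by (simp add: sum_exchange_cycle[OF assms])
  finally show ?thesis by simp
qed

section \<open>The embedding of the Weyl group\<close>

definition weyl_hom :: "(('s \<Rightarrow> int) \<Rightarrow> 's \<Rightarrow> int) \<Rightarrow> ('s \<times> nat) mseq set" where
  "weyl_hom w = cmg_class (Qm m Q) (R_word (SOME u. weyl_act C u = w))"

lemma weyl_hom_eq: "weyl_hom (weyl_act C u) = cmg_class (Qm m Q) (R_word u)"
proof -
  have "weyl_act C (SOME v. weyl_act C v = weyl_act C u) = weyl_act C u" by (rule someI) simp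
  then show ?thesis
    unfolding weyl_hom_def
    by (subst cmg_class_eq_iff[OF weighted_Qm R_word_quiver_preserving R_word_quiver_preserving])
      (rule seed_eq_if_act_eq)
qed

lemma weyl_hom_mon: "weyl_hom \<in> mon (weyl_group C) (peripheral_group (Qm m Q))"
proof -
  have carrier: "weyl_hom w \<in> carrier (peripheral_group (Qm m Q))" if "w \<in> carrier (weyl_group C)" for w
    using that R_word_peripheral cmg_class_carrier[OF weighted_Qm R_word_quiver_preserving]
    by (auto simp: weyl_group_eq[OF cartan] weyl_hom_eq peripheral_group_def)
  have mult: "weyl_hom (v \<otimes>\<^bsub>weyl_group C\<^esub> w) = weyl_hom v \<otimes>\<^bsub>peripheral_group (Qm m Q)\<^esub> weyl_hom w"
    if "v \<in> carrier (weyl_group C)" "w \<in> carrier (weyl_group C)" for v w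
    using that cmg_class_mult[OF weighted_Qm R_word_quiver_preserving R_word_quiver_preserving]
    by (auto simp: weyl_group_eq[OF cartan] weyl_hom_eq peripheral_group_def weyl_group_mult[OF cartan])
  have "inj_on weyl_hom (carrier (weyl_group C))"
  proof (rule inj_onI)
    fix v w assume "v \<in> carrier (weyl_group C)" "w \<in> carrier (weyl_group C)" and eq: "weyl_hom v = weyl_hom w"
    then obtain p q where pq: "v = weyl_act C p" "w = weyl_act C q"
      by (auto simp: weyl_group_eq[OF cartan])
    \<comment> \<open>The pullbacks of the Casimirs recover the action on the root lattice, so equal
      classes come from equal group elements.\<close>
    have "casimir (weyl_act C (rev p) b) = casimir (weyl_act C (rev q) b)" for b
      using eq by (simp add: pq weyl_hom_eq flip: pullback_casimir)
    then have "weyl_act C (rev p) b = weyl_act C (rev q) b" for b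
      using casimir_inj by (metis injD)
    then have "weyl_act C (rev p) (weyl_act C q b) = b" for b
      by (simp add: weyl_act_rev_cancel[OF cartan])
    then show "v = w"
      unfolding pq by (metis ext weyl_act_rev_cancel(2)[OF cartan])
  qed
  then show ?thesis
    using carrier mult by (auto simp: mon_def hom_def)
qed

end

theorem theorem1:
  fixes C :: "'s::finite \<Rightarrow> 's \<Rightarrow> int"
    and d :: "'s \<Rightarrow> int"
    and Q :: "'s wquiver"
    and m :: nat
  assumes "generalized_cartan C"
    and "symmetrized_by C d"
    and "coxeter_quiver C d Q"
    and "m \<ge> 2"
  shows "\<exists>\<phi>. \<phi> \<in> mon (weyl_group C) (peripheral_group (Qm m Q)) \<and>
    (\<forall>s. \<forall>i<m. \<phi> (simple_reflection C s) = cmg_class (Qm m Q) (R_seq m s i)) \<and>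
    (\<exists>\<iota>. \<iota> \<in> mon root_lattice (monomial_casimirs (Qm m Q)) \<and>
      (\<forall>w\<in>carrier (weyl_group C). \<forall>v\<in>carrier root_lattice.
        pullback_X (Qm m Q) (\<phi> w) (\<iota> v) = \<iota> ((inv\<^bsub>weyl_group C\<^esub> w) v)))"
proof -
  interpret coxeter_setting C d Q m
    by unfold_locales (use assms in auto)
  have "weyl_hom (simple_reflection C s) = cmg_class (Qm m Q) (R_seq m s i)" if i: "i < m" for s i
  proof -
    have "weyl_act C [s] = simple_reflection C s" by (simp add: fun_eq_iff)
    then have "weyl_hom (simple_reflection C s) = cmg_class (Qm m Q) (R_word [s])"
      using weyl_hom_eq[of "[s]"] by simp
    also have "\<dots> = cmg_class (Qm m Q) (R_seq m s i)"
      unfolding cmg_class_eq_iff[OF weighted_Qm R_word_quiver_preserving R_seq_quiver_preserving[OF i]]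
      by (rule same_seed_sym[OF R_seq_index[OF i]])
    finally show ?thesis .
  qed
  moreover have "casimir \<in> mon root_lattice (monomial_casimirs (Qm m Q))"
    using casimir_inj casimir_carrier
    by (auto simp: mon_def hom_def root_lattice_def casimir_add monomial_casimirs_def[of "Qm m Q", THEN arg_cong[of _ _ mult]]
        intro: inj_on_subset)
  moreover have "pullback_X (Qm m Q) (weyl_hom w) (casimir v) = casimir ((inv\<^bsub>weyl_group C\<^esub> w) v)"
    if "w \<in> carrier (weyl_group C)" for w v
    using that by (auto simp: weyl_group_eq[OF assms(1)] weyl_hom_eq pullback_casimir weyl_group_inv[OF assms(1)])
  ultimately show ?thesis using weyl_hom_mon by blast
qed

end
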